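(* Let $p$ and $d$ be distinct odd primes. Let $K$ be a finite unramified extension of $\mathbb Q_p$ with residue field $F_q$, where $q=p^m$, and let $$f(x)=(x+p)^d-p\in K[x].$$ Let $T$ be the $d$-ary rooted tree of iterated preimages of $0$ under $f$, let $\mathcal P_d$ be its space of infinite paths, and consider the arboreal representation $\rho_{f,0}$. Let $BS(1,q)=\langle\sigma,\tau\mid\sigma\tau\sigma^{-1}=\tau^q\rangle$. Then there exist a sequence of integers $\{c_n\}$ and a non-decreasing unbounded sequence of integers $\{s_n\}$ such that the Galois group of the extension $K(f^{-n}(0))/K$ is given by $$H_n=\langle\tau,\sigma\mid\sigma\tau\sigma^{-1}=\tau^q,\ \tau^{c_nd^n}=1,\ \sigma^{s_n}=1\rangle,$$ so that $H_n=BS(1,q)/C_n$, where $C_n=\langle\tau^{c_nd^n},\sigma^{s_n}\rangle$; these identifications are compatible with the restriction maps $H_{n+1}\to H_n$, so that $G=BS(1,q)$ acts on $T$ and on $\mathcal P_d$ through the quotients $H_n$. Moreover, there is a choice of a path $\mathbf v\in\mathcal P_d$ such that the associated group chain $\{G_n\}_{n\ge0}$ of this action consists of the groups $$G_n=\langle\tau^{c_nd^n},\sigma\rangle\subset BS(1,q),\qquad G_0=G=BS(1,q).$$ For each $n\ge0$ the discriminant group $\mathcal D^n_{\mathbf v}$ is a Cantor group (an infinite profinite group that is topologically a Cantor set), and the homomorphism $\mathcal D^n_{\mathbf v}\to\mathcal D^k_{\mathbf v}$ is an isomorphism for all $k>n$; so the action is stable.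
   Context: Tree of preimages. $f^n$ denotes the $n$-th iterate of $f$. Put $V_0=\{0\}$ and $V_n=f^{-n}(0)$ for $n\ge1$, the set of roots of $f^n$ in a separable closure $K^{\rm sep}$ of $K$. The tree $T$ has vertex set $\bigsqcup_{n\ge0}V_n$, and $b\in V_{n+1}$ is joined by an edge to $c\in V_n$ if and only if $f(b)=c$. Here $|V_n|=d^n$ and $T$ is a $d$-ary rooted tree. $\mathcal P_d\subset\prod_{n\ge0}V_n$ is the set of sequences $(v_n)_{n\ge0}$ with $v_n\in V_n$ and $v_n,v_{n+1}$ joined by an edge for all $n$, with the topology induced by the product of the discrete topologies; it is a Cantor set. Arboreal representation. $\mathrm{Gal}(K^{\rm sep}/K)$ permutes each $V_n$ compatibly with the edges of $T$, through the quotient $H_n=\mathrm{Gal}(K(f^{-n}(0))/K)$, giving $\rho_{f,0}:\mathrm{Gal}(K^{\rm sep}/K)\to H_\infty=\varprojlim\{H_{n+1}\to H_n\}\subseteq\mathrm{Aut}(T)$, where the maps $H_{n+1}\to H_n$ are restrictions of automorphisms. Associated group chain, discriminant groups, stability. For an action of a discrete group $G$ on $T$ that is transitive on each $V_n$ and a path $\mathbf v=(v_n)_{n\ge0}$, the associated group chain is $G_n=\{g\in G\mid g\cdot v_n=v_n\}$, $n\ge0$. For $j\ge n\ge0$ let $C^n_j=\bigcap_{g\in G_n}gG_jg^{-1}$. The discriminant groups are $$\mathcal D^n_{\mathbf v}=\varprojlim\{G_{j+1}/C^n_{j+1}\to G_j/C^n_j\mid j\ge n\}.$$ For $k\ge n$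 the inclusions $C^n_j\subset C^k_j$ ($j\ge k$) induce surjective homomorphisms $G_j/C^n_j\to G_j/C^k_j$ and, in the limit, surjective homomorphisms $\mathcal D^n_{\mathbf v}\to\mathcal D^k_{\mathbf v}$; these are the homomorphisms in the claim. The action is called stable if there is $n_0\ge0$ such that $\mathcal D^n_{\mathbf v}\to\mathcal D^{n+1}_{\mathbf v}$ is an isomorphism for all $n\ge n_0$. *)

theory Defs
  imports "HOL-Analysis.Analysis" "HOL-Algebra.Algebra" "HOL-Algebra.Algebraic_Closure_Type"
begin

section \<open>Finite unramified extensions of the p-adic numbers\<close>

definition padic_abs :: "nat \<Rightarrow> rat \<Rightarrow> real" where
  "padic_abs p r =
     (if r = 0 then 0
      else real p powi (int (multiplicity (int p) (snd (quotient_of r)))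
                        - int (multiplicity (int p) (fst (quotient_of r)))))"

text \<open>The subfield \<open>F\<close> of \<open>'k\<close>, with the absolute value \<open>v\<close>, is a copy of the field of
  p-adic numbers: a completion of the rationals for the p-adic absolute value.
  The values of \<open>v\<close> outside \<open>F\<close> are irrelevant.\<close>

definition padic_field :: "nat \<Rightarrow> 'k::field_char_0 set \<Rightarrow> ('k \<Rightarrow> real) \<Rightarrow> bool" where
  "padic_field p F v \<longleftrightarrow>
     subfield F (ring_of_type_algebra :: 'k ring) \<and>
     (\<forall>x\<in>F. v x \<ge> 0 \<and> (v x = 0 \<longleftrightarrow> x = 0)) \<and>
     (\<forall>x\<in>F. \<forall>y\<in>F. v (x * y) = v x * v y \<and> v (x + y) \<le> v x + v y) \<and>
     (\<forall>r. v (of_rat r) = padic_abs p r) \<and>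
     (\<forall>x\<in>F. \<forall>e>0. \<exists>r. v (x - of_rat r) < e) \<and>
     (\<forall>S :: nat \<Rightarrow> 'k.
        (\<forall>i. S i \<in> F) \<and> (\<forall>e>0. \<exists>N. \<forall>i\<ge>N. \<forall>j\<ge>N. v (S i - S j) < e)
        \<longrightarrow> (\<exists>x\<in>F. (\<lambda>i. v (S i - x)) \<longlonglongrightarrow> 0))"

text \<open>For a finite extension \<open>K\<close> (the whole type \<open>'k\<close>) of \<open>F\<close>, the ring of integers of \<open>K\<close>
  is the integral closure in \<open>K\<close> of the ring of integers of \<open>F\<close>.\<close>

definition int_ring :: "'k::field_char_0 set \<Rightarrow> ('k \<Rightarrow> real) \<Rightarrow> 'k ring" where
  "int_ring F v = ring_of_type_algebra
     \<lparr>carrier := {x. \<exists>P :: 'k poly. Polynomial.lead_coeff P = 1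
                     \<and> (\<forall>i. Polynomial.coeff P i \<in> F \<and> v (Polynomial.coeff P i) \<le> 1)
                     \<and> poly P x = 0}\<rparr>"

text \<open>The ring of integers is local, so its nonunits form its maximal ideal.\<close>

definition int_max_ideal :: "'k::field_char_0 set \<Rightarrow> ('k \<Rightarrow> real) \<Rightarrow> 'k set" where
  "int_max_ideal F v = carrier (int_ring F v) - Units (int_ring F v)"

definition residue_field :: "'k::field_char_0 set \<Rightarrow> ('k \<Rightarrow> real) \<Rightarrow> 'k set ring" where
  "residue_field F v = int_ring F v Quot int_max_ideal F v"

text \<open>Ramification index 1: \<open>p\<close> generates the maximal ideal. Residue field extensions are
  automatically separable, residue fields being finite.\<close>

definition unramified :: "nat \<Rightarrow> 'k::field_char_0 set \<Rightarrow> ('k \<Rightarrow> real) \<Rightarrow> bool" where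
  "unramified p F v \<longleftrightarrow> int_max_ideal F v = cgenideal (int_ring F v) (of_nat p)"


section \<open>The tree of preimages of 0 and its automorphisms\<close>

definition sep_closure :: "'k::field alg_closure set" where
  "sep_closure = {x. \<exists>P :: 'k poly. P \<noteq> 0 \<and> coprime P (pderiv P)
                     \<and> poly (map_poly to_ac P) x = 0}"

definition ac_map :: "'k::field poly \<Rightarrow> 'k alg_closure \<Rightarrow> 'k alg_closure" where
  "ac_map f x = poly (map_poly to_ac f) x"

definition preims :: "'k::field poly \<Rightarrow> nat \<Rightarrow> 'k alg_closure set" where
  "preims f n = {x \<in> sep_closure. (ac_map f ^^ n) x = 0}"

definition tree_verts :: "'k::field poly \<Rightarrow> (nat \<times> 'k alg_closure) set" where
  "tree_verts f = (SIGMA n:UNIV. preims f n)"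

definition tree_adj ::
  "'k::field poly \<Rightarrow> nat \<times> 'k alg_closure \<Rightarrow> nat \<times> 'k alg_closure \<Rightarrow> bool" where
  "tree_adj f a b \<longleftrightarrow>
     (fst a = Suc (fst b) \<and> ac_map f (snd a) = snd b) \<or>
     (fst b = Suc (fst a) \<and> ac_map f (snd b) = snd a)"

definition tree_aut ::
  "'k::field poly \<Rightarrow> (nat \<times> 'k alg_closure \<Rightarrow> nat \<times> 'k alg_closure) monoid" where
  "tree_aut f = BijGroup (tree_verts f)
     \<lparr>carrier := {\<phi> \<in> Bij (tree_verts f).
        (\<forall>a\<in>tree_verts f. fst (\<phi> a) = fst a) \<and>
        (\<forall>a\<in>tree_verts f. \<forall>b\<in>tree_verts f. tree_adj f (\<phi> a) (\<phi> b) \<longleftrightarrow> tree_adj f a b)}\<rparr>"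

definition path_space :: "'k::field poly \<Rightarrow> (nat \<Rightarrow> 'k alg_closure) set" where
  "path_space f = {v. (\<forall>n. v n \<in> preims f n) \<and> (\<forall>n. tree_adj f (n, v n) (Suc n, v (Suc n)))}"

definition path_topology :: "'k::field poly \<Rightarrow> (nat \<Rightarrow> 'k alg_closure) topology" where
  "path_topology f =
     subtopology (product_topology (\<lambda>n. discrete_topology (preims f n)) UNIV) (path_space f)"


section \<open>Inverse limits of groups\<close>

text \<open>The limit of \<open>A n \<leftarrow> A (n+1) \<leftarrow> \<dots>\<close>, with bonding maps \<open>\<pi> j : A (j+1) \<rightarrow> A j\<close>.\<close>

definition inv_limit ::
  "nat \<Rightarrow> (nat \<Rightarrow> 'a monoid) \<Rightarrow> (nat \<Rightarrow> 'a \<Rightarrow> 'a) \<Rightarrow> (nat \<Rightarrow> 'a) monoid" where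
  "inv_limit n A \<pi> = product_group {n..} A
     \<lparr>carrier := {x \<in> carrier (product_group {n..} A). \<forall>j\<ge>n. \<pi> j (x (Suc j)) = x j}\<rparr>"

definition inv_limit_topology ::
  "nat \<Rightarrow> (nat \<Rightarrow> 'a monoid) \<Rightarrow> (nat \<Rightarrow> 'a \<Rightarrow> 'a) \<Rightarrow> (nat \<Rightarrow> 'a) topology" where
  "inv_limit_topology n A \<pi> =
     subtopology (product_topology (\<lambda>j. discrete_topology (carrier (A j))) {n..})
       (carrier (inv_limit n A \<pi>))"


section \<open>Galois groups of the iterates\<close>

definition preim_field :: "'k::field poly \<Rightarrow> nat \<Rightarrow> 'k alg_closure set" where
  "preim_field f n = generate_field ring_of_type_algebra (range to_ac \<union> preims f n)"

definition galois_group ::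
  "'k::field alg_closure set \<Rightarrow> ('k alg_closure \<Rightarrow> 'k alg_closure) monoid" where
  "galois_group L = BijGroup L
     \<lparr>carrier := {\<phi> \<in> Bij L.
        \<phi> \<in> ring_hom (ring_of_type_algebra\<lparr>carrier := L\<rparr>) (ring_of_type_algebra\<lparr>carrier := L\<rparr>) \<and>
        (\<forall>a. \<phi> (to_ac a) = to_ac a)}\<rparr>"

definition iter_galois :: "'k::field poly \<Rightarrow> nat \<Rightarrow> ('k alg_closure \<Rightarrow> 'k alg_closure) monoid" where
  "iter_galois f n = galois_group (preim_field f n)"

text \<open>The image of the arboreal representation: the inverse limit of the restriction maps.\<close>

definition arboreal_group ::
  "'k::field poly \<Rightarrow> (nat \<Rightarrow> 'k alg_closure \<Rightarrow> 'k alg_closure) monoid" where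
  "arboreal_group f = inv_limit 0 (iter_galois f) (\<lambda>n \<phi>. restrict \<phi> (preim_field f n))"

definition tree_act :: "'k::field poly \<Rightarrow> (nat \<Rightarrow> 'k alg_closure \<Rightarrow> 'k alg_closure) \<Rightarrow>
    nat \<times> 'k alg_closure \<Rightarrow> nat \<times> 'k alg_closure" where
  "tree_act f \<theta> = (\<lambda>a\<in>tree_verts f. (fst a, \<theta> (fst a) (snd a)))"

definition path_act :: "'k::field poly \<Rightarrow> (nat \<Rightarrow> 'k alg_closure \<Rightarrow> 'k alg_closure) \<Rightarrow>
    (nat \<Rightarrow> 'k alg_closure) \<Rightarrow> (nat \<Rightarrow> 'k alg_closure)" where
  "path_act f \<theta> = (\<lambda>v\<in>path_space f. \<lambda>n. \<theta> n (v n))"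


section \<open>Group presentations\<close>

text \<open>The letter \<open>(g, True)\<close> stands for the generator \<open>g\<close>, and \<open>(g, False)\<close> for its inverse.
  A relation \<open>u = w\<close> is the pair \<open>(u, w)\<close>.\<close>

type_synonym 'g word = "('g \<times> bool) list"

inductive pres_cong :: "('g word \<times> 'g word) set \<Rightarrow> 'g word \<Rightarrow> 'g word \<Rightarrow> bool" for R where
  cong_refl: "pres_cong R u u"
| cong_sym: "pres_cong R u w \<Longrightarrow> pres_cong R w u"
| cong_trans: "pres_cong R u w \<Longrightarrow> pres_cong R w z \<Longrightarrow> pres_cong R u z"
| cong_append: "pres_cong R u u' \<Longrightarrow> pres_cong R w w' \<Longrightarrow> pres_cong R (u @ w) (u' @ w')"
| cong_cancel: "pres_cong R [(g, b), (g, \<not> b)] []"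
| cong_rel: "(u, w) \<in> R \<Longrightarrow> pres_cong R u w"

definition pres_class :: "('g word \<times> 'g word) set \<Rightarrow> 'g word \<Rightarrow> 'g word set" where
  "pres_class R u = {w. pres_cong R u w}"

definition presented_group :: "('g word \<times> 'g word) set \<Rightarrow> 'g word set monoid" where
  "presented_group R =
     \<lparr>carrier = range (pres_class R),
      mult = (\<lambda>A B. {z. \<exists>u\<in>A. \<exists>w\<in>B. pres_cong R (u @ w) z}),
      one = pres_class R []\<rparr>"

definition pres_gen :: "('g word \<times> 'g word) set \<Rightarrow> 'g \<Rightarrow> 'g word set" where
  "pres_gen R g = pres_class R [(g, True)]"

definition word_pow :: "'g \<Rightarrow> int \<Rightarrow> 'g word" where
  "word_pow g k = replicate (nat \<bar>k\<bar>) (g, k \<ge> 0)"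

datatype bs_gen = GSigma | GTau

definition bs_rels :: "nat \<Rightarrow> (bs_gen word \<times> bs_gen word) set" where
  "bs_rels q = {([(GSigma, True), (GTau, True), (GSigma, False)], word_pow GTau (int q))}"

definition BS :: "nat \<Rightarrow> bs_gen word set monoid" where
  "BS q = presented_group (bs_rels q)"

definition bs_sigma :: "nat \<Rightarrow> bs_gen word set" where
  "bs_sigma q = pres_gen (bs_rels q) GSigma"

definition bs_tau :: "nat \<Rightarrow> bs_gen word set" where
  "bs_tau q = pres_gen (bs_rels q) GTau"

definition bs_quot_rels :: "nat \<Rightarrow> int \<Rightarrow> int \<Rightarrow> (bs_gen word \<times> bs_gen word) set" where
  "bs_quot_rels q N s = bs_rels q \<union> {(word_pow GTau N, []), (word_pow GSigma s, [])}"


section \<open>Group chains and discriminant groups\<close>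

definition group_chain ::
  "'g monoid \<Rightarrow> ('g \<Rightarrow> nat \<times> 'x \<Rightarrow> nat \<times> 'x) \<Rightarrow> (nat \<Rightarrow> 'x) \<Rightarrow> nat \<Rightarrow> 'g set" where
  "group_chain G \<alpha> v n = stabilizer G \<alpha> (n, v n)"

text \<open>In the following, \<open>H\<close> is a group chain in the group \<open>G\<close>.\<close>

definition chain_core :: "'g monoid \<Rightarrow> (nat \<Rightarrow> 'g set) \<Rightarrow> nat \<Rightarrow> nat \<Rightarrow> 'g set" where
  "chain_core G H n j = (\<Inter>g\<in>H n. (\<lambda>h. g \<otimes>\<^bsub>G\<^esub> h \<otimes>\<^bsub>G\<^esub> inv\<^bsub>G\<^esub> g) ` H j)"

definition discr_quot :: "'g monoid \<Rightarrow> (nat \<Rightarrow> 'g set) \<Rightarrow> nat \<Rightarrow> nat \<Rightarrow> 'g set monoid" where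
  "discr_quot G H n j = (G\<lparr>carrier := H j\<rparr>) Mod chain_core G H n j"

text \<open>The coset \<open>C\<^sup>n\<^sub>i g\<close> with \<open>g\<close> in \<open>H i\<close>, \<open>i \<ge> j\<close>, is sent to \<open>C\<^sup>k\<^sub>j g = C\<^sup>k\<^sub>j (C\<^sup>n\<^sub>i g)\<close>.
  This is well defined as soon as \<open>C\<^sup>n\<^sub>i \<subseteq> C\<^sup>k\<^sub>j\<close>, and gives both the bonding maps
  (\<open>k = n\<close>, \<open>i = j + 1\<close>) and the maps between discriminant groups (\<open>k \<ge> n\<close>, \<open>i = j\<close>).\<close>

definition core_coset :: "'g monoid \<Rightarrow> (nat \<Rightarrow> 'g set) \<Rightarrow> nat \<Rightarrow> nat \<Rightarrow> 'g set \<Rightarrow> 'g set" where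
  "core_coset G H k j S = chain_core G H k j <#>\<^bsub>G\<^esub> S"

definition discr_group :: "'g monoid \<Rightarrow> (nat \<Rightarrow> 'g set) \<Rightarrow> nat \<Rightarrow> (nat \<Rightarrow> 'g set) monoid" where
  "discr_group G H n = inv_limit n (discr_quot G H n) (core_coset G H n)"

definition discr_topology :: "'g monoid \<Rightarrow> (nat \<Rightarrow> 'g set) \<Rightarrow> nat \<Rightarrow> (nat \<Rightarrow> 'g set) topology" where
  "discr_topology G H n = inv_limit_topology n (discr_quot G H n) (core_coset G H n)"

definition discr_map ::
  "'g monoid \<Rightarrow> (nat \<Rightarrow> 'g set) \<Rightarrow> nat \<Rightarrow> (nat \<Rightarrow> 'g set) \<Rightarrow> (nat \<Rightarrow> 'g set)" where
  "discr_map G H k x = (\<lambda>j\<in>{k..}. core_coset G H k j (x j))"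

definition stable_chain :: "'g monoid \<Rightarrow> (nat \<Rightarrow> 'g set) \<Rightarrow> bool" where
  "stable_chain G H \<longleftrightarrow>
     (\<exists>n0. \<forall>n\<ge>n0. discr_map G H (Suc n) \<in> iso (discr_group G H n) (discr_group G H (Suc n)))"


section \<open>Cantor groups\<close>

definition topological_group :: "'a monoid \<Rightarrow> 'a topology \<Rightarrow> bool" where
  "topological_group G S \<longleftrightarrow>
     group G \<and> topspace S = carrier G \<and>
     continuous_map (prod_topology S S) S (\<lambda>(x, y). x \<otimes>\<^bsub>G\<^esub> y) \<and>
     continuous_map S S (\<lambda>x. inv\<^bsub>G\<^esub> x)"

definition profinite_group :: "'a monoid \<Rightarrow> 'a topology \<Rightarrow> bool" where
  "profinite_group G S \<longleftrightarrow>
     topological_group G S \<and> compact_space S \<and> Hausdorff_space S \<and>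
     (\<forall>x\<in>topspace S. connected_component_of_set S x = {x})"

definition cantor_space :: "(nat \<Rightarrow> bool) topology" where
  "cantor_space = product_topology (\<lambda>_. discrete_topology UNIV) UNIV"

definition cantor_group :: "'a monoid \<Rightarrow> 'a topology \<Rightarrow> bool" where
  "cantor_group G S \<longleftrightarrow>
     profinite_group G S \<and> infinite (carrier G) \<and> S homeomorphic_space cantor_space"

end

theory Submission
  imports Defs "Jordan_Normal_Form.Char_Poly" "HOL-Number_Theory.Number_Theory"
begin

text \<open>
  Since \<open>f + p = (x + p)\<^sup>d\<close>, the roots of \<open>f\<^sup>n\<close> are \<open>\<zeta>\<^sup>a \<pi> - p\<close> with \<open>\<pi>\<close> a \<open>d\<^sup>n\<close>-th root of \<open>p\<close> and \<open>\<zeta>\<close> a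
  primitive \<open>d\<^sup>n\<close>-th root of unity. The extension \<open>K(\<zeta>)/K\<close> is unramified with group generated by the
  Frobenius \<open>\<sigma> : \<zeta> \<mapsto> \<zeta>\<^sup>q\<close>, and \<open>K(\<zeta>, \<pi>)/K(\<zeta>)\<close> is totally ramified of degree \<open>d\<^sup>n\<close>, which gives
  \<open>\<tau> : \<pi> \<mapsto> \<zeta>\<pi>\<close>; hence \<open>c\<^sub>n = 1\<close> and \<open>s\<^sub>n\<close> is the order of \<open>q\<close> modulo \<open>d\<^sup>n\<close>. Both facts come from one
  observation: with \<open>O\<close> the ring of integers of \<open>K\<close>, the domain \<open>O[\<zeta>]\<close> is \<open>p\<close>-adically complete, so
  idempotents modulo \<open>p\<close> lift, and some power of Frobenius is the identity modulo \<open>p\<close>; therefore every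
  element of \<open>O[\<zeta>]\<close> is divisible by \<open>p\<close> or invertible.

  For the path \<open>v\<^sub>n = \<pi>\<^sub>n - p\<close>, an element of \<open>G\<^sub>j\<close> lies in \<open>C\<^sup>n\<^sub>j\<close> iff it fixes \<open>\<zeta>\<^bsub>j-n\<^esub>\<close>, so that
  \<open>G\<^sub>j / C\<^sup>n\<^sub>j\<close> is cyclic of order \<open>s\<^bsub>j-n\<^esub>\<close>, and all discriminant groups are the inverse limit of the
  groups \<open>\<int>/s\<^sub>n\<close>.
\<close>

section \<open>Integral closures\<close>

text \<open>No absolute value is extended to the algebraic closure of K. Its place is taken by the
  integral closure \<open>A\<close> of the p-adic integers there, and two facts about
  \<open>A\<close> carry the arguments: 1/p is not in \<open>A\<close>, and every nonzero element
  divides a power of p in \<open>A\<close>. The first plays the role of p having positive valuation;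
  together they make an element divisible by all powers of p vanish. \<open>A\<close> itself is not
  p-adically complete, which is why series are summed only in the finitely generated module
  O[\<zeta>].

  O[\<zeta>]/p is then a field in which distinct roots of unity of order prime to p stay distinct. A
  polynomial with such roots that vanishes modulo p at a root of unity w therefore vanishes at w.
  Applied to the minimal polynomial of \<zeta> this shows that \<zeta>^q is a conjugate; applied to
  the Frobenius orbit it shows that there are no other conjugates. For \<pi>, invertibility modulo p
  drives an Eisenstein argument for the linear independence of its powers. The discriminant groups
  are read off from the exponent sum of \<sigma>, a homomorphism from BS(1,q) to the
  integers.\<close>

definition subring_set :: "'a::comm_ring_1 set \<Rightarrow> bool" where
  "subring_set R \<longleftrightarrow> 0 \<in> R \<and> 1 \<in> R \<and> (\<forall>x\<in>R. \<forall>y\<in>R. x + y \<in> R \<and> x * y \<in> R) \<and> (\<forall>x\<in>R. - x \<in> R)"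

lemma subring_setD:
  assumes "subring_set R"
  shows "0 \<in> R" "1 \<in> R" "\<And>x y. x \<in> R \<Longrightarrow> y \<in> R \<Longrightarrow> x + y \<in> R"
    "\<And>x y. x \<in> R \<Longrightarrow> y \<in> R \<Longrightarrow> x * y \<in> R" "\<And>x. x \<in> R \<Longrightarrow> - x \<in> R"
    "\<And>x y. x \<in> R \<Longrightarrow> y \<in> R \<Longrightarrow> x - y \<in> R"
  using assms unfolding subring_set_def by (auto simp: diff_conv_add_uminus simp del: add_uminus_conv_diff)

lemma subring_set_sum:
  assumes "subring_set R" "\<And>i. i \<in> I \<Longrightarrow> f i \<in> R"
  shows "sum f I \<in> R"
  using assms(2) by (induction I rule: infinite_finite_induct) (auto intro: subring_setD[OF assms(1)])

lemma subring_set_prod: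
  assumes "subring_set R" "\<And>i. i \<in> I \<Longrightarrow> f i \<in> R"
  shows "prod f I \<in> R"
  using assms(2) by (induction I rule: infinite_finite_induct) (auto intro: subring_setD[OF assms(1)])

lemma subring_set_power: "subring_set R \<Longrightarrow> x \<in> R \<Longrightarrow> x ^ n \<in> R"
  by (induction n) (auto intro: subring_setD)

lemma subring_set_of_nat: "subring_set R \<Longrightarrow> of_nat n \<in> R"
  by (induction n) (auto intro: subring_setD)

lemma subring_set_of_int: "subring_set R \<Longrightarrow> of_int n \<in> R"
  by (cases n) (auto intro: subring_setD(5) subring_set_of_nat simp del: of_nat_Suc)

lemmas subring_set_intros = subring_setD subring_set_sum subring_set_prod subring_set_power
  subring_set_of_nat subring_set_of_int

definition polys_over :: "'a::comm_ring_1 set \<Rightarrow> 'a poly set" where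
  "polys_over R = {P. \<forall>i. Polynomial.coeff P i \<in> R}"

lemma subring_set_polys_over:
  assumes "subring_set R" shows "subring_set (polys_over R)"
  using assms unfolding polys_over_def subring_set_def[of "Collect _"]
  by (auto simp: coeff_mult coeff_pCons split: nat.splits intro!: subring_set_sum intro: subring_setD)

lemma poly_in_subring:
  assumes "subring_set R" "P \<in> polys_over R" "x \<in> R" shows "poly P x \<in> R"
  unfolding poly_altdef using assms by (auto simp: polys_over_def intro!: subring_set_intros)

definition integral_over :: "'a::comm_ring_1 set \<Rightarrow> 'a \<Rightarrow> bool" where
  "integral_over R x \<longleftrightarrow> (\<exists>P. Polynomial.lead_coeff P = 1 \<and> P \<in> polys_over R \<and> poly P x = 0)"

section \<open>Finitely generated modules over a subring\<close>

definition span_over :: "'a::comm_ring_1 set \<Rightarrow> 'j set \<Rightarrow> ('j \<Rightarrow> 'a) \<Rightarrow> 'a set" where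
  "span_over R J w = {\<Sum>j\<in>J. a j * w j | a. \<forall>j\<in>J. a j \<in> R}"

lemma span_overI: "(\<And>j. j \<in> J \<Longrightarrow> a j \<in> R) \<Longrightarrow> x = (\<Sum>j\<in>J. a j * w j) \<Longrightarrow> x \<in> span_over R J w"
  unfolding span_over_def by blast

lemma span_over_base:
  assumes "subring_set R" "finite J" "j \<in> J" shows "w j \<in> span_over R J w"
proof (rule span_overI[where a = "\<lambda>i. if i = j then 1 else 0"])
  have "(\<Sum>i\<in>J. (if i = j then 1 else 0) * w i) = (\<Sum>i\<in>J. if i = j then w i else 0)"
    by (rule sum.cong) auto
  then show "w j = (\<Sum>i\<in>J. (if i = j then 1 else 0) * w i)" using assms by simp
qed (use subring_setD[OF assms(1)] in auto)

lemma span_over_add: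
  assumes "subring_set R" "x \<in> span_over R J w" "y \<in> span_over R J w" shows "x + y \<in> span_over R J w"
proof -
  from assms(2,3) obtain a b where "x = (\<Sum>j\<in>J. a j * w j)" "\<forall>j\<in>J. a j \<in> R"
    "y = (\<Sum>j\<in>J. b j * w j)" "\<forall>j\<in>J. b j \<in> R" unfolding span_over_def by blast
  then show ?thesis
    by (intro span_overI[where a = "\<lambda>j. a j + b j"]) (auto simp: sum.distrib algebra_simps intro: subring_setD(3)[OF assms(1)])
qed

lemma span_over_scale:
  assumes "subring_set R" "c \<in> R" "x \<in> span_over R J w" shows "c * x \<in> span_over R J w"
proof -
  from assms(3) obtain a where "x = (\<Sum>j\<in>J. a j * w j)" "\<forall>j\<in>J. a j \<in> R" unfolding span_over_def by blast
  then show ?thesis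
    by (intro span_overI[where a = "\<lambda>j. c * a j"])
      (auto simp: sum_distrib_left algebra_simps intro: subring_setD(4)[OF assms(1)] assms)
qed

lemma span_over_sum:
  assumes "subring_set R" "\<And>i. i \<in> I \<Longrightarrow> f i \<in> span_over R J w" shows "sum f I \<in> span_over R J w"
proof -
  have "0 \<in> span_over R J w" by (rule span_overI[where a = "\<lambda>_. 0"]) (auto intro: subring_setD[OF assms(1)])
  then show ?thesis using assms(2)
    by (induction I rule: infinite_finite_induct) (auto intro: span_over_add[OF assms(1)])
qed

lemma span_over_mult_closed:
  assumes "subring_set R" "\<And>j. j \<in> J \<Longrightarrow> z * w j \<in> span_over R J w" "x \<in> span_over R J w"
  shows "z * x \<in> span_over R J w"
proof -
  from assms(3) obtain a where a: "x = (\<Sum>j\<in>J. a j * w j)" "\<forall>j\<in>J. a j \<in> R" unfolding span_over_def by blast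
  have "z * x = (\<Sum>j\<in>J. a j * (z * w j))" unfolding a(1) sum_distrib_left by (simp add: algebra_simps)
  also have "\<dots> \<in> span_over R J w"
    by (rule span_over_sum[OF assms(1)]) (use a(2) assms in \<open>auto intro: span_over_scale[OF assms(1)]\<close>)
  finally show ?thesis .
qed

text \<open>The determinant trick: \<open>z\<close> is an eigenvalue of a matrix with entries in \<open>R\<close>.\<close>

lemma integral_over_if_eigenvalue:
  fixes z :: "'a::field"
  assumes R: "subring_set R" and "finite J" and "\<exists>j\<in>J. w j \<noteq> 0"
    and "\<And>j. j \<in> J \<Longrightarrow> z * w j \<in> span_over R J w"
  shows "integral_over R z"
proof -
  define n where "n = card J"
  obtain h where h: "bij_betw h {..<n} J"
    using ex_bij_betw_nat_finite[OF \<open>finite J\<close>] by (auto simp: n_def lessThan_atLeast0)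
  have hJ: "h k \<in> J" if "k < n" for k using h that by (auto simp: bij_betw_def)
  have "\<forall>j\<in>J. \<exists>a. (\<forall>i\<in>J. a i \<in> R) \<and> z * w j = (\<Sum>i\<in>J. a i * w i)"
    using assms(4) unfolding span_over_def by blast
  then obtain a where a: "\<And>j i. j \<in> J \<Longrightarrow> i \<in> J \<Longrightarrow> a j i \<in> R"
    "\<And>j. j \<in> J \<Longrightarrow> z * w j = (\<Sum>i\<in>J. a j i * w i)" by metis
  define M where "M = mat n n (\<lambda>(k, l). a (h k) (h l))"
  define v where "v = vec n (\<lambda>k. w (h k))"
  have M: "M \<in> carrier_mat n n" by (simp add: M_def)
  have "M *\<^sub>v v = z \<cdot>\<^sub>v v"
  proof (rule eq_vecI)
    fix k assume "k < dim_vec (z \<cdot>\<^sub>v v)"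
    then have k: "k < n" by (simp add: v_def)
    have "(M *\<^sub>v v) $ k = (\<Sum>l<n. a (h k) (h l) * w (h l))"
      using k by (simp add: M_def v_def scalar_prod_def lessThan_atLeast0)
    also have "\<dots> = (\<Sum>i\<in>J. a (h k) i * w i)"
      by (rule sum.reindex_bij_betw[OF h])
    finally show "(M *\<^sub>v v) $ k = (z \<cdot>\<^sub>v v) $ k"
      using a(2)[OF hJ[OF k]] k by (simp add: v_def)
  qed (auto simp: M_def v_def)
  moreover have "v \<noteq> 0\<^sub>v n"
  proof
    assume "v = 0\<^sub>v n"
    then have "w (h k) = 0" if "k < n" for k
      using that by (metis index_vec index_zero_vec(1) v_def)
    moreover from assms(3) obtain j where "j \<in> J" "w j \<noteq> 0" by blast
    then obtain k where "k < n" "h k = j" using h by (auto simp: bij_betw_def)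
    ultimately show False using \<open>w j \<noteq> 0\<close> by blast
  qed
  ultimately have "eigenvalue M z"
    unfolding eigenvalue_def eigenvector_def using M by (intro exI[of _ v]) (auto simp: v_def)
  then have root: "poly (char_poly M) z = 0" using eigenvalue_root_char_poly[OF M] by simp
  have PR: "subring_set (polys_over R)" by (rule subring_set_polys_over[OF R])
  have "char_poly_matrix M $$ (i, k) \<in> polys_over R" if "i < n" "k < n" for i k
    using that a(1)[OF hJ hJ] M unfolding char_poly_matrix_def
    by (auto simp: M_def polys_over_def coeff_pCons split: nat.splits intro: subring_setD[OF R])
  moreover have less: "\<pi> i < n" if "\<pi> permutes {0..<n}" "i < n" for \<pi> i
    using permutes_in_image[OF that(1), of i] that(2) by simp
  \<comment> \<open>The determinant is a signed sum of products of entries, so it stays in the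
    subring of polynomials with coefficients in \<open>R\<close>.\<close>
  ultimately have "char_poly M \<in> polys_over R"
    unfolding char_poly_def det_def using M subring_setD(2)[OF PR] subring_setD(5)[OF PR subring_setD(2)[OF PR]] less
    by (auto intro!: subring_set_sum[OF PR] subring_set_prod[OF PR] subring_setD(4)[OF PR]
          simp: sign_def carrier_matD[OF char_poly_matrix_closed[OF M]])
  moreover have "Polynomial.lead_coeff (char_poly M) = 1"
    using degree_monic_char_poly[OF M] by auto
  ultimately show ?thesis using root unfolding integral_over_def by blast
qed

lemma integral_over_base: "subring_set R \<Longrightarrow> x \<in> R \<Longrightarrow> integral_over R x"
  unfolding integral_over_def
  by (rule exI[of _ "[:- x, 1:]"]) (auto simp: polys_over_def coeff_pCons split: nat.splits intro: subring_setD)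

text \<open>The multiplier ring of the \<open>R\<close>-module spanned by \<open>W\<close>. If 1
  lies in \<open>W\<close>, all its elements are integral by the determinant trick, so integrality
  of several elements at once is proved by finding one module that all of them preserve.\<close>

definition span_stab :: "'a::comm_ring_1 set \<Rightarrow> 'a set \<Rightarrow> 'a set" where
  "span_stab R W = {s. \<forall>u\<in>W. s * u \<in> span_over R W (\<lambda>x. x)}"

lemma subring_set_span_stab:
  assumes R: "subring_set R" and "finite W"
  shows "subring_set (span_stab R W)" "R \<subseteq> span_stab R W"
proof -
  have base: "u \<in> span_over R W (\<lambda>x. x)" if "u \<in> W" for u using span_over_base[OF assms that] .
  show R_stab: "R \<subseteq> span_stab R W"
    unfolding span_stab_def by (auto intro: span_over_scale[OF R _ base])
  have mult: "s * x \<in> span_over R W (\<lambda>x. x)" if "s \<in> span_stab R W" "x \<in> span_over R W (\<lambda>x. x)" for s x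
    by (rule span_over_mult_closed[OF R _ that(2)]) (use that(1) in \<open>simp add: span_stab_def\<close>)
  have times: "s * t \<in> span_stab R W" if "s \<in> span_stab R W" "t \<in> span_stab R W" for s t
    unfolding span_stab_def using mult[OF that(1)] that(2) by (auto simp: span_stab_def mult.assoc)
  have "- s \<in> span_stab R W" if "s \<in> span_stab R W" for s
    using times[of "- 1" s] R_stab subring_setD(2,5)[OF R] that by auto
  moreover have "s + t \<in> span_stab R W" if "s \<in> span_stab R W" "t \<in> span_stab R W" for s t
    using that by (auto simp: span_stab_def distrib_right intro!: span_over_add[OF R])
  ultimately show "subring_set (span_stab R W)"
    unfolding subring_set_def using subring_setD(1,2)[OF R] R_stab times by blast
qed

lemma integral_over_if_span_stab:
  fixes R :: "'a::field set"
  assumes "subring_set R" "finite W" "1 \<in> W" "s \<in> span_stab R W"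
  shows "integral_over R s"
  using assms by (intro integral_over_if_eigenvalue[of R W "\<lambda>x. x"]) (auto simp: span_stab_def intro: bexI[of _ 1])

text \<open>A monic equation of degree m for x lets the products of \<open>W\<close> with 1, x, ...,
  x^(m-1) absorb multiplication by x, and the old multipliers survive on the enlarged module. Since
  the coefficients are only required to be multipliers, this step serves both for closure under sums
  and products and for transitivity.\<close>

lemma span_stab_adjoin:
  fixes R :: "'a::field set"
  assumes R: "subring_set R" and "finite W" and "1 \<in> W" and "integral_over (span_stab R W) x"
  shows "\<exists>W'. finite W' \<and> 1 \<in> W' \<and> insert x (span_stab R W) \<subseteq> span_stab R W'"
proof -
  from assms(4) obtain P where P: "Polynomial.lead_coeff P = 1" "P \<in> polys_over (span_stab R W)" "poly P x = 0"
    unfolding integral_over_def by blast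
  define m where "m = Polynomial.degree P"
  have "m > 0"
  proof (rule ccontr)
    assume "\<not> m > 0"
    then obtain c where "P = [:c:]" unfolding m_def using degree_eq_zeroE by blast
    then show False using P by auto
  qed
  have "0 = (\<Sum>i<m. Polynomial.coeff P i * x ^ i) + x ^ m"
    using P unfolding poly_altdef m_def by (simp flip: lessThan_Suc_atMost)
  then have xm: "x ^ m = (\<Sum>i<m. (- Polynomial.coeff P i) * x ^ i)"
    by (simp add: sum_negf eq_neg_iff_add_eq_0 add.commute)
  define W' where "W' = (\<lambda>(u, i). u * x ^ i) ` (W \<times> {..<m})"
  let ?M = "span_over R W (\<lambda>x. x)" and ?M' = "span_over R W' (\<lambda>x. x)"
  have fin: "finite W'" using \<open>finite W\<close> by (simp add: W'_def)
  have one: "1 \<in> W'" using \<open>1 \<in> W\<close> \<open>m > 0\<close> by (force simp: W'_def)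
  have lift: "y * x ^ i \<in> ?M'" if y: "y \<in> ?M" and i: "i < m" for y i
  proof -
    from y obtain a where a: "\<forall>u\<in>W. a u \<in> R" "y = (\<Sum>u\<in>W. a u * u)" unfolding span_over_def by blast
    have "y * x ^ i = (\<Sum>u\<in>W. a u * (u * x ^ i))" by (simp add: a(2) sum_distrib_right mult.assoc)
    also have "\<dots> \<in> ?M'" using a(1) i
      by (intro span_over_sum[OF R] span_over_scale[OF R _ span_over_base[OF R fin]]) (auto simp: W'_def)
    finally show ?thesis .
  qed
  have "span_stab R W \<subseteq> span_stab R W'"
    unfolding span_stab_def[of R "W'"]
    using lift by (auto simp: W'_def span_stab_def simp flip: mult.assoc)
  moreover have "x * (u * x ^ i) \<in> ?M'" if "u \<in> W" "i < m" for u i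
  \<comment> \<open>Multiplication by x moves to the next power, except at the top power, where the
    monic equation brings x^m back below m.\<close>
  proof (cases "Suc i < m")
    case True
    then have "u * x ^ Suc i \<in> ?M'" using that by (intro lift span_over_base[OF R \<open>finite W\<close>])
    then show ?thesis by (simp add: mult.left_commute)
  next
    case False
    then have "m = Suc i" using that by auto
    have "x * (u * x ^ i) = x ^ m * u" by (simp add: \<open>m = Suc i\<close>)
    also have "\<dots> = (\<Sum>k<m. (- Polynomial.coeff P k * u) * x ^ k)"
      unfolding xm sum_distrib_right by (simp add: mult_ac)
    also have "\<dots> \<in> ?M'"
    proof (intro span_over_sum[OF R] lift)
      fix k
      have "- Polynomial.coeff P k \<in> span_stab R W"
        using P(2) by (intro subring_setD(5)[OF subring_set_span_stab(1)[OF R \<open>finite W\<close>]]) (simp add: polys_over_def)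
      then show "- Polynomial.coeff P k * u \<in> ?M" using that(1) unfolding span_stab_def by blast
    qed simp
    finally show ?thesis .
  qed
  then have "x \<in> span_stab R W'" by (auto simp: span_stab_def W'_def)
  ultimately show ?thesis using fin one by blast
qed

lemma integral_over_mono: "integral_over R x \<Longrightarrow> R \<subseteq> S \<Longrightarrow> integral_over S x"
  unfolding integral_over_def polys_over_def by blast

lemma span_stab_adjoin_finite:
  fixes R :: "'a::field set"
  assumes R: "subring_set R" and "finite C" and "\<And>c. c \<in> C \<Longrightarrow> integral_over R c"
  shows "\<exists>W. finite W \<and> 1 \<in> W \<and> C \<subseteq> span_stab R W"
  using assms(2,3)
proof (induction C rule: finite_induct)
  case empty then show ?case by (intro exI[of _ "{1}"]) simp
next
  case (insert c C)
  then obtain W where W: "finite W" "1 \<in> W" "C \<subseteq> span_stab R W" by auto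
  have "integral_over (span_stab R W) c"
    by (rule integral_over_mono[OF insert.prems[OF insertI1] subring_set_span_stab(2)[OF R W(1)]])
  from span_stab_adjoin[OF R W(1,2) this] W(3) show ?case by blast
qed

lemma subring_set_integral_closure:
  fixes R :: "'a::field set"
  assumes R: "subring_set R" shows "subring_set {x. integral_over R x}"
proof -
  have "integral_over R (x + y) \<and> integral_over R (x * y) \<and> integral_over R (- x)"
    if "integral_over R x" "integral_over R y" for x y
  proof -
    have "\<exists>W. finite W \<and> 1 \<in> W \<and> {x, y} \<subseteq> span_stab R W"
      by (rule span_stab_adjoin_finite[OF R]) (use that in auto)
    then obtain W where W: "finite W" "1 \<in> W" "{x, y} \<subseteq> span_stab R W" by blast
    note S = subring_setD(3,4,5)[OF subring_set_span_stab(1)[OF R W(1)]]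
    show ?thesis using W(3) S by (auto intro!: integral_over_if_span_stab[OF R W(1,2)])
  qed
  then show ?thesis
    using integral_over_base[OF R] subring_setD(1,2)[OF R] unfolding subring_set_def by auto
qed

text \<open>The equation has finitely many coefficients, so a single multiplier ring contains them
  all; adjoining x to its module makes x a multiplier too.\<close>

lemma integral_over_trans:
  fixes R :: "'a::field set"
  assumes R: "subring_set R" and x: "integral_over {c. integral_over R c} x"
  shows "integral_over R x"
proof -
  from x obtain P where P: "Polynomial.lead_coeff P = 1" "P \<in> polys_over {c. integral_over R c}" "poly P x = 0"
    unfolding integral_over_def by blast
  obtain W where W: "finite W" "1 \<in> W" "Polynomial.coeff P ` {..Polynomial.degree P} \<subseteq> span_stab R W"
    using span_stab_adjoin_finite[OF R, of "Polynomial.coeff P ` {..Polynomial.degree P}"] P(2)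
    by (auto simp: polys_over_def)
  have "Polynomial.coeff P i \<in> span_stab R W" for i
  proof (cases "i \<le> Polynomial.degree P")
    case False
    then show ?thesis using subring_setD(1)[OF subring_set_span_stab(1)[OF R W(1)]] by (simp add: coeff_eq_0)
  qed (use W(3) in auto)
  then have "integral_over (span_stab R W) x" using P unfolding integral_over_def polys_over_def by blast
  from span_stab_adjoin[OF R W(1,2) this] show ?thesis using integral_over_if_span_stab[OF R] by blast
qed

section \<open>Complete local rings generated by roots of unity\<close>

text \<open>Convergence in algebraic form: the series with terms p^i y_i has a sum whose remainder
  after k terms lies in p^k \<open>S\<close>. The quotients are formed in the ambient field.
  Uniqueness of sums is a separate matter, settled by \<open>p_divisible_zero\<close>.\<close>

definition pcomplete :: "nat \<Rightarrow> 'a::field set \<Rightarrow> bool" where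
  "pcomplete p S \<longleftrightarrow> (\<forall>y. (\<forall>i. y i \<in> S) \<longrightarrow>
     (\<exists>a\<in>S. \<forall>k. (a - (\<Sum>i<k. of_nat p ^ i * y i)) / of_nat p ^ k \<in> S))"

lemma pcompleteE:
  assumes "pcomplete p S" "\<And>i. y i \<in> S"
  obtains a where "a \<in> S" "\<And>k. (a - (\<Sum>i<k. of_nat p ^ i * y i)) / of_nat p ^ k \<in> S"
  using assms(1)[unfolded pcomplete_def, rule_format, of y] assms(2) by blast

text \<open>Each coefficient series is summed separately. The family \<open>w\<close> may be
  linearly dependent: any choice of coefficients for the terms leads to a sum.\<close>

lemma pcomplete_span_over:
  fixes S :: "'a::field_char_0 set"
  assumes "pcomplete p S" "finite J" "p > 0"
  shows "pcomplete p (span_over S J w)"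
  unfolding pcomplete_def
proof (intro allI impI)
  fix y :: "nat \<Rightarrow> 'a" assume "\<forall>i. y i \<in> span_over S J w"
  then have "\<forall>i. \<exists>c. (\<forall>j\<in>J. c j \<in> S) \<and> y i = (\<Sum>j\<in>J. c j * w j)" unfolding span_over_def by blast
  then obtain c where c: "\<And>i j. j \<in> J \<Longrightarrow> c i j \<in> S" "\<And>i. y i = (\<Sum>j\<in>J. c i j * w j)" by metis
  have "\<exists>a. a \<in> S \<and> (\<forall>k. (a - (\<Sum>i<k. of_nat p ^ i * c i j)) / of_nat p ^ k \<in> S)" if "j \<in> J" for j
    using assms(1)[unfolded pcomplete_def, rule_format, of "\<lambda>i. c i j"] c(1)[OF that] by blast
  then have "\<forall>j\<in>J. \<exists>a. a \<in> S \<and> (\<forall>k. (a - (\<Sum>i<k. of_nat p ^ i * c i j)) / of_nat p ^ k \<in> S)" by blast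
  from bchoice[OF this] obtain a where a: "\<And>j. j \<in> J \<Longrightarrow> a j \<in> S"
    "\<And>j k. j \<in> J \<Longrightarrow> (a j - (\<Sum>i<k. of_nat p ^ i * c i j)) / of_nat p ^ k \<in> S" by blast
  have eq: "((\<Sum>j\<in>J. a j * w j) - (\<Sum>i<k. of_nat p ^ i * y i)) / of_nat p ^ k
      = (\<Sum>j\<in>J. ((a j - (\<Sum>i<k. of_nat p ^ i * c i j)) / of_nat p ^ k) * w j)" for k
  proof -
    have "(\<Sum>i<k. of_nat p ^ i * y i) = (\<Sum>j\<in>J. (\<Sum>i<k. of_nat p ^ i * c i j) * w j)"
      unfolding c(2) sum_distrib_left sum_distrib_right
      by (subst sum.swap) (simp add: mult.assoc)
    then show ?thesis by (simp add: sum_subtractf[symmetric] sum_divide_distrib left_diff_distrib)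
  qed
  show "\<exists>b\<in>span_over S J w. \<forall>k. (b - (\<Sum>i<k. of_nat p ^ i * y i)) / of_nat p ^ k \<in> span_over S J w"
  proof (rule bexI[of _ "\<Sum>j\<in>J. a j * w j"], unfold eq)
    show "\<forall>k. (\<Sum>j\<in>J. (a j - (\<Sum>i<k. of_nat p ^ i * c i j)) / of_nat p ^ k * w j) \<in> span_over S J w"
      by (intro allI span_overI[OF _ refl] a)
  qed (intro span_overI[OF _ refl] a)
qed

text \<open>The intended reading: \<open>R\<close> is the ring of p-adic integers, \<open>Ok\<close>
  the ring of integers of K, \<open>A\<close> the integral closure in an algebraic closure, and
  \<open>T\<close> a set of representatives of the residue field. \<open>absorb\<close> says that
  denominators are bounded by powers of p, and \<open>frob_Ok\<close> that the q-th power map is the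
  identity on the residue field.\<close>

locale unram_ring =
  fixes A Ok R T :: "'a::field_char_0 set" and p q m :: nat
  assumes ring_A: "subring_set A" and ring_Ok: "subring_set Ok" and ring_R: "subring_set R"
    and R_sub: "R \<subseteq> Ok" and Ok_sub: "Ok \<subseteq> A"
    and prime_p: "Factorial_Ring.prime p" and odd_p: "odd p" and q_eq: "q = p ^ m"
    and complete_R: "pcomplete p R"
    and pinv: "inverse (of_nat p) \<notin> A"
    and absorb: "\<And>z. z \<noteq> 0 \<Longrightarrow> \<exists>N. of_nat p ^ N / z \<in> A"
    and finite_T: "finite T" and card_T: "card T = q" and T_sub: "T \<subseteq> Ok"
    and T_reps: "\<And>x. x \<in> Ok \<Longrightarrow> \<exists>t\<in>T. (x - t) / of_nat p \<in> Ok"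
    and T_distinct: "\<And>t u. t \<in> T \<Longrightarrow> u \<in> T \<Longrightarrow> t \<noteq> u \<Longrightarrow> (t - u) / of_nat p \<notin> A"
    and frob_Ok: "\<And>x. x \<in> Ok \<Longrightarrow> (x ^ q - x) / of_nat p \<in> Ok"
begin

abbreviation pp :: 'a where "pp \<equiv> of_nat p"

lemma pp_nz [simp]: "pp \<noteq> 0" "p > 0" "p \<noteq> 0"
  using prime_p prime_gt_0_nat by auto

text \<open>Excludes m = 0: with a single residue class, 0 and 1 would be congruent modulo p, which
  puts 1/p into \<open>A\<close>.\<close>

lemma q_ge_2: "q \<ge> 2"
proof -
  have "q \<noteq> 1"
  proof
    assume "q = 1"
    then obtain t where t: "T = {t}" using card_T card_1_singletonE by metis
    have "(1 - t) / pp - (0 - t) / pp \<in> Ok"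
      using T_reps[of 1] T_reps[of 0] subring_setD(1,2)[OF ring_Ok] t
      by (intro subring_setD(6)[OF ring_Ok]) auto
    then show False using pinv Ok_sub by (auto simp: field_simps)
  qed
  moreover have "q > 0" unfolding q_eq by simp
  ultimately show ?thesis by linarith
qed

text \<open>If p^N / z lies in \<open>A\<close>, its product with z / p^(N+1) is 1/p.\<close>

lemma p_divisible_zero:
  assumes "\<And>k. z / pp ^ k \<in> A" shows "z = 0"
proof (rule ccontr)
  assume "z \<noteq> 0"
  then obtain N where "pp ^ N / z \<in> A" using absorb by blast
  then have "(pp ^ N / z) * (z / pp ^ Suc N) \<in> A" using assms by (intro subring_setD(4)[OF ring_A])
  then show False using pinv \<open>z \<noteq> 0\<close> by (simp add: field_simps)
qed

text \<open>Elements have p-adic digit expansions with digits in the finite set \<open>T\<close>.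
  The series of digits can be summed in the span of \<open>T\<close> over the complete ring
  \<open>R\<close>, and the sum is the given element because no nonzero element is divisible by all
  powers of p. So \<open>Ok\<close> inherits completeness from \<open>R\<close>.\<close>

lemma Ok_span: "Ok = span_over R T (\<lambda>t. t)"
proof
  show "span_over R T (\<lambda>t. t) \<subseteq> Ok"
    unfolding span_over_def using R_sub T_sub
    by (auto intro!: subring_set_sum[OF ring_Ok] subring_setD(4)[OF ring_Ok])
  show "Ok \<subseteq> span_over R T (\<lambda>t. t)"
  proof
    fix x assume x: "x \<in> Ok"
    define tt where "tt y = (SOME t. t \<in> T \<and> (y - t) / pp \<in> Ok)" for y
    have tt: "tt y \<in> T \<and> (y - tt y) / pp \<in> Ok" if "y \<in> Ok" for y
      unfolding tt_def by (rule someI_ex) (use T_reps[OF that] in blast)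
    \<comment> \<open>\<open>Y k\<close> is what is left of x when its first k digits are removed
      and the rest is divided by p^k.\<close>
    define Y where "Y = rec_nat x (\<lambda>_ y. (y - tt y) / pp)"
    have Y0: "Y 0 = x" and YS: "Y (Suc k) = (Y k - tt (Y k)) / pp" for k by (simp_all add: Y_def)
    have YO: "Y k \<in> Ok" for k by (induction k) (use x tt in \<open>auto simp: Y0 YS\<close>)
    have part: "x = (\<Sum>i<k. pp ^ i * tt (Y i)) + pp ^ k * Y k" for k
      by (induction k) (auto simp: Y0 YS field_simps)
    have "tt (Y i) \<in> span_over R T (\<lambda>t. t)" for i
      by (rule span_over_base[OF ring_R finite_T]) (use tt YO in auto)
    then obtain y where y: "y \<in> span_over R T (\<lambda>t. t)"
      "\<And>k. (y - (\<Sum>i<k. pp ^ i * tt (Y i))) / pp ^ k \<in> span_over R T (\<lambda>t. t)"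
      using pcompleteE[OF pcomplete_span_over[OF complete_R finite_T pp_nz(2), of "\<lambda>t. t"], of "\<lambda>i. tt (Y i)"] by blast
    have "(x - y) / pp ^ k \<in> A" for k
    proof -
      have "x - y = pp ^ k * Y k - (y - (\<Sum>i<k. pp ^ i * tt (Y i)))"
        using part[of k] by (simp add: algebra_simps)
      then have "(x - y) / pp ^ k = (pp ^ k * Y k - (y - (\<Sum>i<k. pp ^ i * tt (Y i)))) / pp ^ k"
        by (simp only:)
      also have "\<dots> = Y k - (y - (\<Sum>i<k. pp ^ i * tt (Y i))) / pp ^ k"
        by (subst diff_divide_distrib) simp
      finally have "(x - y) / pp ^ k = Y k - (y - (\<Sum>i<k. pp ^ i * tt (Y i))) / pp ^ k" .
      moreover have "(y - (\<Sum>i<k. pp ^ i * tt (Y i))) / pp ^ k \<in> Ok"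
        using y(2)[of k] \<open>span_over R T (\<lambda>t. t) \<subseteq> Ok\<close> by blast
      ultimately show ?thesis using YO[of k] Ok_sub by (auto intro!: subring_setD(6)[OF ring_A])
    qed
    then have "x = y" using p_divisible_zero[of "x - y"] by simp
    with y(1) show "x \<in> span_over R T (\<lambda>t. t)" by simp
  qed
qed

lemma pcomplete_Ok: "pcomplete p Ok"
  unfolding Ok_span by (rule pcomplete_span_over[OF complete_R finite_T pp_nz(2)])

text \<open>The sum 1 + u + ... + u^(N-1) vanishes, so -N is the sum of the differences u^i - 1,
  each a multiple of u - 1. For N prime to p this keeps distinct roots of unity apart modulo
  p.\<close>

lemma root_diff_unit:
  assumes "u \<in> A" "u ^ N = 1" "u \<noteq> 1" "N > 0"
  shows "of_nat N / (u - 1) \<in> A"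
proof -
  have s0: "(\<Sum>i<N. u ^ i) = 0" using assms geometric_sum[of u N] by simp
  have "(\<Sum>i<N. u ^ i - 1) = (u - 1) * (\<Sum>i<N. \<Sum>j<i. u ^ j)"
    unfolding sum_distrib_left by (rule sum.cong) (auto simp: power_diff_1_eq sum_distrib_left)
  then have "- of_nat N = (u - 1) * (\<Sum>i<N. \<Sum>j<i. u ^ j)"
    by (simp add: sum_subtractf s0)
  then have "of_nat N / (u - 1) = - (\<Sum>i<N. \<Sum>j<i. u ^ j)" using assms by (simp add: field_simps)
  also have "\<dots> \<in> A" using assms by (intro subring_set_intros ring_A)
  finally show ?thesis .
qed

lemma coprime_not_divisible:
  assumes "coprime N p" shows "of_nat N / pp \<notin> A"
proof
  assume N: "of_nat N / pp \<in> A"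
  from assms have "coprime (int N) (int p)" by simp
  then obtain a b where "a * int N + b * int p = 1" by (metis bezout_int coprime_iff_gcd_eq_1)
  then have "of_int (a * int N + b * int p) = (1 :: 'a)" by simp
  then have "inverse pp = of_int a * (of_nat N / pp) + of_int b" by (simp add: field_simps)
  also have "\<dots> \<in> A" using N by (intro subring_setD(3,4)[OF ring_A] subring_set_of_int[OF ring_A])
  finally show False using pinv by simp
qed

end

locale unram_root = unram_ring A Ok R T p q m
  for A Ok R T :: "'a::field_char_0 set" and p q m :: nat +
  fixes z :: 'a and N :: nat
  assumes z_A: "z \<in> A" and root: "z ^ N = 1" and N_pos: "N > 0" and N_coprime: "coprime N p"
begin

text \<open>The ring \<open>Ok\<close>[z]. Polynomials of arbitrary degree make closure under
  products immediate; that the powers below N suffice is shown in \<open>B_span\<close>, and this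
  finiteness gives completeness.\<close>

definition B :: "'a set" where "B = {poly P z | P. P \<in> polys_over Ok}"

definition cg :: "'a \<Rightarrow> 'a \<Rightarrow> bool" where "cg x y \<longleftrightarrow> (x - y) / pp \<in> B"

lemma ring_B: "subring_set B"
proof -
  note PR = subring_setD[OF subring_set_polys_over[OF ring_Ok]]
  show ?thesis unfolding subring_set_def B_def
  proof (intro conjI ballI)
    show "0 \<in> {poly P z |P. P \<in> polys_over Ok}" using PR(1) by (metis (mono_tags, lifting) mem_Collect_eq poly_0)
    show "1 \<in> {poly P z |P. P \<in> polys_over Ok}" using PR(2) by (metis (mono_tags, lifting) mem_Collect_eq poly_1)
  next
    fix x y assume "x \<in> {poly P z |P. P \<in> polys_over Ok}" "y \<in> {poly P z |P. P \<in> polys_over Ok}"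
    then obtain P Q where "x = poly P z" "P \<in> polys_over Ok" "y = poly Q z" "Q \<in> polys_over Ok" by blast
    then show "x + y \<in> {poly P z |P. P \<in> polys_over Ok}" "x * y \<in> {poly P z |P. P \<in> polys_over Ok}"
      using PR(3,4)[of P Q] by (metis (mono_tags, lifting) mem_Collect_eq poly_add poly_mult)+
  next
    fix x assume "x \<in> {poly P z |P. P \<in> polys_over Ok}"
    then obtain P where "x = poly P z" "P \<in> polys_over Ok" by blast
    then show "- x \<in> {poly P z |P. P \<in> polys_over Ok}"
      using PR(5)[of P] by (metis (mono_tags, lifting) mem_Collect_eq poly_minus)
  qed
qed

lemmas B_intros = subring_set_intros[OF ring_B]

lemma Ok_B: "x \<in> Ok \<Longrightarrow> x \<in> B"
  unfolding B_def by (auto intro!: exI[of _ "[:x:]"] simp: polys_over_def coeff_pCons subring_setD[OF ring_Ok] split: nat.splits)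

lemma z_B: "z \<in> B"
  unfolding B_def by (auto intro!: exI[of _ "[:0, 1:]"] simp: polys_over_def coeff_pCons subring_setD[OF ring_Ok] split: nat.splits)

lemma B_sub: "B \<subseteq> A"
proof -
  have "P \<in> polys_over A" if "P \<in> polys_over Ok" for P
    using that Ok_sub by (auto simp: polys_over_def)
  then show ?thesis unfolding B_def using z_A by (auto intro!: poly_in_subring[OF ring_A])
qed

lemma z_power_mod: "z ^ i = z ^ (i mod N)"
proof -
  have "z ^ i = z ^ (N * (i div N) + i mod N)" by simp
  also have "\<dots> = z ^ (i mod N)" by (simp only: power_add power_mult root power_one mult_1)
  finally show ?thesis .
qed

lemma B_span: "B = span_over Ok {..<N} (\<lambda>i. z ^ i)"
proof
  show "span_over Ok {..<N} (\<lambda>i. z ^ i) \<subseteq> B"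
    unfolding span_over_def by (auto intro!: B_intros z_B intro: Ok_B)
  have "z ^ i \<in> span_over Ok {..<N} (\<lambda>i. z ^ i)" for i
    using span_over_base[OF ring_Ok, of "{..<N}" "i mod N" "\<lambda>i. z ^ i"] N_pos z_power_mod[of i] by auto
  then show "B \<subseteq> span_over Ok {..<N} (\<lambda>i. z ^ i)"
    unfolding B_def poly_altdef
    by (auto intro!: span_over_sum[OF ring_Ok] span_over_scale[OF ring_Ok] simp: polys_over_def)
qed

lemma pcomplete_B: "pcomplete p B"
  unfolding B_span by (rule pcomplete_span_over[OF pcomplete_Ok _ pp_nz(2)]) simp

lemma pcomplete_B_limit:
  assumes "\<And>i. y i \<in> B"
  obtains a where "a \<in> B" "\<And>k. (a - (\<Sum>i<k. pp ^ i * y i)) / pp ^ k \<in> B"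
  using pcompleteE[OF pcomplete_B, of y] assms by blast

lemma p_divisible_zero_B: "(\<And>k. x / pp ^ k \<in> B) \<Longrightarrow> x = 0"
  using p_divisible_zero B_sub by blast

lemma pinv_B: "1 / pp \<notin> B"
  using pinv B_sub by (auto simp: divide_inverse)

lemma cg_refl [simp]: "cg x x" unfolding cg_def by (simp add: B_intros)

lemma cg_sym: "cg x y \<Longrightarrow> cg y x"
  unfolding cg_def using B_intros(5)[of "(x - y) / pp"] by (simp add: diff_divide_distrib)

lemma cg_trans: "cg x y \<Longrightarrow> cg y w \<Longrightarrow> cg x w"
  unfolding cg_def using B_intros(3)[of "(x - y) / pp" "(y - w) / pp"]
  by (simp add: diff_divide_distrib)

lemma cg_add: "cg x y \<Longrightarrow> cg x' y' \<Longrightarrow> cg (x + x') (y + y')"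
  unfolding cg_def using B_intros(3)[of "(x - y) / pp" "(x' - y') / pp"]
  by (simp add: diff_divide_distrib add_divide_distrib algebra_simps)

lemma cg_minus: "cg x y \<Longrightarrow> cg (- x) (- y)"
  unfolding cg_def using B_intros(5)[of "(x - y) / pp"] by (simp add: diff_divide_distrib)

lemma cg_diff: "cg x y \<Longrightarrow> cg x' y' \<Longrightarrow> cg (x - x') (y - y')"
  using cg_add[of x y "- x'" "- y'"] cg_minus by simp

lemma cg_mult:
  assumes "cg x y" "cg x' y'" "x' \<in> B" "y \<in> B" shows "cg (x * x') (y * y')"
proof -
  have "(x * x' - y * y') / pp = (x - y) / pp * x' + y * ((x' - y') / pp)" by (simp add: field_simps)
  moreover have "\<dots> \<in> B" using assms unfolding cg_def by (intro B_intros)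
  ultimately show ?thesis unfolding cg_def by simp
qed

lemma cg_closed: "cg x y \<Longrightarrow> y \<in> B \<Longrightarrow> x \<in> B"
proof -
  assume "cg x y" "y \<in> B"
  then have "pp * ((x - y) / pp) + y \<in> B" unfolding cg_def by (intro B_intros) auto
  then show ?thesis by simp
qed

lemma cg_power:
  assumes "cg x y" "y \<in> B" shows "cg (x ^ n) (y ^ n)"
  using cg_closed[OF assms] assms by (induction n) (auto intro!: cg_mult B_intros)

lemma cg_power_p_add:
  assumes "x \<in> B" "y \<in> B" shows "cg ((x + y) ^ p) (x ^ p + y ^ p)"
proof -
  have *: "{..p} = insert 0 (insert p {0<..<p})" using pp_nz by auto
  have "(x + y) ^ p = (\<Sum>k\<le>p. of_nat (p choose k) * x ^ k * y ^ (p - k))" by (rule binomial_ring)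
  also have "\<dots> = x ^ p + y ^ p + (\<Sum>k\<in>{0<..<p}. of_nat (p choose k) * x ^ k * y ^ (p - k))"
    unfolding * using pp_nz(2) by (subst sum.insert) auto
  finally have eq: "((x + y) ^ p - (x ^ p + y ^ p)) / pp
     = (\<Sum>k\<in>{0<..<p}. of_nat (p choose k) / pp * x ^ k * y ^ (p - k))"
    by (simp add: sum_divide_distrib)
  have "of_nat (p choose k) / pp \<in> B" if "k \<in> {0<..<p}" for k
  proof -
    have "p dvd (p choose k)" using that prime_p by (intro dvd_choose_prime) auto
    then obtain c where "p choose k = p * c" by blast
    then show ?thesis by (simp add: B_intros)
  qed
  then show ?thesis unfolding cg_def eq using assms by (intro B_intros) auto
qed

lemma cg_power_pm_add:
  assumes "x \<in> B" "y \<in> B" shows "cg ((x + y) ^ (p ^ k)) (x ^ (p ^ k) + y ^ (p ^ k))"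
proof (induction k)
  case (Suc k)
  have "(x + y) ^ (p ^ Suc k) = ((x + y) ^ (p ^ k)) ^ p" by (simp only: power_Suc2 power_mult)
  moreover have "cg \<dots> ((x ^ (p ^ k) + y ^ (p ^ k)) ^ p)"
    by (rule cg_power[OF Suc]) (use assms in \<open>auto intro!: B_intros\<close>)
  moreover have "cg \<dots> ((x ^ (p ^ k)) ^ p + (y ^ (p ^ k)) ^ p)"
    by (rule cg_power_p_add) (use assms in \<open>auto intro!: B_intros\<close>)
  moreover have "(x ^ (p ^ k)) ^ p + (y ^ (p ^ k)) ^ p = x ^ (p ^ Suc k) + y ^ (p ^ Suc k)"
    by (simp only: power_Suc2 power_mult)
  ultimately show ?case by (metis cg_trans)
qed simp

lemma cg_frob_add: "x \<in> B \<Longrightarrow> y \<in> B \<Longrightarrow> cg ((x + y) ^ q) (x ^ q + y ^ q)"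
  unfolding q_eq by (rule cg_power_pm_add)

text \<open>Oddness of p enters through (-y)^q = -y^q.\<close>

lemma cg_frob_diff: "x \<in> B \<Longrightarrow> y \<in> B \<Longrightarrow> cg ((x - y) ^ q) (x ^ q - y ^ q)"
  using cg_frob_add[of x "- y"] B_intros(5)[of y] odd_p by (simp add: q_eq power_minus_odd)

lemma cg_frob_Ok: "c \<in> Ok \<Longrightarrow> cg (c ^ q) c"
  using frob_Ok Ok_B unfolding cg_def by blast

lemma polys_over_pCons: "pCons a P \<in> polys_over S \<longleftrightarrow> a \<in> S \<and> P \<in> polys_over S"
  by (auto simp: polys_over_def coeff_pCons split: nat.splits dest: spec[of _ 0] spec[of _ "Suc _"])

lemma poly_B: "P \<in> polys_over Ok \<Longrightarrow> x \<in> B \<Longrightarrow> poly P x \<in> B"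
  by (rule poly_in_subring[OF ring_B]) (auto simp: polys_over_def Ok_B)

text \<open>Modulo p the q-th power is additive and multiplicative and fixes the coefficients, which
  lie in \<open>Ok\<close>; so it acts on the argument alone.\<close>

lemma cg_frob_poly:
  assumes "P \<in> polys_over Ok" "x \<in> B" shows "cg (poly P x ^ q) (poly P (x ^ q))"
  using assms(1)
proof (induction P)
  case 0
  have "(0 :: 'a) ^ q = 0" using q_ge_2 by (intro zero_power) simp
  then show ?case by (simp add: power_0_left)
next
  case (pCons a P)
  then have a: "a \<in> Ok" and P: "P \<in> polys_over Ok" by (auto simp: polys_over_pCons)
  have "cg ((a + x * poly P x) ^ q) (a ^ q + (x * poly P x) ^ q)"
    using a P assms(2) by (intro cg_frob_add B_intros poly_B) (auto intro: Ok_B)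
  moreover have "cg (a ^ q + (x * poly P x) ^ q) (a + x ^ q * poly P (x ^ q))"
    unfolding power_mult_distrib
    by (intro cg_add cg_mult pCons.IH cg_frob_Ok a P cg_refl B_intros poly_B assms(2))
  ultimately have "cg ((a + x * poly P x) ^ q) (a + x ^ q * poly P (x ^ q))" by (rule cg_trans)
  then show ?case by simp
qed

lemma cg_frob_iterate:
  assumes "P \<in> polys_over Ok" shows "cg (poly P z ^ (q ^ k)) (poly P (z ^ (q ^ k)))"
proof (induction k)
  case (Suc k)
  have "poly P z ^ (q ^ Suc k) = (poly P z ^ (q ^ k)) ^ q" by (simp only: power_Suc2 power_mult)
  moreover have "cg \<dots> (poly P (z ^ (q ^ k)) ^ q)"
    by (rule cg_power[OF Suc]) (intro poly_B assms B_intros z_B)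
  moreover have "cg \<dots> (poly P ((z ^ (q ^ k)) ^ q))"
    by (intro cg_frob_poly assms B_intros z_B)
  moreover have "(z ^ (q ^ k)) ^ q = z ^ (q ^ Suc k)" by (simp only: power_Suc2 power_mult)
  ultimately show ?case by (metis cg_trans)
qed simp

lemma N_coprime_q: "coprime q N" unfolding q_eq using N_coprime by (simp add: ac_simps)

text \<open>By Euler's theorem some positive power of q is 1 modulo N, so it acts trivially on the
  exponents of z.\<close>

lemma frob_order: obtains s where "s > 0" "z ^ (q ^ s) = z"
proof -
  have "[q ^ totient N = 1] (mod N)" using N_coprime_q by (rule euler_theorem)
  then have "q ^ totient N mod N = 1 mod N" by (simp add: cong_def)
  then have "z ^ (q ^ totient N) = z ^ 1" using z_power_mod by metis
  then show ?thesis using that[of "totient N"] N_pos by simp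
qed

text \<open>The inverse is the geometric series in -p b, which completeness allows to be summed. Its
  partial sums show that the product differs from 1 by a multiple of every p^k.\<close>

lemma one_plus_p_unit:
  assumes "b \<in> B" obtains u where "u \<in> B" "(1 + pp * b) * u = 1"
proof -
  have "(- b) ^ i \<in> B" for i using assms by (intro B_intros)
  then obtain u where u: "u \<in> B" "\<And>k. (u - (\<Sum>i<k. pp ^ i * (- b) ^ i)) / pp ^ k \<in> B"
    using pcomplete_B_limit by blast
  have "((1 + pp * b) * u - 1) / pp ^ k \<in> B" for k
  proof -
    let ?S = "\<Sum>i<k. pp ^ i * (- b) ^ i"
    have "(1 - (- (pp * b))) * (\<Sum>i<k. (- (pp * b)) ^ i) = 1 - (- (pp * b)) ^ k"
      by (rule one_diff_power_eq[symmetric])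
    then have S: "(1 + pp * b) * ?S = 1 - (pp * (- b)) ^ k"
      by (simp flip: power_mult_distrib)
    have "((1 + pp * b) * u - 1) / pp ^ k = (1 + pp * b) * ((u - ?S) / pp ^ k) + ((1 + pp * b) * ?S - 1) / pp ^ k"
      by (simp add: field_simps)
    also have "((1 + pp * b) * ?S - 1) / pp ^ k = - ((- b) ^ k)"
      unfolding S power_mult_distrib by simp
    finally show ?thesis by (simp only:) (intro B_intros u(2) assms)
  qed
  then have "(1 + pp * b) * u = 1" using p_divisible_zero_B[of "(1 + pp * b) * u - 1"] by simp
  with u(1) show ?thesis using that by blast
qed

text \<open>The iteration \<open>e \<mapsto> 3 e\<^sup>2 - 2 e\<^sup>3\<close> squares the defect \<open>e\<^sup>2 - e\<close>. It lifts an idempotent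
  modulo \<open>p\<close> to an idempotent of the domain \<open>B\<close>.\<close>

lemma idempotent_mod_p:
  assumes e: "e \<in> B" and "cg (e ^ 2) e"
  shows "cg e 0 \<or> cg e 1"
proof -
  define h where "h x = 3 * x ^ 2 - 2 * x ^ 3" for x :: 'a
  define E where "E k = (h ^^ k) e" for k
  have num: "numeral n \<in> B" for n using subring_set_of_nat[OF ring_B, of "numeral n"] by simp
  have hB: "h x \<in> B" if "x \<in> B" for x unfolding h_def using that num by (intro B_intros)
  have EB: "E k \<in> B" for k unfolding E_def by (induction k) (auto simp: e hB)
  have id: "(h x) ^ 2 - h x = (x ^ 2 - x) ^ 2 * (4 * x ^ 2 - 4 * x - 3)" for x :: 'a
    unfolding h_def by (simp add: power2_eq_square power3_eq_cube algebra_simps)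
  have def_: "(E k ^ 2 - E k) / pp ^ Suc k \<in> B" for k
  proof (induction k)
    case 0 then show ?case using assms(2) by (simp add: E_def cg_def)
  next
    case (Suc k)
    have "(E (Suc k) ^ 2 - E (Suc k)) / pp ^ Suc (Suc k)
        = ((E k ^ 2 - E k) / pp ^ Suc k) ^ 2 * pp ^ k * (4 * E k ^ 2 - 4 * E k - 3)"
    proof -
      have "E (Suc k) = h (E k)" by (simp add: E_def)
      then have "E (Suc k) ^ 2 - E (Suc k) = (E k ^ 2 - E k) ^ 2 * (4 * E k ^ 2 - 4 * E k - 3)" by (simp add: id)
      \<comment> \<open>Squaring doubles the exponent k + 1, but only k + 2 is needed for the next
        step; the surplus p^k stays as a factor in \<open>B\<close>.\<close>
      moreover have "(pp ^ Suc k) ^ 2 = pp ^ Suc (Suc k) * pp ^ k" by (simp add: power2_eq_square)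
      ultimately show ?thesis by (simp only: power_divide) (simp del: power_Suc)
    qed
    also have "\<dots> \<in> B" using Suc EB num by (intro B_intros)
    finally show ?case .
  qed
  \<comment> \<open>Since h x - x = -(2 x - 1)(x^2 - x), successive iterates differ by a multiple of
    p^(i+1). Dividing by p^i therefore stays in \<open>B\<close>, and the resulting series
    telescopes.\<close>
  define y where "y i = (E (Suc i) - E i) / pp ^ i" for i
  have "y i = - (2 * E i - 1) * ((E i ^ 2 - E i) / pp ^ Suc i) * pp" for i
    unfolding y_def E_def by (simp add: h_def field_simps power2_eq_square power3_eq_cube)
  then have yB: "y i \<in> B" for i using def_ EB num by (simp only:) (intro B_intros)
  then obtain a where a: "a \<in> B" "\<And>k. (a - (\<Sum>i<k. pp ^ i * y i)) / pp ^ k \<in> B"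
    using pcomplete_B_limit by blast
  have tel: "(\<Sum>i<k. pp ^ i * y i) = E k - e" for k
    by (induction k) (auto simp: y_def E_def)
  define b where "b = a + e"
  have bB: "b \<in> B" unfolding b_def using a(1) e by (intro B_intros)
  have bE: "(b - E k) / pp ^ k \<in> B" for k using a(2)[of k] unfolding tel b_def by (simp add: algebra_simps)
  have "(b ^ 2 - b) / pp ^ k \<in> B" for k
  proof -
    have "(b ^ 2 - b) / pp ^ k = (b - E k) / pp ^ k * (b + E k - 1) + (E k ^ 2 - E k) / pp ^ Suc k * pp"
      by (simp add: field_simps power2_eq_square)
    also have "\<dots> \<in> B" using bE def_ bB EB by (intro B_intros)
    finally show ?thesis .
  qed
  then have "b ^ 2 - b = 0" by (rule p_divisible_zero_B)
  \<comment> \<open>The limit is an honest idempotent inside a field, hence 0 or 1, and it is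
    congruent to e.\<close>
  then have "b * (b - 1) = 0" by (simp add: power2_eq_square algebra_simps)
  then have "b = 0 \<or> b = 1" by auto
  moreover have "cg b (E 1)" using bE[of 1] by (simp add: cg_def)
  moreover have "cg (E 1) e"
  proof -
    have "(E 1 - e) / pp = - (2 * e - 1) * ((e ^ 2 - e) / pp)"
      unfolding E_def h_def by (simp add: field_simps power2_eq_square power3_eq_cube)
    also have "\<dots> \<in> B" using assms(2) num e unfolding cg_def by (intro B_intros)
    finally show ?thesis unfolding cg_def .
  qed
  ultimately show ?thesis using cg_trans cg_sym by blast
qed

text \<open>Some power of Frobenius fixes \<open>B\<close> modulo \<open>p\<close>, so a suitable power of \<open>b\<close> is idempotent there.\<close>

lemma local_B:
  assumes b: "b \<in> B" and "b / pp \<notin> B"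
  obtains u where "u \<in> B" "b * u = 1"
proof -
  obtain P where P: "P \<in> polys_over Ok" "b = poly P z" using b unfolding B_def by blast
  obtain s where s: "s > 0" "z ^ (q ^ s) = z" using frob_order by blast
  define Q where "Q = q ^ s"
  \<comment> \<open>The exponent depends on z alone, so one power of Frobenius fixes all of
    \<open>B\<close> modulo p.\<close>
  have bQ: "cg (b ^ Q) b" using cg_frob_iterate[OF P(1), of s] s(2) unfolding P(2) Q_def by simp
  have Q2: "Q \<ge> 2" unfolding Q_def using s(1) q_ge_2 by (meson le_trans self_le_power one_le_numeral)
  then have r: "Q = Suc (Suc (Q - 2))" by simp
  define r where "r = Q - 2"
  note r = r[folded r_def]
  \<comment> \<open>The exponent is Q - 1, so e^2 = b^Q b^(Q-2) is congruent to b b^(Q-2) =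
    e.\<close>
  define e where "e = b ^ Suc r"
  have eB: "e \<in> B" unfolding e_def using b by (intro B_intros)
  have "cg (b ^ Q * b ^ r) (b * b ^ r)" using bQ b by (intro cg_mult B_intros) auto
  then have "cg (e ^ 2) e" unfolding e_def r by (simp add: power2_eq_square power_add[symmetric] flip: power_Suc)
  then consider "cg e 0" | "cg e 1" using idempotent_mod_p[OF eB] by blast
  then show ?thesis
  proof cases
    case 1
    have "cg (b * e) (b * 0)" using 1 b eB by (intro cg_mult) auto
    moreover have "b * e = b ^ Q" by (simp add: e_def r)
    ultimately have "cg b 0" using bQ cg_trans cg_sym by (metis mult_zero_right)
    with assms(2) show ?thesis by (simp add: cg_def)
  next
    case 2
    define c where "c = (e - 1) / pp"
    have "c \<in> B" using 2 by (simp add: cg_def c_def)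
    then obtain u where u: "u \<in> B" "(1 + pp * c) * u = 1" using one_plus_p_unit by blast
    have "b * (b ^ r * u) = (1 + pp * c) * u" unfolding c_def e_def by simp
    then show ?thesis using that[of "b ^ r * u"] u b by (simp add: B_intros)
  qed
qed

section \<open>Roots of polynomials modulo p\<close>

lemma prime_B:
  assumes "x \<in> B" "y \<in> B" "x * y / pp \<in> B" "x / pp \<notin> B" shows "y / pp \<in> B"
proof -
  obtain u where "u \<in> B" "x * u = 1" using local_B[OF assms(1,4)] by blast
  then have "y / pp = u * (x * y / pp)"
    by (metis mult.assoc mult.commute mult_1 times_divide_eq_right)
  moreover have "u * (x * y / pp) \<in> B" using \<open>u \<in> B\<close> assms(3) by (intro B_intros)
  ultimately show ?thesis by (simp only:)
qed

text \<open>Lagrange's bound on the number of roots over the domain \<open>B\<close>/p, phrased in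
  \<open>B\<close> itself: distinctness becomes incongruence, and vanishing becomes divisibility by
  p. The division step rests on \<open>prime_B\<close>.\<close>

lemma card_roots_mod_p:
  assumes "P \<in> polys_over B" "Polynomial.lead_coeff P = 1" "finite Y" "Y \<subseteq> B"
    and "\<And>x y. x \<in> Y \<Longrightarrow> y \<in> Y \<Longrightarrow> x \<noteq> y \<Longrightarrow> (x - y) / pp \<notin> B"
    and "\<And>x. x \<in> Y \<Longrightarrow> poly P x / pp \<in> B"
  shows "card Y \<le> Polynomial.degree P"
  using assms
proof (induction "Polynomial.degree P" arbitrary: P Y)
  case 0
  then have "P = 1" by (metis degree_eq_zeroE lead_coeff_pCons(2) one_pCons)
  then have "Y = {}" using 0 pinv_B by auto
  then show ?case by simp
next
  case (Suc n)
  show ?case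
  proof (cases "Y = {}")
    case False
    then obtain a where a: "a \<in> Y" by blast
    define S where "S = synthetic_div P a"
    have eq: "P = [:poly P a:] + [:- a, 1:] * S"
      using synthetic_div_correct'[of a P] by (simp add: S_def add.commute)
    have degS: "Polynomial.degree S = n" using Suc(2) by (simp add: S_def degree_synthetic_div)
    have co: "Polynomial.coeff S k = Polynomial.coeff P (Suc k) + a * Polynomial.coeff S (Suc k)" for k
    proof -
      have "Polynomial.coeff P (Suc k) = Polynomial.coeff ([:poly P a:] + [:- a, 1:] * S) (Suc k)" using eq by simp
      then show ?thesis by simp
    qed
    have leadS: "Polynomial.lead_coeff S = 1"
      using co[of n] Suc(2,4) degS by (simp add: coeff_eq_0)
    have aB: "a \<in> B" using a Suc by blast
    \<comment> \<open>The recursion for the coefficients of the quotient runs from the top down, so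
      the induction is on the distance from k to the degree of P.\<close>
    have "Polynomial.coeff S k \<in> B" for k
    proof (induction "Suc n - k" arbitrary: k)
      case 0 then show ?case using degS by (simp add: coeff_eq_0 B_intros)
    next
      case (Suc j)
      then have "Polynomial.coeff S (Suc k) \<in> B" by (metis Suc_inject Suc_diff_Suc zero_less_Suc zero_less_diff)
      then show ?case using co[of k] aB \<open>P \<in> polys_over B\<close> by (auto simp: polys_over_def intro!: B_intros)
    qed
    then have SB: "S \<in> polys_over B" by (simp add: polys_over_def)
    have "card (Y - {a}) \<le> Polynomial.degree S"
    proof (rule Suc(1))
      fix x assume x: "x \<in> Y - {a}"
      have "(x - a) * poly S x = poly P x - poly P a" by (subst eq) (simp add: algebra_simps)
      then have "(x - a) * poly S x / pp = poly P x / pp - poly P a / pp" by (simp only: diff_divide_distrib)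
      then have "(x - a) * poly S x / pp \<in> B" using Suc.prems(6) a x by (auto intro!: B_intros)
      moreover have "(x - a) / pp \<notin> B" using Suc.prems(5) a x by auto
      ultimately show "poly S x / pp \<in> B" using prime_B[of "x - a" "poly S x"] x aB Suc.prems(4) SB
        by (auto intro: B_intros poly_in_subring[OF ring_B])
    qed (use degS leadS SB Suc.prems in auto)
    then show ?thesis using a Suc.prems(3) Suc(2) degS by (metis Suc_le_mono card_Suc_Diff1)
  qed simp
qed

text \<open>The q elements of \<open>T\<close> are incongruent roots of X^q - X modulo p and already
  attain the degree bound, so there is no room for a further root c. Residues fixed by Frobenius
  thus come from K.\<close>

lemma frob_fixed_in_Ok:
  assumes c: "c \<in> B" "cg (c ^ q) c"
  shows "\<exists>a\<in>Ok. cg c a"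
proof (rule ccontr)
  assume no: "\<not> ?thesis"
  note q2 = q_ge_2
  define P :: "'a poly" where "P = Polynomial.monom 1 q - [:0, 1:]"
  have PB: "P \<in> polys_over B"
    unfolding P_def polys_over_def by (auto simp: coeff_pCons B_intros split: nat.splits)
  have degP: "Polynomial.degree P = q"
    unfolding P_def using q2
    by (intro antisym degree_le le_degree) (auto simp: coeff_pCons split: nat.splits)
  have lead: "Polynomial.lead_coeff P = 1" using q2 unfolding degP by (auto simp: P_def coeff_pCons split: nat.splits)
  have polyP: "poly P x = x ^ q - x" for x by (simp add: P_def poly_monom)
  have "c \<notin> T" using no T_sub by (meson cg_refl subsetD)
  have cT: "(c - t) / pp \<notin> B" if "t \<in> T" for t using no T_sub that unfolding cg_def by blast
  have "card (insert c T) \<le> Polynomial.degree P"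
  proof (rule card_roots_mod_p[OF PB lead])
    fix x y assume "x \<in> insert c T" "y \<in> insert c T" "x \<noteq> y"
    then show "(x - y) / pp \<notin> B"
      using cT T_distinct B_sub cg_sym[of x y] unfolding cg_def by blast
  next
    fix x assume "x \<in> insert c T"
    then show "poly P x / pp \<in> B" using c T_sub cg_frob_Ok unfolding polyP cg_def by auto
  qed (use finite_T T_sub c Ok_B in auto)
  then show False using \<open>c \<notin> T\<close> finite_T card_T degP by simp
qed

end

section \<open>Conjugates of roots of unity and Eisenstein extensions\<close>

lemma map_poly_to_ac_simps [simp]:
  "map_poly to_ac (P + Q) = map_poly to_ac P + map_poly to_ac Q"
  "map_poly to_ac (pCons a P) = pCons (to_ac a) (map_poly to_ac P)"
  "map_poly to_ac (Polynomial.smult a P) = Polynomial.smult (to_ac a) (map_poly to_ac P)"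
  "map_poly to_ac (- P) = - map_poly to_ac P"
  "map_poly to_ac (P - Q) = map_poly to_ac P - map_poly to_ac Q"
  "map_poly to_ac (Polynomial.monom a n) = Polynomial.monom (to_ac a) n"
  by (rule poly_eqI; simp add: coeff_map_poly coeff_pCons split: nat.split)+

lemma map_poly_to_ac_mult [simp]: "map_poly to_ac (P * Q) = map_poly to_ac P * map_poly to_ac Q"
  by (induction P) simp_all

lemma map_poly_to_ac_1 [simp]: "map_poly to_ac 1 = 1"
  by (simp add: one_pCons)

lemma map_poly_to_ac_power [simp]: "map_poly to_ac (P ^ n) = map_poly to_ac P ^ n"
  by (induction n) simp_all

lemma map_poly_to_ac_dvd: "P dvd Q \<Longrightarrow> map_poly to_ac P dvd map_poly to_ac Q"
  by (auto elim!: dvdE)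

lemma minimal_polynomial:
  fixes x :: "'k::field alg_closure"
  obtains g :: "'k poly" where "Polynomial.lead_coeff g = 1" "ac_map g x = 0"
    "\<And>P. ac_map P x = 0 \<Longrightarrow> g dvd P"
proof -
  define V where "V = {P :: 'k poly. P \<noteq> 0 \<and> ac_map P x = 0}"
  obtain P0 where "P0 \<in> V" using alg_closure_algebraic[of x] unfolding V_def ac_map_def by blast
  then obtain g0 where g0: "g0 \<in> V" "\<And>P. P \<in> V \<Longrightarrow> Polynomial.degree g0 \<le> Polynomial.degree P"
    using arg_min_nat_lemma[of "\<lambda>P. P \<in> V" P0 Polynomial.degree] by blast
  define g where "g = Polynomial.smult (inverse (Polynomial.lead_coeff g0)) g0"
  have "g0 \<noteq> 0" using g0(1) by (simp add: V_def)
  then have lead: "Polynomial.lead_coeff g = 1" by (simp add: g_def)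
  have root: "ac_map g x = 0" using g0(1) by (simp add: g_def V_def ac_map_def)
  have "g dvd P" if "ac_map P x = 0" for P
  proof (rule ccontr)
    assume "\<not> g dvd P"
    then have nz: "P mod g \<noteq> 0" by (simp add: dvd_eq_mod_eq_0)
    have "P mod g = P - P div g * g" by (simp add: minus_div_mult_eq_mod)
    then have "ac_map (P mod g) x = 0" using that root by (simp add: ac_map_def)
    with nz have "P mod g \<in> V" by (simp add: V_def)
    then have "Polynomial.degree g0 \<le> Polynomial.degree (P mod g)" by (rule g0(2))
    moreover have "Polynomial.degree g = Polynomial.degree g0" using \<open>g0 \<noteq> 0\<close> by (simp add: g_def)
    moreover have "g \<noteq> 0" using lead by auto
    ultimately show False using degree_mod_less[of g P] nz by auto
  qed
  with lead root show ?thesis using that by blast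
qed

lemma linear_prod_polys_over:
  assumes "subring_set S" "\<And>r. r \<in># M \<Longrightarrow> r \<in> S"
  shows "(\<Prod>r\<in>#M. [:- r, 1:]) \<in> polys_over S"
  using assms(2)
proof (induction M)
  case (add r M)
  have "[:- r, 1:] \<in> polys_over S" using add.prems assms(1)
    by (auto simp: polys_over_def coeff_pCons subring_setD split: nat.splits)
  then have "[:- r, 1:] * (\<Prod>r\<in>#M. [:- r, 1:]) \<in> polys_over S"
    using add by (intro subring_setD(4)[OF subring_set_polys_over[OF assms(1)]]) auto
  then show ?case by (simp only: image_mset_add_mset prod_mset.add_mset)
qed (use subring_setD(2)[OF subring_set_polys_over[OF assms(1)]] in simp)

text \<open>The ambient field is now an algebraic closure of K, so minimal polynomials split.
  \<open>A_root\<close> brings roots of unity and roots of p into \<open>A\<close>.\<close>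

locale unram_field = unram_ring A Ok R T p q m
  for A Ok R T :: "'k::field_char_0 alg_closure set" and p q m :: nat +
  assumes Ok_eq: "Ok = A \<inter> range to_ac"
    and A_root: "\<And>x n. x ^ n \<in> A \<Longrightarrow> n > 0 \<Longrightarrow> x \<in> A"
begin

lemma unity_A: "x ^ N = 1 \<Longrightarrow> N > 0 \<Longrightarrow> x \<in> A"
  using A_root[of x N] subring_setD(2)[OF ring_A] by simp

lemma unity_diff_A:
  assumes "r ^ N = 1" "r' ^ N = 1" "r \<noteq> r'" "N > 0"
  shows "of_nat N / (r - r') \<in> A"
proof -
  have nz: "r' \<noteq> 0" using assms(2,4) by (auto simp: power_0_left)
  define u where "u = r / r'"
  have u: "u ^ N = 1" "u \<noteq> 1" using assms nz by (auto simp: u_def power_divide)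
  have "inverse r' \<in> A" using unity_A[of "inverse r'" N] assms(2,4) by (simp add: power_inverse)
  then have "of_nat N / (u - 1) * inverse r' \<in> A"
    using root_diff_unit[OF unity_A[OF u(1) assms(4)] u assms(4)] by (rule subring_setD(4)[OF ring_A, rotated])
  moreover have "of_nat N / (u - 1) * inverse r' = of_nat N / (r - r')"
    using nz assms(3) by (simp add: u_def field_simps)
  ultimately show ?thesis by simp
qed

text \<open>Each difference w - r divides N, so the product divides a power of N, which is prime to
  p. Used contrapositively: if a product of linear factors over N-th roots of unity has a value at w
  divisible by p, then w is one of the roots.\<close>

lemma unity_prod_not_divisible:
  assumes "w ^ N = 1" "N > 0" "coprime N p" "\<And>r. r \<in># M \<Longrightarrow> r ^ N = 1 \<and> r \<noteq> w"
  shows "(\<Prod>r\<in>#M. w - r) / pp \<notin> A"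
proof
  assume div: "(\<Prod>r\<in>#M. w - r) / pp \<in> A"
  have "of_nat N ^ size M / (\<Prod>r\<in>#M. w - r) \<in> A \<and> (\<Prod>r\<in>#M. w - r) \<noteq> 0"
    using assms(4)
  proof (induction M)
    case (add r M)
    have "of_nat N / (w - r) * (of_nat N ^ size M / (\<Prod>r\<in>#M. w - r)) \<in> A"
      using add by (intro subring_setD(4)[OF ring_A] unity_diff_A assms(1,2)) auto
    with add show ?case by auto
  qed (simp add: subring_setD[OF ring_A])
  moreover define W where "W = (\<Prod>r\<in>#M. w - r)"
  ultimately have W: "of_nat N ^ size M / W \<in> A" "W \<noteq> 0" "W / pp \<in> A" using div by simp_all
  have "(of_nat N ^ size M / W) * (W / pp) \<in> A" by (rule subring_setD(4)[OF ring_A W(1,3)])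
  then have "of_nat (N ^ size M) / pp \<in> A" using W(2) by simp
  moreover have "coprime (N ^ size M) p" using assms(3) by simp
  ultimately show False using coprime_not_divisible by blast
qed

lemma polys_over_Ok_lift:
  assumes "Q \<in> polys_over Ok" obtains P where "Q = map_poly to_ac P"
proof -
  have "Q = map_poly to_ac (map_poly of_ac Q)"
  proof (rule poly_eqI)
    fix i
    have "Polynomial.coeff Q i \<in> range to_ac" using assms Ok_eq by (auto simp: polys_over_def)
    then show "Polynomial.coeff Q i = Polynomial.coeff (map_poly to_ac (map_poly of_ac Q)) i"
      by (simp add: coeff_map_poly to_ac_of_ac)
  qed
  then show ?thesis using that by blast
qed

lemma range_to_ac_scale: "\<exists>M. pp ^ M * to_ac c \<in> Ok"
proof (cases "c = 0")
  case True then show ?thesis using subring_setD(1)[OF ring_Ok] by simp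
next
  case False
  then obtain M where "pp ^ M / (inverse (to_ac c)) \<in> A" using absorb[of "inverse (to_ac c)"] by auto
  then have "pp ^ M * to_ac c \<in> A" by (simp add: divide_inverse)
  moreover have "pp ^ M * to_ac c = to_ac (of_nat p ^ M * c)" by simp
  ultimately show ?thesis using Ok_eq by (metis IntI rangeI)
qed

end

locale unram_field_root = unram_field A Ok R T p q m + unram_root A Ok R T p q m z N
  for A Ok R T :: "'k::field_char_0 alg_closure set" and p q m :: nat and z N
begin

text \<open>For the minimal polynomial G of z, the value G(z^q) is congruent to G(z)^q = 0 modulo p.
  As the roots of G are N-th roots of unity, z^q must be one of them.\<close>

lemma conj_frobenius:
  assumes "ac_map P z = 0" shows "ac_map P (z ^ q) = 0"
proof -
  obtain g where g: "Polynomial.lead_coeff g = 1" "ac_map g z = 0" "\<And>P. ac_map P z = 0 \<Longrightarrow> g dvd P"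
    using minimal_polynomial by blast
  define G where "G = map_poly to_ac g"
  have leadG: "Polynomial.lead_coeff G = 1" using g(1) unfolding G_def by (subst degree_map_poly) (auto simp: coeff_map_poly)
  then have "G \<noteq> 0" by auto
  then obtain M where "G = Polynomial.smult (Polynomial.lead_coeff G) (\<Prod>x\<in>#M. [:- x, 1:])"
    using alg_closed_imp_factorization by metis
  then have M: "G = (\<Prod>x\<in>#M. [:- x, 1:])" using leadG by simp
  have polyG: "poly G x = (\<Prod>r\<in>#M. x - r)" for x
    unfolding M by (induction M) (auto simp: algebra_simps)
  have "ac_map (Polynomial.monom 1 N - 1) z = 0" using root by (simp add: ac_map_def poly_monom)
  then have dvd: "G dvd Polynomial.monom 1 N - 1" using map_poly_to_ac_dvd[OF g(3)] unfolding G_def by fastforce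
  have Mr: "r ^ N = 1" if "r \<in># M" for r
  proof -
    have "poly G r = 0" unfolding polyG using that by (auto simp: prod_mset_zero_iff)
    then have "poly (Polynomial.monom 1 N - 1) r = 0" using dvd by (metis dvdE mult_zero_left poly_mult)
    then show ?thesis by (simp add: poly_monom)
  qed
  \<comment> \<open>The roots are integral, hence so are the coefficients of G; lying in K as well,
    they belong to \<open>Ok\<close>.\<close>
  have "G \<in> polys_over A" unfolding M by (rule linear_prod_polys_over[OF ring_A]) (use Mr unity_A N_pos in blast)
  then have GO: "G \<in> polys_over Ok" unfolding Ok_eq polys_over_def G_def by (auto simp: coeff_map_poly)
  have "poly G z = 0" using g(2) by (simp add: G_def ac_map_def)
  then have "cg 0 (poly G (z ^ q))" using cg_frob_poly[OF GO z_B] q_ge_2 by (simp add: power_0_left)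
  then have "poly G (z ^ q) / pp \<in> A" using cg_sym B_sub unfolding cg_def by fastforce
  moreover have "(z ^ q) ^ N = 1" using root by (simp flip: power_mult add: mult.commute[of q]) (simp add: power_mult)
  ultimately have "\<exists>r\<in>#M. r = z ^ q"
    using unity_prod_not_divisible[of "z ^ q" N M] N_pos N_coprime Mr unfolding polyG by blast
  then have "poly G (z ^ q) = 0" unfolding polyG by (auto simp: prod_mset_zero_iff)
  moreover have "G dvd map_poly to_ac P" unfolding G_def by (rule map_poly_to_ac_dvd) (rule g(3)[OF assms])
  ultimately show ?thesis unfolding ac_map_def by (auto elim!: dvdE)
qed

text \<open>Replacing each y_i by its q-th power raises the elementary symmetric functions to the
  q-th power modulo p. This is meant for the Frobenius orbit of z, whose linear factors the
  replacement merely permutes.\<close>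

lemma coeff_prod_frob:
  assumes "finite I" "\<And>i. i \<in> I \<Longrightarrow> y i \<in> B"
  shows "Polynomial.coeff (\<Prod>i\<in>I. [:- y i, 1:]) k \<in> B \<and>
    cg (Polynomial.coeff (\<Prod>i\<in>I. [:- y i, 1:]) k ^ q) (Polynomial.coeff (\<Prod>i\<in>I. [:- (y i ^ q), 1:]) k)"
  using assms
proof (induction I arbitrary: k rule: finite_induct)
  case empty
  then show ?case using q_ge_2 by (cases k) (auto simp: B_intros power_0_left)
next
  case (insert i I)
  define c where "c k = Polynomial.coeff (\<Prod>i\<in>I. [:- y i, 1:]) k" for k
  define e where "e k = Polynomial.coeff (\<Prod>i\<in>I. [:- (y i ^ q), 1:]) k" for k
  have IH: "c k \<in> B" "cg (c k ^ q) (e k)" for k using insert unfolding c_def e_def by auto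
  have eB: "e k \<in> B" for k using cg_closed[OF cg_sym[OF IH(2)]] IH(1) by (auto intro: B_intros)
  have yB: "y i \<in> B" using insert by simp
  define c' where "c' k = (case k of 0 \<Rightarrow> 0 | Suc l \<Rightarrow> c l)" for k
  define e' where "e' k = (case k of 0 \<Rightarrow> 0 | Suc l \<Rightarrow> e l)" for k
  have c: "Polynomial.coeff (\<Prod>i\<in>insert i I. [:- y i, 1:]) k = c' k - y i * c k"
    using insert(1,2) by (simp add: c_def c'_def coeff_pCons split: nat.split)
  have e: "Polynomial.coeff (\<Prod>i\<in>insert i I. [:- (y i ^ q), 1:]) k = e' k - y i ^ q * e k"
    using insert(1,2) by (simp add: e_def e'_def coeff_pCons split: nat.split)
  have c': "c' k \<in> B" "cg (c' k ^ q) (e' k)"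
    using IH q_ge_2 by (auto simp: c'_def e'_def B_intros power_0_left split: nat.split)
  have "cg ((c' k - y i * c k) ^ q) (c' k ^ q - (y i * c k) ^ q)"
    using c'(1) yB IH(1) by (intro cg_frob_diff B_intros)
  moreover have "cg (c' k ^ q - (y i * c k) ^ q) (e' k - y i ^ q * e k)"
    unfolding power_mult_distrib
    using c'(1) yB IH(1) eB by (intro cg_diff cg_mult c'(2) IH(2) cg_refl B_intros)
  ultimately have "cg ((c' k - y i * c k) ^ q) (e' k - y i ^ q * e k)" by (rule cg_trans)
  moreover have "c' k - y i * c k \<in> B" using c'(1) yB IH(1) by (intro B_intros)
  ultimately show ?case unfolding c e by blast
qed

text \<open>The orbit polynomial G of z under Frobenius has coefficients fixed by Frobenius modulo
  p, so they agree modulo p with elements of \<open>Ok\<close>. A correction divisible by p produces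
  a polynomial H over \<open>Ok\<close> with H(z) = G(z) = 0 and hence H(w) = 0. Then p divides
  G(w), and w lies in the orbit.\<close>

lemma conj_is_frobenius_power:
  assumes w: "w ^ N = 1" and conj: "\<And>P. ac_map P z = 0 \<Longrightarrow> ac_map P w = 0"
  shows "\<exists>i. w = z ^ (q ^ i)"
proof (rule ccontr)
  assume no: "\<nexists>i. w = z ^ (q ^ i)"
  obtain s where s: "s > 0" "z ^ (q ^ s) = z" using frob_order by blast
  define F where "F i = [:- (z ^ (q ^ i)), 1:]" for i
  define G where "G = (\<Prod>i<s. F i)"
  \<comment> \<open>The orbit closes up after s steps, so shifting the index by one only permutes
    the factors.\<close>
  have shift: "(\<Prod>i<s. F (Suc i)) = G"
  proof -
    obtain s' where s': "s = Suc s'" using s(1) gr0_implies_Suc by blast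
    have "F s = F 0" using s(2) by (simp add: F_def)
    then show ?thesis unfolding G_def s' prod.lessThan_Suc_shift[of F] prod.lessThan_Suc[of "\<lambda>i. F (Suc i)"]
      by (simp add: s' mult.commute)
  qed
  have pw: "(z ^ (q ^ i)) ^ q = z ^ (q ^ Suc i)" for i by (simp only: power_Suc2 power_mult)
  have co: "Polynomial.coeff G k \<in> B" "cg (Polynomial.coeff G k ^ q) (Polynomial.coeff G k)" for k
  proof -
    have "Polynomial.coeff (\<Prod>i<s. [:- (z ^ (q ^ i)), 1:]) k \<in> B \<and>
      cg (Polynomial.coeff (\<Prod>i<s. [:- (z ^ (q ^ i)), 1:]) k ^ q)
         (Polynomial.coeff (\<Prod>i<s. [:- ((z ^ (q ^ i)) ^ q), 1:]) k)"
      by (rule coeff_prod_frob) (auto intro: B_intros z_B)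
    then show "Polynomial.coeff G k \<in> B" "cg (Polynomial.coeff G k ^ q) (Polynomial.coeff G k)"
      using shift unfolding pw G_def F_def by simp_all
  qed
  have "\<forall>k. \<exists>a Q. a \<in> Ok \<and> Q \<in> polys_over Ok \<and> Polynomial.coeff G k = a + pp * poly Q z"
  proof
    fix k
    obtain a where a: "a \<in> Ok" "(Polynomial.coeff G k - a) / pp \<in> B"
      using frob_fixed_in_Ok[OF co] unfolding cg_def by blast
    then obtain Q where "Q \<in> polys_over Ok" "(Polynomial.coeff G k - a) / pp = poly Q z" unfolding B_def by blast
    then show "\<exists>a Q. a \<in> Ok \<and> Q \<in> polys_over Ok \<and> Polynomial.coeff G k = a + pp * poly Q z"
      using a(1) by (intro exI[of _ a] exI[of _ Q]) (auto simp: field_simps)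
  qed
  then obtain a Q where aQ: "\<And>k. a k \<in> Ok" "\<And>k. Q k \<in> polys_over Ok"
    "\<And>k. Polynomial.coeff G k = a k + pp * poly (Q k) z" by metis
  note PO = subring_set_polys_over[OF ring_Ok]
  define n where "n = Polynomial.degree G"
  \<comment> \<open>The k-th coefficient of G is \<open>a k\<close> plus p times a polynomial in z.
    Replacing that z by the variable moves the coefficients into \<open>Ok\<close> and keeps the
    value at z.\<close>
  define H where "H = (\<Sum>k\<le>n. [:a k:] * [:0, 1:] ^ k) + [:pp:] * (\<Sum>k\<le>n. Q k * [:0, 1:] ^ k)"
  have cst: "[:c:] \<in> polys_over Ok" if "c \<in> Ok" for c
    using that subring_setD(1)[OF ring_Ok] by (auto simp: polys_over_def coeff_pCons split: nat.split)
  have x: "[:0, 1:] \<in> polys_over Ok"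
    using subring_setD(1,2)[OF ring_Ok] by (auto simp: polys_over_def coeff_pCons split: nat.split)
  have HO: "H \<in> polys_over Ok" unfolding H_def
    by (intro subring_set_intros(3,4,7,9)[OF PO] cst aQ x subring_set_of_nat[OF ring_Ok])
  have Hx: "poly H x = (\<Sum>k\<le>n. a k * x ^ k) + pp * (\<Sum>k\<le>n. poly (Q k) x * x ^ k)" for x
    by (simp add: H_def poly_sum)
  have Gx: "poly G x = (\<Sum>k\<le>n. a k * x ^ k) + pp * (\<Sum>k\<le>n. poly (Q k) z * x ^ k)" for x
    unfolding poly_altdef n_def[symmetric] aQ(3)
    by (simp add: algebra_simps sum.distrib sum_distrib_left)
  have "poly G z = 0" unfolding G_def poly_prod F_def using s(1) by (intro prod_zero) (auto intro!: bexI[of _ 0])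
  then have "poly H z = 0" unfolding Hx Gx .
  then have Hw: "poly H w = 0" using conj polys_over_Ok_lift[OF HO] unfolding ac_map_def by metis
  have wA: "w \<in> A" by (rule unity_A[OF w N_pos])
  have QA: "poly (Q k) x \<in> A" if "x \<in> A" for k x
    using aQ(2)[of k] Ok_sub that by (intro poly_in_subring[OF ring_A]) (auto simp: polys_over_def)
  define S2 where "S2 = (\<Sum>k\<le>n. poly (Q k) w * w ^ k)"
  define S3 where "S3 = (\<Sum>k\<le>n. poly (Q k) z * w ^ k)"
  \<comment> \<open>At w the replacement does matter, but what it changes carries the factor
    p.\<close>
  have "poly G w - poly H w = pp * (S3 - S2)" unfolding Hx Gx S2_def[symmetric] S3_def[symmetric]
    by (simp only: right_diff_distrib add_diff_cancel_left)
  then have "poly G w / pp = S3 - S2" using Hw by simp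
  also have "\<dots> \<in> A" unfolding S2_def S3_def using wA z_A QA
    by (intro subring_setD(4,6)[OF ring_A] subring_set_sum[OF ring_A] subring_set_power[OF ring_A])
  finally have "poly G w / pp \<in> A" .
  moreover have "poly G w = (\<Prod>r\<in>#image_mset (\<lambda>i. z ^ (q ^ i)) (mset_set {..<s}). w - r)"
  proof -
    have "poly G w = (\<Prod>i<s. w - z ^ (q ^ i))" unfolding G_def F_def poly_prod by simp
    then show ?thesis unfolding prod_unfold_prod_mset by (simp add: image_mset.compositionality comp_def)
  qed
  moreover have "(z ^ (q ^ i)) ^ N = 1" for i
    using root by (simp flip: power_mult add: mult.commute[of _ N]) (simp add: power_mult)
  ultimately show False
    using unity_prod_not_divisible[OF w N_pos N_coprime, of "image_mset (\<lambda>i. z ^ (q ^ i)) (mset_set {..<s})"] no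
    by auto
qed

section \<open>Linear independence of the powers of a root of p\<close>

lemma ac_map_scale: "\<exists>M. pp ^ M * ac_map P z \<in> B"
proof (induction P)
  case 0 then show ?case by (simp add: ac_map_def B_intros)
next
  case (pCons a P)
  obtain M1 where M1: "pp ^ M1 * to_ac a \<in> Ok" using range_to_ac_scale by blast
  obtain M2 where M2: "pp ^ M2 * ac_map P z \<in> B" using pCons by blast
  have "pp ^ (M1 + M2) * ac_map (pCons a P) z = pp ^ M2 * (pp ^ M1 * to_ac a) + pp ^ M1 * (z * (pp ^ M2 * ac_map P z))"
    by (simp add: ac_map_def power_add algebra_simps)
  also have "\<dots> \<in> B"
    by (intro B_intros(3) B_intros(4)[OF B_intros(4)[OF z_B M2]] B_intros(4)[OF _ B_intros(4)[OF z_B M2]]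
        B_intros(4)[OF _ Ok_B[OF M1]] subring_set_power[OF ring_B] subring_set_of_nat[OF ring_B])
  finally show ?case by blast
qed

text \<open>Take the least j with b_j not divisible by p, hence a unit. The terms below j have
  coefficients divisible by p = \<pi>^D and the terms above j contain \<pi>^(j+1), so b_j \<pi>^j is
  a multiple of \<pi>^(j+1) in \<open>A\<close>. Then 1/\<pi>, and with it 1/p, would lie in
  \<open>A\<close>.\<close>

lemma Eisenstein_independent_B:
  assumes pi: "\<pi> ^ D = pp" and D: "D > 0" and b: "\<And>j. j < D \<Longrightarrow> b j \<in> B"
    and sum0: "(\<Sum>j<D. b j * \<pi> ^ j) = 0" and "j < D"
  shows "b j / pp \<in> B"
  using \<open>j < D\<close>
proof (induction j rule: less_induct)
  case (less j)
  have piA: "\<pi> \<in> A" using A_root[of \<pi> D] pi D subring_set_of_nat[OF ring_A, of p] by simp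
  have pi0: "\<pi> \<noteq> 0" using pi D by (auto simp: power_0_left)
  show ?case
  proof (rule ccontr)
    assume "b j / pp \<notin> B"
    then obtain u where u: "u \<in> B" "b j * u = 1" using local_B b less.prems by metis
    have "{..<D} = insert j ({..<j} \<union> {j<..<D})" using less.prems by auto
    then have "b j * \<pi> ^ j + (\<Sum>i\<in>{..<j} \<union> {j<..<D}. b i * \<pi> ^ i) = 0"
      using sum0 by simp
    moreover have "(\<Sum>i\<in>{..<j} \<union> {j<..<D}. b i * \<pi> ^ i) = (\<Sum>i<j. b i * \<pi> ^ i) + (\<Sum>i\<in>{j<..<D}. b i * \<pi> ^ i)"
      by (rule sum.union_disjoint) auto
    ultimately have "0 = b j * \<pi> ^ j + ((\<Sum>i<j. b i * \<pi> ^ i) + (\<Sum>i\<in>{j<..<D}. b i * \<pi> ^ i))"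
      by simp
    \<comment> \<open>For i < j one factor p of b_i is spent as \<pi>^D; the exponent i + (D - Suc
      j) is what remains after \<pi>^(j+1) has been split off.\<close>
    moreover have "(\<Sum>i<j. b i * \<pi> ^ i) = \<pi> ^ Suc j * (\<Sum>i<j. b i / pp * \<pi> ^ (i + (D - Suc j)))"
      unfolding sum_distrib_left
    proof (rule sum.cong)
      fix i assume "i \<in> {..<j}"
      have "\<pi> ^ Suc j * \<pi> ^ (i + (D - Suc j)) = \<pi> ^ i * \<pi> ^ D"
        using less.prems unfolding power_add[symmetric] by (intro arg_cong2[where f = "(^)"]) auto
      then have "\<pi> ^ Suc j * (b i / pp * \<pi> ^ (i + (D - Suc j))) = b i / pp * (\<pi> ^ i * \<pi> ^ D)"
        by (metis mult.left_commute)
      then show "b i * \<pi> ^ i = \<pi> ^ Suc j * (b i / pp * \<pi> ^ (i + (D - Suc j)))" by (simp add: pi)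
    qed simp
    moreover have "(\<Sum>i\<in>{j<..<D}. b i * \<pi> ^ i) = \<pi> ^ Suc j * (\<Sum>i\<in>{j<..<D}. b i * \<pi> ^ (i - Suc j))"
      unfolding sum_distrib_left
      by (rule sum.cong) (auto simp: mult.left_commute simp flip: power_add power_Suc)
    ultimately have eq: "b j * \<pi> ^ j = \<pi> ^ Suc j * - ((\<Sum>i<j. b i / pp * \<pi> ^ (i + (D - Suc j))) + (\<Sum>i\<in>{j<..<D}. b i * \<pi> ^ (i - Suc j)))"
      (is "_ = _ * ?S") by (simp add: eq_neg_iff_add_eq_0 algebra_simps del: power_Suc)
    have SA: "?S \<in> A" using less b B_sub piA
      by (intro subring_set_intros(3,4,5,7,9)[OF ring_A]) auto
    have "u * (b j * \<pi> ^ j) = \<pi> ^ Suc j * (u * ?S)" unfolding eq by (simp only: mult.left_commute)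
    moreover have "u * (b j * \<pi> ^ j) = \<pi> ^ j" using u(2) by (metis mult.assoc mult.commute mult_1)
    ultimately have "\<pi> ^ j * 1 = \<pi> ^ j * (\<pi> * (u * ?S))" by (simp only: power_Suc2 mult.assoc mult_1_right)
    then have "1 = \<pi> * (u * ?S)" using pi0 by (simp only: mult_left_cancel[OF power_not_zero[OF pi0]])
    then have "inverse \<pi> = u * ?S" by (intro inverse_unique) (simp only:)
    also have "\<dots> \<in> A" using SA u(1) B_sub by (intro subring_setD(4)[OF ring_A]) auto
    finally have "inverse \<pi> ^ D \<in> A" by (intro subring_set_power[OF ring_A])
    then show False using pinv by (simp add: power_inverse pi)
  qed
qed

text \<open>Descent: after clearing denominators, the relation can be divided by p again and again
  with coefficients still in \<open>B\<close>. They are divisible by all powers of p and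
  vanish.\<close>

lemma Eisenstein_independent:
  assumes pi: "\<pi> ^ D = pp" and D: "D > 0" and sum0: "(\<Sum>j<D. ac_map (P j) z * \<pi> ^ j) = 0"
    and "j < D"
  shows "ac_map (P j) z = 0"
proof -
  define b where "b j = ac_map (P j) z" for j
  have "\<exists>M. \<forall>j<n. pp ^ M * b j \<in> B" for n
  proof (induction n)
    case (Suc n)
    then obtain M where M: "\<forall>j<n. pp ^ M * b j \<in> B" by blast
    obtain M' where M': "pp ^ M' * b n \<in> B" using ac_map_scale unfolding b_def by blast
    have "pp ^ (M + M') * b j \<in> B" if "j < Suc n" for j
    proof (cases "j = n")
      case True
      have "pp ^ M * (pp ^ M' * b n) \<in> B"
        by (rule B_intros(4)[OF subring_set_power[OF ring_B subring_set_of_nat[OF ring_B]] M'])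
      then show ?thesis by (simp add: True power_add mult.assoc)
    next
      case False
      then have "pp ^ M * b j \<in> B" using M that by auto
      then have "pp ^ M' * (pp ^ M * b j) \<in> B"
        by (rule B_intros(4)[OF subring_set_power[OF ring_B subring_set_of_nat[OF ring_B]]])
      then show ?thesis by (simp add: power_add ac_simps)
    qed
    then show ?case by blast
  qed auto
  then obtain M where M: "\<And>j. j < D \<Longrightarrow> pp ^ M * b j \<in> B" by blast
  have "\<forall>j<D. pp ^ M * b j / pp ^ k \<in> B" for k
  proof (induction k)
    case (Suc k)
    have "(\<Sum>j<D. pp ^ M * b j / pp ^ k * \<pi> ^ j) = pp ^ M / pp ^ k * (\<Sum>j<D. b j * \<pi> ^ j)"
      by (simp add: sum_distrib_left mult.assoc)
    then have "(\<Sum>j<D. pp ^ M * b j / pp ^ k * \<pi> ^ j) = 0" using sum0 by (simp add: b_def)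
    then have "pp ^ M * b j / pp ^ k / pp \<in> B" if "j < D" for j
      using Suc that by (intro Eisenstein_independent_B[OF pi D]) auto
    then show ?case by (simp add: mult.commute)
  qed (use M in simp)
  then have "pp ^ M * b j = 0" using \<open>j < D\<close> p_divisible_zero_B by blast
  then show ?thesis by (simp add: b_def)
qed

end

section \<open>The ring of integers of an unramified extension\<close>

lemma ring_of_type_algebra_simps [simp]:
  "carrier ring_of_type_algebra = UNIV"
  "x \<otimes>\<^bsub>ring_of_type_algebra\<^esub> y = x * y"
  "x \<oplus>\<^bsub>ring_of_type_algebra\<^esub> y = x + y"
  "\<zero>\<^bsub>ring_of_type_algebra\<^esub> = 0"
  "\<one>\<^bsub>ring_of_type_algebra\<^esub> = 1"
  by (simp_all add: ring_of_type_algebra_def)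

lemma a_inv_ring_of_type_algebra [simp]:
  "\<ominus>\<^bsub>ring_of_type_algebra\<^esub> x = - (x :: 'a::comm_ring_1)"
proof -
  interpret ring "ring_of_type_algebra :: 'a ring" by (rule ring_from_type_algebra)
  have "\<ominus>\<^bsub>ring_of_type_algebra\<^esub> x + x = 0" using l_neg[of x] by simp
  then show ?thesis by (simp add: eq_neg_iff_add_eq_0)
qed

lemma m_inv_ring_of_type_algebra [simp]:
  assumes "x \<noteq> (0 :: 'a::field)" shows "inv\<^bsub>ring_of_type_algebra\<^esub> x = inverse x"
proof -
  interpret field "ring_of_type_algebra :: 'a ring" by (rule field_from_type_algebra)
  have "x \<in> Units (ring_of_type_algebra :: 'a ring)" using assms field_Units by auto
  then have "inv\<^bsub>ring_of_type_algebra\<^esub> x * x = 1" using Units_l_inv by fastforce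
  then show ?thesis by (metis assms inverse_unique mult.commute)
qed

lemma subfield_type_algebraD:
  assumes "subfield F (ring_of_type_algebra :: 'k::field ring)"
  shows "subring_set F" "x \<in> F \<Longrightarrow> inverse x \<in> F"
proof -
  interpret field "ring_of_type_algebra :: 'k ring" by (rule field_from_type_algebra)
  note sr = subringE[OF subfieldE(1)[OF assms]]
  show S: "subring_set F" unfolding subring_set_def using sr by auto
  show "x \<in> F \<Longrightarrow> inverse x \<in> F"
  proof (cases "x = 0")
    case False
    assume "x \<in> F"
    then show ?thesis using subfield_m_inv(1)[OF assms, of x] False by simp
  qed simp
qed

text \<open>Exponential against linear growth: the analytic half of the proof that the absolute
  value is non-archimedean.\<close>

lemma unbounded_power:
  assumes "a > (1 :: real)" shows "\<exists>n. a ^ n > real n + 1"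
proof -
  have x: "norm (1 / a) < 1" using assms by simp
  have "(\<lambda>n. of_nat n * (1 / a) ^ n + (1 / a) ^ n) \<longlonglongrightarrow> 0 + 0"
    by (intro tendsto_add powser_times_n_limit_0[OF x] LIMSEQ_power_zero[OF x])
  then have "eventually (\<lambda>n. of_nat n * (1 / a) ^ n + (1 / a) ^ n < 1) sequentially"
    by (rule order_tendstoD(2)) simp
  then obtain n where "of_nat n * (1 / a) ^ n + (1 / a) ^ n < 1"
    using eventually_happens'[OF sequentially_bot] by blast
  then show ?thesis using assms by (intro exI[of _ n]) (simp add: field_simps)
qed

lemma padic_abs_of_nat: "Factorial_Ring.prime p \<Longrightarrow> padic_abs p (of_nat n) \<le> 1"
  using quotient_of_int[of "int n"] unfolding padic_abs_def
  by (auto simp: power_int_minus prime_gt_0_nat Suc_leI field_simps)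

locale unram_extension =
  fixes p q m :: nat and F :: "'k::field_char_0 set" and v :: "'k \<Rightarrow> real"
  assumes prime_p: "Factorial_Ring.prime p" and odd_p: "odd p"
    and padic: "padic_field p F v"
    and findim: "ring.finite_dimension (ring_of_type_algebra :: 'k ring) F UNIV"
    and unram: "unramified p F v" and q_eq: "q = p ^ m"
    and fin_res: "finite (carrier (residue_field F v))" and card_res: "card (carrier (residue_field F v)) = q"
begin

lemma subring_F: "subring_set F" and inverse_F: "x \<in> F \<Longrightarrow> inverse x \<in> F"
  using subfield_type_algebraD[of F] padic unfolding padic_field_def by auto

lemma v_nonneg: "x \<in> F \<Longrightarrow> v x \<ge> 0" and v_eq_0: "x \<in> F \<Longrightarrow> v x = 0 \<longleftrightarrow> x = 0"
  and v_mult: "x \<in> F \<Longrightarrow> y \<in> F \<Longrightarrow> v (x * y) = v x * v y"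
  and v_add: "x \<in> F \<Longrightarrow> y \<in> F \<Longrightarrow> v (x + y) \<le> v x + v y"
  and v_rat: "v (of_rat r) = padic_abs p r"
  using padic unfolding padic_field_def by blast+

lemma v_complete:
  assumes "\<And>i. S i \<in> F" "\<And>e. e > 0 \<Longrightarrow> \<exists>N. \<forall>i\<ge>N. \<forall>j\<ge>N. v (S i - S j) < e"
  obtains x where "x \<in> F" "(\<lambda>i. v (S i - x)) \<longlonglongrightarrow> 0"
proof -
  have "\<forall>S :: nat \<Rightarrow> 'k. (\<forall>i. S i \<in> F) \<and> (\<forall>e>0. \<exists>N. \<forall>i\<ge>N. \<forall>j\<ge>N. v (S i - S j) < e)
        \<longrightarrow> (\<exists>x\<in>F. (\<lambda>i. v (S i - x)) \<longlonglongrightarrow> 0)"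
    using padic unfolding padic_field_def by blast
  from this[rule_format, of S] show ?thesis using assms that by blast
qed

lemmas F_intros = subring_set_intros[OF subring_F]

lemma v_0: "v 0 = 0" using v_eq_0[of 0] F_intros by simp

lemma v_1: "v 1 = 1"
proof -
  have "v 1 * v 1 = v 1 * 1" using v_mult[of 1 1] F_intros by simp
  then show ?thesis using v_eq_0[of 1] F_intros by simp
qed

lemma v_power: "x \<in> F \<Longrightarrow> v (x ^ n) = v x ^ n"
  by (induction n) (auto simp: v_1 v_mult F_intros)

lemma v_minus: "x \<in> F \<Longrightarrow> v (- x) = v x"
proof -
  assume x: "x \<in> F"
  have m1: "- 1 \<in> F" using F_intros by simp
  have "v (- 1) ^ 2 = 1" using v_power[OF m1, of 2] v_1 by simp
  then have "v (- 1) = 1" using v_nonneg[OF m1] by (simp add: power2_eq_1_iff)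
  then show ?thesis using v_mult[OF m1 x] by simp
qed

lemma v_of_nat: "v (of_nat n) \<le> 1"
  using v_rat[of "of_nat n"] padic_abs_of_nat[OF prime_p, of n] by simp

lemma v_p: "v (of_nat p) = 1 / real p"
proof -
  have "multiplicity (int p) (int p) = 1" using prime_p by (intro multiplicity_self) (auto simp: prime_gt_1_nat)
  then have "padic_abs p (of_nat p) = 1 / real p"
    unfolding padic_abs_def using prime_gt_0_nat[OF prime_p] quotient_of_int[of "int p"]
    by (simp add: power_int_minus field_simps)
  then show ?thesis using v_rat[of "of_nat p"] by simp
qed

text \<open>By the binomial theorem \<open>v ((x + y) ^ n)\<close> grows at most linearly in \<open>n\<close>.\<close>

lemma v_add_le_1:
  assumes x: "x \<in> F" "v x \<le> 1" and y: "y \<in> F" "v y \<le> 1" shows "v (x + y) \<le> 1"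
proof (rule ccontr)
  assume "\<not> ?thesis"
  then obtain n where n: "v (x + y) ^ n > real n + 1" using unbounded_power[of "v (x + y)"] by auto
  have sum_le: "v (\<Sum>k\<in>I. f k) \<le> (\<Sum>k\<in>I. v (f k))" if "\<And>k. k \<in> I \<Longrightarrow> f k \<in> F" "finite I" for f :: "nat \<Rightarrow> 'k" and I
    using that(2,1)
  proof (induction I rule: finite_induct)
    case (insert i I)
    then have "v (f i + sum f I) \<le> v (f i) + v (sum f I)" by (intro v_add F_intros) auto
    with insert show ?case by fastforce
  qed (simp add: v_0)
  have "v (x + y) ^ n = v (\<Sum>k\<le>n. of_nat (n choose k) * x ^ k * y ^ (n - k))"
    using v_power[of "x + y" n] x y by (simp add: F_intros binomial_ring)
  also have "\<dots> \<le> (\<Sum>k\<le>n. v (of_nat (n choose k) * x ^ k * y ^ (n - k)))"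
    using x y by (intro sum_le F_intros) auto
  also have "\<dots> \<le> (\<Sum>k\<le>n. 1)"
  proof (rule sum_mono)
    fix k
    have "v (of_nat (n choose k) * x ^ k * y ^ (n - k)) = v (of_nat (n choose k)) * v x ^ k * v y ^ (n - k)"
      using x y by (simp add: v_mult v_power F_intros)
    also have "\<dots> \<le> 1"
      using x y v_nonneg v_of_nat
      by (intro mult_le_one power_le_one mult_nonneg_nonneg zero_le_power) (auto simp: F_intros)
    finally show "v (of_nat (n choose k) * x ^ k * y ^ (n - k)) \<le> 1" .
  qed
  finally show False using n by simp
qed

definition Zp :: "'k alg_closure set" where "Zp = to_ac ` {x \<in> F. v x \<le> 1}"

text \<open>The integral closure in the whole algebraic closure, not just in K. It stands in for the
  valuation ring of an extended absolute value.\<close>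

definition A :: "'k alg_closure set" where "A = {x. integral_over Zp x}"

definition Ok :: "'k alg_closure set" where "Ok = A \<inter> range to_ac"

lemma subring_Zp: "subring_set Zp"
proof -
  have "x * y \<in> {x \<in> F. v x \<le> 1}" if "x \<in> {x \<in> F. v x \<le> 1}" "y \<in> {x \<in> F. v x \<le> 1}" for x y
    using that v_nonneg by (auto simp: v_mult F_intros intro: mult_le_one)
  moreover have "x + y \<in> {x \<in> F. v x \<le> 1}" if "x \<in> {x \<in> F. v x \<le> 1}" "y \<in> {x \<in> F. v x \<le> 1}" for x y
    using that by (auto simp: v_add_le_1 F_intros)
  moreover have "- x \<in> {x \<in> F. v x \<le> 1}" if "x \<in> {x \<in> F. v x \<le> 1}" for x
    using that by (auto simp: v_minus F_intros)
  moreover have "0 \<in> {x \<in> F. v x \<le> 1}" "1 \<in> {x \<in> F. v x \<le> 1}"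
    using v_0 v_1 by (auto simp: F_intros)
  ultimately show ?thesis unfolding subring_set_def Zp_def
    by (auto simp flip: to_ac_add to_ac_mult to_ac_minus)
qed

lemma subring_A: "subring_set A"
  unfolding A_def by (rule subring_set_integral_closure[OF subring_Zp])

lemma Zp_A: "Zp \<subseteq> A"
  unfolding A_def using integral_over_base[OF subring_Zp] by blast

lemma Zp_Ok: "Zp \<subseteq> Ok"
  unfolding Ok_def using Zp_A by (auto simp: Zp_def)

lemma integral_over_A: "integral_over A x \<Longrightarrow> x \<in> A"
  unfolding A_def using integral_over_trans[OF subring_Zp] by blast

lemma subring_Ok: "subring_set Ok"
  unfolding Ok_def subring_set_def using subring_setD[OF subring_A]
  by (auto simp flip: to_ac_add to_ac_mult to_ac_minus to_ac_0 to_ac_1 simp del: to_ac_eq_0_iff)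

lemma A_root:
  assumes "x ^ n \<in> A" "n > 0" shows "x \<in> A"
proof (rule integral_over_A)
  define P where "P = Polynomial.monom 1 n - [:x ^ n:]"
  have c: "Polynomial.coeff P i = (if i = n then 1 else if i = 0 then - (x ^ n) else 0)" for i
    using assms(2) by (auto simp: P_def coeff_pCons split: nat.split)
  then have deg: "Polynomial.degree P = n"
    by (intro antisym degree_le le_degree) auto
  have "P \<in> polys_over A" unfolding polys_over_def using assms(1) subring_setD(1,2,5)[OF subring_A] by (simp add: c)
  moreover have "Polynomial.lead_coeff P = 1" unfolding deg c by simp
  moreover have "poly P x = 0" by (simp add: P_def poly_monom)
  ultimately show "integral_over A x" unfolding integral_over_def by blast
qed

text \<open>Integrality is tested by polynomials over K on one side and over the algebraic closure
  on the other. A polynomial with coefficients in \<open>Zp\<close> descends along the embedding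
  coefficient by coefficient.\<close>

lemma carrier_int_ring: "carrier (int_ring F v) = {x. to_ac x \<in> A}"
proof -
  have "(\<exists>P :: 'k poly. Polynomial.lead_coeff P = 1 \<and> (\<forall>i. Polynomial.coeff P i \<in> F \<and> v (Polynomial.coeff P i) \<le> 1) \<and> poly P x = 0)
    \<longleftrightarrow> integral_over Zp (to_ac x)" for x
  proof
    assume "\<exists>P :: 'k poly. Polynomial.lead_coeff P = 1 \<and> (\<forall>i. Polynomial.coeff P i \<in> F \<and> v (Polynomial.coeff P i) \<le> 1) \<and> poly P x = 0"
    then obtain P :: "'k poly" where P: "Polynomial.lead_coeff P = 1"
      "\<forall>i. Polynomial.coeff P i \<in> F \<and> v (Polynomial.coeff P i) \<le> 1" "poly P x = 0" by blast
    have "Polynomial.lead_coeff (map_poly to_ac P) = 1"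
      using P(1) by (subst degree_map_poly) (auto simp: coeff_map_poly)
    moreover have "map_poly to_ac P \<in> polys_over Zp"
      using P(2) by (auto simp: polys_over_def coeff_map_poly Zp_def)
    moreover have "poly (map_poly to_ac Q) (to_ac x) = to_ac (poly Q x)" for Q
      by (induction Q) auto
    ultimately show "integral_over Zp (to_ac x)" using P(3) unfolding integral_over_def by (metis to_ac_0)
  next
    assume "integral_over Zp (to_ac x)"
    then obtain Q where Q: "Polynomial.lead_coeff Q = 1" "Q \<in> polys_over Zp" "poly Q (to_ac x) = 0"
      unfolding integral_over_def by blast
    define P where "P = map_poly of_ac Q"
    have c: "to_ac (Polynomial.coeff P i) = Polynomial.coeff Q i" "Polynomial.coeff P i \<in> F"
      "v (Polynomial.coeff P i) \<le> 1" for i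
      using Q(2) unfolding polys_over_def Zp_def P_def by (auto simp: coeff_map_poly dest!: spec[of _ i])
    have QP: "Q = map_poly to_ac P" by (rule poly_eqI) (simp add: coeff_map_poly c)
    have deg: "Polynomial.degree Q = Polynomial.degree P" unfolding QP by (rule degree_map_poly) auto
    have "to_ac (Polynomial.lead_coeff P) = 1" using Q(1) by (simp add: c(1) deg)
    then have "Polynomial.lead_coeff P = 1" by (simp only: to_ac_eq_1_iff)
    moreover have "poly (map_poly to_ac Q) (to_ac x) = to_ac (poly Q x)" for Q
      by (induction Q) auto
    ultimately show "\<exists>P :: 'k poly. Polynomial.lead_coeff P = 1 \<and> (\<forall>i. Polynomial.coeff P i \<in> F \<and> v (Polynomial.coeff P i) \<le> 1) \<and> poly P x = 0"
      using Q(3) c(2,3) QP by (intro exI[of _ P]) auto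
  qed
  then show ?thesis unfolding int_ring_def A_def by simp
qed

lemma int_ring_simps [simp]:
  "x \<otimes>\<^bsub>int_ring F v\<^esub> y = x * y" "x \<oplus>\<^bsub>int_ring F v\<^esub> y = x + y"
  "\<zero>\<^bsub>int_ring F v\<^esub> = 0" "\<one>\<^bsub>int_ring F v\<^esub> = 1"
  by (simp_all add: int_ring_def ring_of_type_algebra_def)

lemma cring_int_ring: "cring (int_ring F v)"
proof -
  note S = subring_setD[OF subring_A]
  have "\<exists>y. to_ac y \<in> A \<and> y + x = 0 \<and> x + y = 0" if "to_ac x \<in> A" for x
    using S(5)[OF that] by (intro exI[of _ "- x"]) simp
  then show ?thesis
    by unfold_locales (auto simp: carrier_int_ring Units_def S algebra_simps)
qed

lemma of_nat_p_nz [simp]: "of_nat p \<noteq> (0 :: 'a::field_char_0)" using prime_p prime_gt_0_nat by auto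

text \<open>The point where unramifiedness enters: residue classes are classes modulo p.\<close>

lemma max_ideal_eq: "int_max_ideal F v = {x * of_nat p | x. to_ac x \<in> A}"
  using unram unfolding unramified_def cgenideal_def by (simp add: carrier_int_ring)

lemma of_nat_p_in_max_ideal: "of_nat p \<in> int_max_ideal F v"
  unfolding max_ideal_eq using subring_setD(2)[OF subring_A] by (intro CollectI exI[of _ 1]) simp

text \<open>The inverse of p lies in K, so if it were integral, p would be a unit of the ring of
  integers; but p belongs to the ideal of nonunits.\<close>

lemma pinv: "inverse (of_nat p) \<notin> A"
proof
  assume "inverse (of_nat p) \<in> A"
  then have "to_ac (inverse (of_nat p)) \<in> A" by simp
  then have "of_nat p \<in> Units (int_ring F v)" unfolding Units_def carrier_int_ring
    using subring_set_of_nat[OF subring_A, of p]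
    using prime_gt_0_nat[OF prime_p] by (auto intro!: exI[of _ "inverse (of_nat p)"])
  then show False using of_nat_p_in_max_ideal unfolding int_max_ideal_def by blast
qed

text \<open>Tails of the partial sums are p^k times an element of absolute value at most 1, so the
  partial sums are Cauchy. The limit inherits the bound, and dividing its k-th remainder by p^k
  leaves absolute value at most 1.\<close>

lemma pcomplete_Zp: "pcomplete p Zp"
  unfolding pcomplete_def
proof (intro allI impI)
  fix y :: "nat \<Rightarrow> 'k alg_closure" assume "\<forall>i. y i \<in> Zp"
  then have "\<forall>i. \<exists>x. x \<in> F \<and> v x \<le> 1 \<and> y i = to_ac x" unfolding Zp_def by blast
  then obtain x where x: "\<And>i. x i \<in> F" "\<And>i. v (x i) \<le> 1" "\<And>i. y i = to_ac (x i)" by metis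
  define S where "S k = (\<Sum>i<k. of_nat p ^ i * x i)" for k
  have SF: "S k \<in> F" for k unfolding S_def using x by (intro F_intros)
  have vp: "v (of_nat p ^ k) = (1 / real p) ^ k" for k by (simp add: v_power F_intros v_p)
  have p1: "real p > 1" using prime_gt_1_nat[OF prime_p] by simp
  have tail: "v (S (k + i) - S k) \<le> (1 / real p) ^ k" for k i
  proof -
    \<comment> \<open>The ultrametric bound \<open>v_add_le_1\<close> keeps the absolute value of c
      at most 1 throughout the induction; the triangle inequality alone would not preserve this
      constant.\<close>
    have "\<exists>c\<in>F. v c \<le> 1 \<and> S (k + i) - S k = of_nat p ^ k * c"
    proof (induction i)
      case 0 then show ?case using v_0 by (intro bexI[of _ 0]) (auto simp: F_intros)
    next
      case (Suc i)
      then obtain c where c: "c \<in> F" "v c \<le> 1" "S (k + i) - S k = of_nat p ^ k * c" by blast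
      have "v (of_nat p ^ i * x (k + i)) \<le> 1"
        using x p1 by (simp add: v_mult F_intros vp mult_le_one v_nonneg power_le_one)
      then have "v (c + of_nat p ^ i * x (k + i)) \<le> 1" using c x by (intro v_add_le_1 F_intros) auto
      moreover have "S (k + Suc i) - S k = of_nat p ^ k * (c + of_nat p ^ i * x (k + i))"
        using c(3) by (simp add: S_def algebra_simps power_add)
      moreover have "c + of_nat p ^ i * x (k + i) \<in> F" using c x by (intro F_intros)
      ultimately show ?case by blast
    qed
    then obtain c where c: "c \<in> F" "v c \<le> 1" "S (k + i) - S k = of_nat p ^ k * c" by blast
    then have "v (S (k + i) - S k) = (1 / real p) ^ k * v c" by (simp add: v_mult F_intros vp)
    also have "\<dots> \<le> (1 / real p) ^ k * 1" using c p1 by (intro mult_left_mono) auto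
    finally show ?thesis by simp
  qed
  have "\<exists>N. \<forall>i\<ge>N. \<forall>j\<ge>N. v (S i - S j) < e" if e: "e > 0" for e
  proof -
    obtain N where N: "(1 / real p) ^ N < e" using real_arch_pow_inv[of e "1 / real p"] e p1 by auto
    have *: "v (S (j + d) - S j) < e" if "j \<ge> N" for j d
    proof -
      have "(1 / real p) ^ j \<le> (1 / real p) ^ N" using p1 that by (intro power_decreasing) auto
      then show ?thesis using tail[of j d] N by linarith
    qed
    have "v (S i - S j) < e" if "i \<ge> N" "j \<ge> N" for i j
    proof (cases "i \<ge> j")
      case True then show ?thesis using *[OF that(2), of "i - j"] by simp
    next
      case False
      then have "v (S j - S i) < e" using *[OF that(1), of "j - i"] by simp
      moreover have "v (S i - S j) = v (- (S j - S i))" by simp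
      moreover have "\<dots> = v (S j - S i)" by (intro v_minus F_intros SF)
      ultimately show ?thesis by (simp only:)
    qed
    then show ?thesis by blast
  qed
  from v_complete[OF SF this] obtain a where a: "a \<in> F" "(\<lambda>i. v (S i - a)) \<longlonglongrightarrow> 0" by blast
  have close: "v (a - S k) \<le> (1 / real p) ^ k" for k
  proof (rule field_le_epsilon)
    fix e :: real assume "e > 0"
    then obtain N where N: "\<forall>i\<ge>N. v (S i - a) < e"
      using order_tendstoD(2)[OF a(2)] by (auto simp: eventually_sequentially)
    have "a - S k = - (S (k + N) - a) + (S (k + N) - S k)" by simp
    also have "v \<dots> \<le> v (- (S (k + N) - a)) + v (S (k + N) - S k)"
      using a SF by (intro v_add F_intros)
    also have "v (- (S (k + N) - a)) = v (S (k + N) - a)" using a SF by (intro v_minus F_intros)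
    also have "\<dots> < e" using N by simp
    finally show "v (a - S k) \<le> (1 / real p) ^ k + e" using tail[of k N] by linarith
  qed
  have "(to_ac a - (\<Sum>i<k. of_nat p ^ i * y i)) / of_nat p ^ k \<in> Zp" for k
  proof -
    define b where "b = (a - S k) * inverse (of_nat p ^ k)"
    have bF: "b \<in> F" unfolding b_def using a SF by (intro F_intros inverse_F)
    have ab: "a - S k = of_nat p ^ k * b" using prime_gt_0_nat[OF prime_p] by (simp add: b_def)
    have "(1 / real p) ^ k * v b \<le> (1 / real p) ^ k * 1"
      using close[of k] bF unfolding ab by (simp add: v_mult F_intros vp)
    then have "v b \<le> 1" using p1 by (subst (asm) mult_le_cancel_left_pos) auto
    moreover have "(to_ac a - (\<Sum>i<k. of_nat p ^ i * y i)) / of_nat p ^ k = to_ac b"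
      by (simp add: b_def x(3) S_def to_ac_sum divide_inverse)
    ultimately show ?thesis using bF by (auto simp: Zp_def)
  qed
  moreover have "to_ac a \<in> Zp" using close[of 0] a by (auto simp: Zp_def S_def)
  ultimately show "\<exists>a\<in>Zp. \<forall>k. (a - (\<Sum>i<k. of_nat p ^ i * y i)) / of_nat p ^ k \<in> Zp" by blast
qed

text \<open>If c clears the denominators of P and n is the degree, then c^n P(X / c) is monic with
  coefficients in \<open>S\<close> and has the root c x.\<close>

lemma integral_scale:
  assumes S: "subring_set S" and P: "Polynomial.lead_coeff P = 1" "poly P x = 0"
    and coeffs: "\<And>i. \<exists>N. of_nat p ^ N * Polynomial.coeff P i \<in> S"
  shows "\<exists>N. integral_over S (of_nat p ^ N * (x :: 'k alg_closure))"
proof -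
  define n where "n = Polynomial.degree P"
  have "\<exists>N. \<forall>i<k. of_nat p ^ N * Polynomial.coeff P i \<in> S" for k
  proof (induction k)
    case (Suc k)
    then obtain M where M: "\<forall>i<k. of_nat p ^ M * Polynomial.coeff P i \<in> S" by blast
    obtain M' where M': "of_nat p ^ M' * Polynomial.coeff P k \<in> S" using coeffs by blast
    have pw: "of_nat p ^ l \<in> S" for l by (intro subring_set_power subring_set_of_nat S)
    have "of_nat p ^ (M + M') * Polynomial.coeff P i \<in> S" if "i < Suc k" for i
    proof (cases "i = k")
      case True
      have "of_nat p ^ M * (of_nat p ^ M' * Polynomial.coeff P k) \<in> S" by (rule subring_setD(4)[OF S pw M'])
      then show ?thesis by (simp add: True power_add mult.assoc)
    next
      case False
      then have "of_nat p ^ M * Polynomial.coeff P i \<in> S" using M that by auto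
      then have "of_nat p ^ M' * (of_nat p ^ M * Polynomial.coeff P i) \<in> S"
        by (rule subring_setD(4)[OF S pw])
      then show ?thesis by (simp add: power_add ac_simps)
    qed
    then show ?case by blast
  qed simp
  then obtain N where N: "\<And>i. i < n \<Longrightarrow> of_nat p ^ N * Polynomial.coeff P i \<in> S" by blast
  define c :: "'k alg_closure" where "c = of_nat p ^ N"
  have cS: "c \<in> S" unfolding c_def by (intro subring_set_power subring_set_of_nat S)
  define Q where "Q = (\<Sum>i\<le>n. Polynomial.monom (c ^ (n - i) * Polynomial.coeff P i) i)"
  have coQ: "Polynomial.coeff Q i = (if i \<le> n then c ^ (n - i) * Polynomial.coeff P i else 0)" for i
    by (auto simp: Q_def coeff_sum sum.delta)
  have degQ: "Polynomial.degree Q = n"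
    using P(1) by (intro antisym degree_le le_degree) (auto simp: coQ n_def)
  have "Polynomial.coeff Q i \<in> S" for i
  proof -
    consider "i < n" | "i = n" | "i > n" by linarith
    then show ?thesis
    proof cases
      case 1
      then have "n - i = Suc (n - Suc i)" by simp
      then have "c ^ (n - i) * Polynomial.coeff P i = c ^ (n - Suc i) * (c * Polynomial.coeff P i)"
        by (simp add: ac_simps)
      also have "\<dots> \<in> S"
        by (rule subring_setD(4)[OF S subring_set_power[OF S cS] N[OF 1, folded c_def]])
      finally show ?thesis using 1 by (simp add: coQ)
    next
      case 2 then show ?thesis using P(1) subring_setD(2)[OF S] by (simp add: coQ n_def)
    next
      case 3 then show ?thesis using subring_setD(1)[OF S] by (simp add: coQ)
    qed
  qed
  moreover have "Polynomial.lead_coeff Q = 1" using P(1) by (simp add: degQ coQ n_def)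
  moreover have "poly Q (c * x) = 0"
  proof -
    have "poly Q (c * x) = (\<Sum>i\<le>n. c ^ n * (Polynomial.coeff P i * x ^ i))"
      unfolding Q_def poly_sum poly_monom
    proof (rule sum.cong)
      fix i assume "i \<in> {..n}"
      then have "c ^ n = c ^ (n - i) * c ^ i" by (simp flip: power_add)
      then show "c ^ (n - i) * Polynomial.coeff P i * (c * x) ^ i = c ^ n * (Polynomial.coeff P i * x ^ i)"
        by (simp add: power_mult_distrib ac_simps)
    qed simp
    also have "\<dots> = c ^ n * poly P x" by (simp add: poly_altdef n_def sum_distrib_left)
    finally show ?thesis using P(2) by simp
  qed
  ultimately have "integral_over S (c * x)" unfolding integral_over_def polys_over_def by blast
  then show ?thesis unfolding c_def by blast
qed

lemma F_scale: "c \<in> F \<Longrightarrow> \<exists>N. of_nat p ^ N * to_ac c \<in> Zp"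
proof -
  assume c: "c \<in> F"
  have p1: "real p > 1" using prime_gt_1_nat[OF prime_p] by simp
  obtain N where "v c < real p ^ N" using real_arch_pow[OF p1] by blast
  then have "v (of_nat p ^ N * c) \<le> 1" using c p1
    by (simp add: v_mult v_power F_intros v_p power_divide field_simps)
  then have "of_nat p ^ N * c \<in> {x \<in> F. v x \<le> 1}" using c by (simp add: F_intros)
  then have "to_ac (of_nat p ^ N * c) \<in> Zp" unfolding Zp_def by (rule imageI)
  then show ?thesis by auto
qed

section \<open>Algebraicity of K and denominators that are powers of p\<close>

lemma eval_eq_poly: "ring.eval ring_of_type_algebra xs x = poly (Poly (rev xs)) (x :: 'k)"
proof -
  interpret field "ring_of_type_algebra :: 'k ring" by (rule field_from_type_algebra)
  have pow: "x [^]\<^bsub>ring_of_type_algebra\<^esub> n = x ^ n" for n :: nat by (induction n) (auto simp: mult.commute)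
  show ?thesis by (induction xs) (auto simp: Poly_append poly_monom pow)
qed

lemma algebraic_over_F:
  obtains P :: "'k poly" where "Polynomial.lead_coeff P = 1" "P \<in> polys_over F" "poly P x = 0"
proof -
  interpret field "ring_of_type_algebra :: 'k ring" by (rule field_from_type_algebra)
  have sf: "subfield F (ring_of_type_algebra :: 'k ring)" using padic by (simp add: padic_field_def)
  have "subring UNIV (ring_of_type_algebra :: 'k ring)" using carrier_is_subring by simp
  then have "(algebraic over F) x" using finite_dimension_imp_algebraic[OF sf _ findim] by blast
  then obtain xs where xs: "xs \<in> carrier (F[X]\<^bsub>ring_of_type_algebra\<^esub>)" "xs \<noteq> []" "eval xs x = 0"
    using algebraicE[OF subfieldE(1)[OF sf], of x] by auto
  define P where "P = Poly (rev xs)"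
  have mem: "set xs \<subseteq> F" "hd xs \<noteq> 0" using xs by (auto simp: univ_poly_def polynomial_def)
  have co: "Polynomial.coeff P i \<in> F" for i
  proof (cases "i < length xs")
    case True
    then have "rev xs ! i \<in> set xs" by (metis length_rev nth_mem set_rev)
    then show ?thesis using True mem by (auto simp: P_def nth_default_def)
  qed (simp add: P_def nth_default_def F_intros)
  have "last (rev xs) \<noteq> 0" using mem xs(2) by (simp add: last_rev)
  then have "P \<noteq> 0" unfolding P_def using xs(2) by (metis Nil_is_rev_conv Poly_eq_0 last_replicate replicate_empty)
  define c where "c = inverse (Polynomial.lead_coeff P)"
  have cF: "c \<in> F" unfolding c_def by (intro inverse_F co)
  show ?thesis
  proof (rule that[of "Polynomial.smult c P"])
    show "Polynomial.lead_coeff (Polynomial.smult c P) = 1" using \<open>P \<noteq> 0\<close> by (simp add: c_def)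
    show "Polynomial.smult c P \<in> polys_over F" using co cF by (simp add: polys_over_def F_intros)
    show "poly (Polynomial.smult c P) x = 0" using xs(3) by (simp add: eval_eq_poly P_def)
  qed
qed

text \<open>Denominators of 1/z are cleared in two stages: for elements of K, whose equations have
  coefficients in the p-adic field, and then for elements of the algebraic closure, whose equations
  have coefficients in K.\<close>

lemma absorb: "z \<noteq> 0 \<Longrightarrow> \<exists>N. of_nat p ^ N / z \<in> A"
proof -
  have K_scale: "\<exists>N. of_nat p ^ N * to_ac c \<in> A" for c
  proof -
    obtain P where P: "Polynomial.lead_coeff P = 1" "P \<in> polys_over F" "poly P c = 0"
      using algebraic_over_F by blast
    have "\<exists>N. integral_over Zp (of_nat p ^ N * to_ac c)"
    proof (rule integral_scale[OF subring_Zp])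
      show "Polynomial.lead_coeff (map_poly to_ac P) = 1"
        using P(1) by (subst degree_map_poly) (auto simp: coeff_map_poly)
      have "poly (map_poly to_ac Q) (to_ac x) = to_ac (poly Q x)" for Q and x :: 'k
        by (induction Q) auto
      then show "poly (map_poly to_ac P) (to_ac c) = 0" using P(3) by simp
      show "\<exists>N. of_nat p ^ N * Polynomial.coeff (map_poly to_ac P) i \<in> Zp" for i
        using F_scale P(2) by (simp add: coeff_map_poly polys_over_def)
    qed
    then show ?thesis by (simp add: A_def)
  qed
  obtain g :: "'k poly" where g: "Polynomial.lead_coeff g = 1" "ac_map g (inverse z) = 0"
    using minimal_polynomial by blast
  have "\<exists>N. integral_over A (of_nat p ^ N * inverse z)"
  proof (rule integral_scale[OF subring_A])
    show "Polynomial.lead_coeff (map_poly to_ac g) = 1"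
      using g(1) by (subst degree_map_poly) (auto simp: coeff_map_poly)
    show "poly (map_poly to_ac g) (inverse z) = 0" using g(2) by (simp add: ac_map_def)
    show "\<exists>N. of_nat p ^ N * Polynomial.coeff (map_poly to_ac g) i \<in> A" for i
      using K_scale by (simp add: coeff_map_poly)
  qed
  then show ?thesis using integral_over_A by (auto simp: divide_inverse)
qed

section \<open>The residue field and its Frobenius\<close>

lemma maximal_max_ideal: "maximalideal (int_max_ideal F v) (int_ring F v)"
proof -
  interpret O: cring "int_ring F v" by (rule cring_int_ring)
  have "of_nat p \<in> carrier (int_ring F v)"
    using subring_set_of_nat[OF subring_A] by (simp add: carrier_int_ring)
  then have ideal: "ideal (int_max_ideal F v) (int_ring F v)"
    using O.cgenideal_ideal unram unfolding unramified_def by simp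
  show ?thesis
  proof (rule maximalidealI[OF ideal])
    show "carrier (int_ring F v) \<noteq> int_max_ideal F v"
      using O.Units_one_closed unfolding int_max_ideal_def by blast
    fix J assume J: "ideal J (int_ring F v)" "int_max_ideal F v \<subseteq> J" "J \<subseteq> carrier (int_ring F v)"
    show "J = int_max_ideal F v \<or> J = carrier (int_ring F v)"
    proof (rule disjCI)
      assume notcarr: "J \<noteq> carrier (int_ring F v)"
      have "u \<notin> Units (int_ring F v)" if u: "u \<in> J" for u
      proof
        assume unit: "u \<in> Units (int_ring F v)"
        have "u \<otimes>\<^bsub>int_ring F v\<^esub> inv\<^bsub>int_ring F v\<^esub> u \<in> J"
          using ideal.I_r_closed[OF J(1) u] unit by blast
        then have "\<one>\<^bsub>int_ring F v\<^esub> \<in> J" using O.Units_r_inv[OF unit] by simp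
        then show False using notcarr ideal.one_imp_carrier[OF J(1)] by simp
      qed
      then show "J = int_max_ideal F v" using J unfolding int_max_ideal_def by blast
    qed
  qed
qed

lemma ideal_max_ideal: "ideal (int_max_ideal F v) (int_ring F v)"
  using maximal_max_ideal by (rule maximalideal.axioms)

lemma int_ring_minus: "to_ac x \<in> A \<Longrightarrow> to_ac y \<in> A \<Longrightarrow> x \<ominus>\<^bsub>int_ring F v\<^esub> y = x - y"
proof -
  interpret O: cring "int_ring F v" by (rule cring_int_ring)
  assume xy: "to_ac x \<in> A" "to_ac y \<in> A"
  have "\<ominus>\<^bsub>int_ring F v\<^esub> y = - y"
    using xy subring_setD(5)[OF subring_A xy(2)] by (intro O.minus_equality) (simp_all add: carrier_int_ring)
  then show ?thesis by (simp add: a_minus_def)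
qed

lemma coset_eq_iff:
  assumes "to_ac x \<in> A" "to_ac y \<in> A"
  shows "int_max_ideal F v +>\<^bsub>int_ring F v\<^esub> x = int_max_ideal F v +>\<^bsub>int_ring F v\<^esub> y \<longleftrightarrow> (to_ac x - to_ac y) / of_nat p \<in> A"
proof -
  interpret O: cring "int_ring F v" by (rule cring_int_ring)
  have "int_max_ideal F v +>\<^bsub>int_ring F v\<^esub> x = int_max_ideal F v +>\<^bsub>int_ring F v\<^esub> y \<longleftrightarrow> x - y \<in> int_max_ideal F v"
    using O.quotient_eq_iff_same_a_r_cos[OF ideal_max_ideal, of x y] assms
    by (auto simp: carrier_int_ring int_ring_minus)
  also have "\<dots> \<longleftrightarrow> to_ac ((x - y) / of_nat p) \<in> A"
  proof
    assume "x - y \<in> int_max_ideal F v"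
    then obtain w where "x - y = w * of_nat p" "to_ac w \<in> A" unfolding max_ideal_eq by blast
    moreover from this(1) have "(x - y) / of_nat p = w" by (simp only: nonzero_mult_div_cancel_right[OF of_nat_p_nz])
    ultimately show "to_ac ((x - y) / of_nat p) \<in> A" by (simp only:)
  next
    assume "to_ac ((x - y) / of_nat p) \<in> A"
    moreover have "x - y = (x - y) / of_nat p * of_nat p"
      by (metis nonzero_eq_divide_eq of_nat_p_nz)
    ultimately show "x - y \<in> int_max_ideal F v" unfolding max_ideal_eq by blast
  qed
  finally show ?thesis by simp
qed

lemma residue_field_carrier: "carrier (residue_field F v) = (\<lambda>x. int_max_ideal F v +>\<^bsub>int_ring F v\<^esub> x) ` {x. to_ac x \<in> A}"
  unfolding residue_field_def FactRing_def A_RCOSETS_def' by (auto simp: carrier_int_ring)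

text \<open>Lagrange's theorem in the multiplicative group of the residue field, which has q - 1
  elements; the zero class is treated apart.\<close>

lemma frob_residue:
  assumes x: "to_ac x \<in> A" shows "(to_ac x ^ q - to_ac x) / of_nat p \<in> A"
proof -
  let ?K = "residue_field F v" and ?h = "\<lambda>x. int_max_ideal F v +>\<^bsub>int_ring F v\<^esub> x"
  interpret K: field ?K unfolding residue_field_def
    by (rule maximalideal.quotient_is_field[OF maximal_max_ideal cring_int_ring])
  have hom: "?h \<in> Ring.ring_hom (int_ring F v) ?K"
    unfolding residue_field_def by (rule ideal.rcos_ring_hom[OF ideal_max_ideal])
  have hc: "?h x \<in> carrier ?K" using x by (simp add: residue_field_carrier)
  have pow: "?h (x ^ n) = ?h x [^]\<^bsub>?K\<^esub> n" for n :: nat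
  proof (induction n)
    case 0 then show ?case using ring_hom_one[OF hom] by simp
  next
    case (Suc n)
    have "to_ac (x ^ n) \<in> A" using subring_set_power[OF subring_A x] by simp
    then have "?h (x ^ n \<otimes>\<^bsub>int_ring F v\<^esub> x) = ?h (x ^ n) \<otimes>\<^bsub>?K\<^esub> ?h x"
      using x by (intro ring_hom_mult[OF hom]) (simp_all add: carrier_int_ring)
    then show ?case using Suc by (simp add: mult.commute)
  qed
  have q0: "q > 0" using card_res fin_res K.carrier_not_empty by (metis card_gt_0_iff)
  have "?h x [^]\<^bsub>?K\<^esub> q = ?h x"
  proof (cases "?h x = \<zero>\<^bsub>?K\<^esub>")
    case True
    then show ?thesis using q0 by (simp add: K.nat_pow_zero)
  next
    case False
    let ?M = "Multiplicative_Group.mult_of ?K"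
    interpret M: group ?M by (rule K.field_mult_group)
    have "?h x \<in> carrier ?M" using False hc by simp
    then have "?h x [^]\<^bsub>?M\<^esub> Coset.order ?M = \<one>\<^bsub>?M\<^esub>" by (rule M.pow_order_eq_1)
    moreover have "Coset.order ?M = q - 1"
      using K.order_mult_of[OF fin_res] card_res by (simp add: Coset.order_def)
    ultimately have "?h x [^]\<^bsub>?K\<^esub> (q - 1) = \<one>\<^bsub>?K\<^esub>" by (simp add: Multiplicative_Group.nat_pow_mult_of)
    moreover have "q = Suc (q - 1)" using q0 by simp
    ultimately show ?thesis using hc by (metis K.l_one K.nat_pow_Suc)
  qed
  then have "?h (x ^ q) = ?h x" using pow by simp
  then show ?thesis using coset_eq_iff[of "x ^ q" x] x subring_set_power[OF subring_A x, of q] by simp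
qed

definition T :: "'k alg_closure set" where
  "T = (\<lambda>C. to_ac (SOME x. to_ac x \<in> A \<and> C = int_max_ideal F v +>\<^bsub>int_ring F v\<^esub> x)) ` carrier (residue_field F v)"

text \<open>Passes from absolute values to the purely ring-theoretic interface on which everything
  after this rests.\<close>

lemma unram_field: "unram_field A Ok Zp T p q m"
proof -
  let ?h = "\<lambda>x. int_max_ideal F v +>\<^bsub>int_ring F v\<^esub> x"
  define rep where "rep C = (SOME x. to_ac x \<in> A \<and> C = ?h x)" for C
  have T_rep: "T = (\<lambda>C. to_ac (rep C)) ` carrier (residue_field F v)" by (simp add: T_def rep_def)
  have rep: "to_ac (rep C) \<in> A \<and> C = ?h (rep C)" if "C \<in> carrier (residue_field F v)" for C
    unfolding rep_def by (rule someI_ex) (use that in \<open>auto simp: residue_field_carrier\<close>)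
  have div_Ok: "y / of_nat p \<in> Ok" if "y \<in> range to_ac" and div: "y / of_nat p \<in> A" for y
  proof -
    from \<open>y \<in> range to_ac\<close> obtain x where "y = to_ac x" by blast
    then have "y / of_nat p = to_ac (x / of_nat p)" by simp
    then show ?thesis using div unfolding Ok_def by (metis IntI rangeI)
  qed
  show ?thesis
  proof (unfold_locales)
    show "subring_set A" "subring_set Ok" "subring_set Zp" "Zp \<subseteq> Ok" "Ok \<subseteq> A" "Factorial_Ring.prime p" "odd p"
      "q = p ^ m" "pcomplete p Zp" "inverse (of_nat p) \<notin> A" "Ok = A \<inter> range to_ac"
      by (rule subring_A subring_Ok subring_Zp Zp_Ok prime_p odd_p q_eq pcomplete_Zp pinv Ok_def | simp add: Ok_def)+
    show "\<exists>N. of_nat p ^ N / z \<in> A" if "z \<noteq> 0" for z using absorb that by blast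
    show "finite T" unfolding T_rep using fin_res by simp
    have "inj_on (\<lambda>C. to_ac (rep C)) (carrier (residue_field F v))"
    proof (rule inj_onI)
      fix C D assume CD: "C \<in> carrier (residue_field F v)" "D \<in> carrier (residue_field F v)"
        and "to_ac (rep C) = to_ac (rep D)"
      then have "?h (rep C) = ?h (rep D)" by simp
      then show "C = D" using rep CD by metis
    qed
    then show "card T = q" unfolding T_rep using card_res card_image by blast
    show "T \<subseteq> Ok" unfolding T_rep Ok_def using rep by auto
    show "\<exists>t\<in>T. (x - t) / of_nat p \<in> Ok" if "x \<in> Ok" for x
    proof -
      from \<open>x \<in> Ok\<close> obtain x' where x': "x = to_ac x'" "to_ac x' \<in> A" by (auto simp: Ok_def)
      define C where "C = ?h x'"
      have C: "C \<in> carrier (residue_field F v)" using x' by (auto simp: C_def residue_field_carrier)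
      have "?h x' = ?h (rep C)" using rep[OF C] by (simp add: C_def)
      then have "(to_ac x' - to_ac (rep C)) / of_nat p \<in> A" using coset_eq_iff x' rep[OF C] by blast
      moreover have "to_ac x' - to_ac (rep C) \<in> range to_ac" by (simp flip: to_ac_diff)
      ultimately have "(to_ac x' - to_ac (rep C)) / of_nat p \<in> Ok" by (intro div_Ok)
      then show ?thesis using C x' by (auto simp: T_rep)
    qed
    show "(t - u) / of_nat p \<notin> A" if tu: "t \<in> T" "u \<in> T" and "t \<noteq> u" for t u
    proof
      assume *: "(t - u) / of_nat p \<in> A"
      from tu obtain C D where CD: "C \<in> carrier (residue_field F v)" "D \<in> carrier (residue_field F v)"
        "t = to_ac (rep C)" "u = to_ac (rep D)" by (auto simp: T_rep)
      then have "?h (rep C) = ?h (rep D)" using coset_eq_iff rep * by blast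
      then have "C = D" using rep CD by metis
      then show False using \<open>t \<noteq> u\<close> CD by simp
    qed
    show "(x ^ q - x) / of_nat p \<in> Ok" if "x \<in> Ok" for x
    proof -
      from \<open>x \<in> Ok\<close> obtain x' where x': "x = to_ac x'" "to_ac x' \<in> A" by (auto simp: Ok_def)
      have "x ^ q - x \<in> range to_ac" unfolding x' by (simp flip: to_ac_diff to_ac_power)
      then show ?thesis using frob_residue[OF x'(2)] x' by (intro div_Ok) auto
    qed
    show "x \<in> A" if "x ^ n \<in> A" "0 < n" for x n using A_root that .
  qed
qed

end

section \<open>The tower generated by iterated preimages\<close>

lemma ac_map_simps [simp]:
  "ac_map 0 x = 0" "ac_map 1 x = 1" "ac_map (pCons a P) x = to_ac a + x * ac_map P x"
  "ac_map (P + Q) x = ac_map P x + ac_map Q x" "ac_map (P * Q) x = ac_map P x * ac_map Q x"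
  "ac_map (- P) x = - ac_map P x" "ac_map (P - Q) x = ac_map P x - ac_map Q x"
  "ac_map (Polynomial.smult a P) x = to_ac a * ac_map P x" "ac_map (P ^ n) x = ac_map P x ^ n"
  by (simp_all add: ac_map_def)

lemma ac_map_sum: "ac_map (sum P I) x = (\<Sum>i\<in>I. ac_map (P i) x)"
  by (induction I rule: infinite_finite_induct) simp_all

text \<open>Evaluation of an element of K[X][Y] at X = x and Y = y. The nesting groups an expression
  by powers of y with coefficients in K[x], which is the shape the Eisenstein argument takes as
  input.\<close>

definition ev :: "'k::field poly poly \<Rightarrow> 'k alg_closure \<Rightarrow> 'k alg_closure \<Rightarrow> 'k alg_closure" where
  "ev P x y = poly (map_poly (\<lambda>c. ac_map c x) P) y"

lemma ev_simps [simp]: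
  "ev 0 x y = 0" "ev (pCons c P) x y = ac_map c x + y * ev P x y"
proof -
  have "map_poly (\<lambda>c. ac_map c x) (pCons c P) = pCons (ac_map c x) (map_poly (\<lambda>c. ac_map c x) P)"
    by (rule poly_eqI) (simp add: coeff_map_poly coeff_pCons split: nat.split)
  then show "ev (pCons c P) x y = ac_map c x + y * ev P x y" by (simp add: ev_def)
qed (simp add: ev_def)

lemma ev_add [simp]: "ev (P + Q) x y = ev P x y + ev Q x y"
proof -
  have "map_poly (\<lambda>c. ac_map c x) (P + Q) = map_poly (\<lambda>c. ac_map c x) P + map_poly (\<lambda>c. ac_map c x) Q"
    by (rule poly_eqI) (simp add: coeff_map_poly)
  then show ?thesis by (simp add: ev_def)
qed

lemma ev_smult [simp]: "ev (Polynomial.smult c P) x y = ac_map c x * ev P x y"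
  by (induction P) (simp_all add: algebra_simps)

lemma ev_1 [simp]: "ev 1 x y = 1" by (simp add: one_pCons)

lemma ev_mult [simp]: "ev (P * Q) x y = ev P x y * ev Q x y"
  by (induction P) (simp_all add: algebra_simps)

lemma ev_minus [simp]: "ev (- P) x y = - ev P x y"
  using ev_smult[of "- 1" P x y] by simp

lemma ev_diff [simp]: "ev (P - Q) x y = ev P x y - ev Q x y"
  using ev_add[of P "- Q" x y] by simp

lemma ev_power [simp]: "ev (P ^ n) x y = ev P x y ^ n"
  by (induction n) simp_all

lemma ev_altdef: "ev P x y = (\<Sum>j\<le>Polynomial.degree P. ac_map (Polynomial.coeff P j) x * y ^ j)"
proof (induction P)
  case (pCons c P)
  then show ?case
    by (cases "P = 0") (simp_all add: sum.atMost_Suc_shift sum_distrib_left ac_simps del: sum.atMost_Suc)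
qed simp

lemma ev_in_subring:
  assumes S: "subring_set S" "range to_ac \<subseteq> S" and xy: "x \<in> S" "y \<in> S"
  shows "ev P x y \<in> S"
proof -
  have "ac_map c x \<in> S" for c
    using S(2) xy(1) by (induction c) (auto intro!: subring_setD[OF S(1)])
  then show ?thesis
    using xy(2) subring_setD[OF S(1)] by (induction P) auto
qed

text \<open>Both generators of level n are powers, with one and the same exponent e, of those of a
  higher level. This rewrites an expression of level n as one of the higher level.\<close>

lemma ev_subst_power: "\<exists>P'. \<forall>x y. ev P (x ^ e) (y ^ e) = ev P' x y"
proof (induction P)
  case 0 show ?case by (intro exI[of _ 0]) simp
next
  case (pCons c P)
  then obtain P' where P': "\<And>x y. ev P (x ^ e) (y ^ e) = ev P' x y" by blast
  have "\<exists>c'. \<forall>x. ac_map c (x ^ e) = ac_map c' x"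
  proof (induction c)
    case 0 show ?case by (intro exI[of _ 0]) simp
  next
    case (pCons a c)
    then obtain c' where "\<And>x. ac_map c (x ^ e) = ac_map c' x" by blast
    then show ?case by (intro exI[of _ "[:a:] + [:0, 1:] ^ e * c'"]) simp
  qed
  then obtain c' where "\<And>x. ac_map c (x ^ e) = ac_map c' x" by blast
  then show ?case using P' by (intro exI[of _ "[:c':] + [:0, 1:] ^ e * P'"]) simp
qed

section \<open>K-algebra endomorphisms and Galois groups\<close>

definition khom :: "'k::field alg_closure set \<Rightarrow> ('k alg_closure \<Rightarrow> 'k alg_closure) \<Rightarrow> bool" where
  "khom S \<phi> \<longleftrightarrow> (\<forall>x\<in>S. \<phi> x \<in> S) \<and>
     (\<forall>x\<in>S. \<forall>y\<in>S. \<phi> (x + y) = \<phi> x + \<phi> y \<and> \<phi> (x * y) = \<phi> x * \<phi> y) \<and> (\<forall>a. \<phi> (to_ac a) = to_ac a)"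

lemma khomD:
  assumes "khom S \<phi>"
  shows "x \<in> S \<Longrightarrow> \<phi> x \<in> S" "x \<in> S \<Longrightarrow> y \<in> S \<Longrightarrow> \<phi> (x + y) = \<phi> x + \<phi> y"
    "x \<in> S \<Longrightarrow> y \<in> S \<Longrightarrow> \<phi> (x * y) = \<phi> x * \<phi> y" "\<phi> (to_ac a) = to_ac a"
    "\<phi> 0 = 0" "\<phi> 1 = 1" "\<phi> (of_nat n) = of_nat n"
  using assms unfolding khom_def by (blast | metis to_ac_0 to_ac_1 to_ac_of_nat)+

lemma khom_power: "khom S \<phi> \<Longrightarrow> subring_set S \<Longrightarrow> x \<in> S \<Longrightarrow> \<phi> (x ^ n) = \<phi> x ^ n"
  by (induction n) (simp_all add: khomD subring_set_power)

lemma khom_ev: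
  assumes S: "subring_set S" "range to_ac \<subseteq> S" and h: "khom S \<phi>" and xy: "x \<in> S" "y \<in> S"
  shows "\<phi> (ev P x y) = ev P (\<phi> x) (\<phi> y)"
proof -
  have ac_S: "ac_map c x \<in> S" for c
    using S(2) xy(1) by (induction c) (auto intro!: subring_setD[OF S(1)])
  have ac: "\<phi> (ac_map c x) = ac_map c (\<phi> x)" for c
  proof (induction c)
    case (pCons a c)
    have "to_ac a \<in> S" "x * ac_map c x \<in> S" using S(2) ac_S xy by (auto intro: subring_setD[OF S(1)])
    then show ?case using pCons khomD[OF h] ac_S xy by simp
  qed (use khomD[OF h] in simp)
  show ?thesis
  proof (induction P)
    case (pCons c P)
    have "y * ev P x y \<in> S" "ev P x y \<in> S" using ev_in_subring[OF S xy] xy by (auto intro: subring_setD[OF S(1)])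
    then show ?case using pCons khomD[OF h] ac_S ac xy by simp
  qed (use khomD[OF h] in simp)
qed

lemma carrier_galois_group:
  assumes "subring_set L"
  shows "carrier (galois_group L) = {\<phi> \<in> Bij L. khom L \<phi>}"
proof -
  have one: "\<phi> 1 = 1" if "\<forall>a. \<phi> (to_ac a) = to_ac a" for \<phi> :: "'a alg_closure \<Rightarrow> 'a alg_closure"
    using that[rule_format, of 1] by simp
  show ?thesis by (auto simp: galois_group_def khom_def Ring.ring_hom_def one)
qed

lemma galois_group_mult: "\<phi> \<in> Bij L \<Longrightarrow> \<psi> \<in> Bij L \<Longrightarrow> \<phi> \<otimes>\<^bsub>galois_group L\<^esub> \<psi> = compose L \<phi> \<psi>"
  by (simp add: galois_group_def BijGroup_def)

lemma galois_group_one: "\<one>\<^bsub>galois_group L\<^esub> = (\<lambda>x\<in>L. x)"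
  by (simp add: galois_group_def BijGroup_def)

lemma group_galois_group:
  assumes L: "subring_set L" and K: "range to_ac \<subseteq> L" shows "group (galois_group L)"
proof -
  have "subgroup (carrier (galois_group L)) (BijGroup L)"
  proof (rule group.subgroupI[OF group_BijGroup])
    show "carrier (galois_group L) \<subseteq> carrier (BijGroup L)"
      unfolding carrier_galois_group[OF L] by (auto simp: BijGroup_def)
    have "khom L (\<lambda>x\<in>L. x)" using K subring_setD[OF L] by (auto simp: khom_def)
    then show "carrier (galois_group L) \<noteq> {}"
      unfolding carrier_galois_group[OF L] using id_Bij by auto
  next
    fix \<phi> assume "\<phi> \<in> carrier (galois_group L)"
    then have B: "\<phi> \<in> Bij L" and h: "khom L \<phi>" by (auto simp: carrier_galois_group[OF L])
    have bij: "bij_betw \<phi> L L" using B by (simp add: Bij_def)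
    let ?i = "inv_into L \<phi>"
    have i: "?i x \<in> L" "\<phi> (?i x) = x" if "x \<in> L" for x
      using bij that by (auto simp: bij_betw_def intro: inv_into_into f_inv_into_f)
    have ii: "?i (\<phi> x) = x" if "x \<in> L" for x using bij that by (simp add: bij_betw_def)
    have "khom L (\<lambda>x\<in>L. ?i x)" unfolding khom_def
    proof (intro conjI ballI allI)
      fix x y assume xy: "x \<in> L" "y \<in> L"
      have "\<phi> (?i x + ?i y) = x + y" "\<phi> (?i x * ?i y) = x * y" using xy i khomD[OF h] by auto
      moreover have "?i x + ?i y \<in> L" "?i x * ?i y \<in> L" "x + y \<in> L" "x * y \<in> L"
        using xy i subring_setD[OF L] by auto
      ultimately show "(\<lambda>x\<in>L. ?i x) (x + y) = (\<lambda>x\<in>L. ?i x) x + (\<lambda>x\<in>L. ?i x) y"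
        "(\<lambda>x\<in>L. ?i x) (x * y) = (\<lambda>x\<in>L. ?i x) x * (\<lambda>x\<in>L. ?i x) y"
        using ii xy by (metis restrict_apply')+
    next
      fix a have "to_ac a \<in> L" using K by blast
      then show "(\<lambda>x\<in>L. ?i x) (to_ac a) = to_ac a" using ii[of "to_ac a"] khomD(4)[OF h] by simp
    qed (use i in auto)
    then show "inv\<^bsub>BijGroup L\<^esub> \<phi> \<in> carrier (galois_group L)"
      unfolding inv_BijGroup[OF B] carrier_galois_group[OF L] using restrict_inv_into_Bij[OF B] by simp
  next
    fix \<phi> \<psi> assume "\<phi> \<in> carrier (galois_group L)" "\<psi> \<in> carrier (galois_group L)"
    then have B: "\<phi> \<in> Bij L" "\<psi> \<in> Bij L" and h: "khom L \<phi>" "khom L \<psi>" by (auto simp: carrier_galois_group[OF L])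
    have "to_ac a \<in> L" for a using K by blast
    then have "khom L (compose L \<phi> \<psi>)" unfolding khom_def
      using khomD[OF h(1)] khomD[OF h(2)] subring_setD[OF L] by (auto simp: compose_def)
    then show "\<phi> \<otimes>\<^bsub>BijGroup L\<^esub> \<psi> \<in> carrier (galois_group L)"
      unfolding carrier_galois_group[OF L] using B compose_Bij by (simp add: BijGroup_def)
  qed
  then have "group (BijGroup L\<lparr>carrier := carrier (galois_group L)\<rparr>)"
    by (rule subgroup.subgroup_is_group[OF _ group_BijGroup])
  moreover have "BijGroup L\<lparr>carrier := carrier (galois_group L)\<rparr> = galois_group L"
    by (simp add: galois_group_def)
  ultimately show ?thesis by simp
qed

text \<open>Compatible systems of roots of 1 and of p. Since d is prime, \<open>\<zeta> 1\<close>
  being different from 1 already makes every \<open>\<zeta> n\<close> a primitive d^n-th root of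
  unity.\<close>

locale kummer_tower = unram_field A Ok R T p q m
  for A Ok R T :: "'k::field_char_0 alg_closure set" and p q m :: nat +
  fixes d :: nat and \<zeta> \<pi> :: "nat \<Rightarrow> 'k alg_closure"
  assumes prime_d: "Factorial_Ring.prime d" and odd_d: "odd d" and p_neq_d: "p \<noteq> d"
    and \<zeta>_0: "\<zeta> 0 = 1" and \<zeta>_1: "\<zeta> 1 \<noteq> 1" and \<zeta>_Suc: "\<And>n. \<zeta> (Suc n) ^ d = \<zeta> n"
    and \<pi>_0: "\<pi> 0 = of_nat p" and \<pi>_Suc: "\<And>n. \<pi> (Suc n) ^ d = \<pi> n"
begin

lemma d_pos: "d > 0" "d ^ n > 0" using prime_gt_0_nat[OF prime_d] by auto

lemma \<zeta>_add: "\<zeta> (n + k) ^ (d ^ k) = \<zeta> n"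
proof (induction k)
  case (Suc k)
  have "\<zeta> (n + Suc k) ^ (d ^ Suc k) = (\<zeta> (Suc (n + k)) ^ d) ^ (d ^ k)" by (simp add: power_mult)
  then show ?case using Suc \<zeta>_Suc by simp
qed simp

lemma \<pi>_add: "\<pi> (n + k) ^ (d ^ k) = \<pi> n"
proof (induction k)
  case (Suc k)
  have "\<pi> (n + Suc k) ^ (d ^ Suc k) = (\<pi> (Suc (n + k)) ^ d) ^ (d ^ k)" by (simp add: power_mult)
  then show ?case using Suc \<pi>_Suc by simp
qed simp

lemma \<zeta>_root: "\<zeta> n ^ (d ^ n) = 1" using \<zeta>_add[of 0 n] \<zeta>_0 by simp

lemma \<pi>_root: "\<pi> n ^ (d ^ n) = pp" using \<pi>_add[of 0 n] \<pi>_0 by simp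

lemma \<zeta>_nz [simp]: "\<zeta> n \<noteq> 0" using \<zeta>_root[of n] d_pos by (auto simp: power_0_left)

lemma \<pi>_nz [simp]: "\<pi> n \<noteq> 0" using \<pi>_root[of n] d_pos by (auto simp: power_0_left)

text \<open>The inductive step comes down to level 1, where an exponent b prime to d cannot kill
  \<open>\<zeta> 1\<close>: by Bezout \<open>\<zeta> 1\<close> would itself be 1.\<close>

lemma \<zeta>_power_eq_1: "\<zeta> n ^ a = 1 \<longleftrightarrow> d ^ n dvd a"
proof
  assume "d ^ n dvd a" then show "\<zeta> n ^ a = 1" by (auto elim!: dvdE simp: power_mult \<zeta>_root)
next
  show "\<zeta> n ^ a = 1 \<Longrightarrow> d ^ n dvd a"
  proof (induction n)
    case (Suc n)
    have "\<zeta> n ^ a = (\<zeta> (Suc n) ^ a) ^ d" unfolding \<zeta>_Suc[of n, symmetric] by (simp add: power_mult[symmetric] mult.commute)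
    then have "d ^ n dvd a" using Suc by simp
    then obtain b where b: "a = d ^ n * b" by blast
    have z1: "\<zeta> 1 ^ b = 1" using Suc.prems \<zeta>_add[of 1 n] by (simp add: b power_mult)
    have "d dvd b"
    proof (rule ccontr)
      assume "\<not> d dvd b"
      then have "coprime b d" using prime_imp_coprime[OF prime_d] by (simp add: coprime_commute)
      moreover have "b \<noteq> 0" using \<open>\<not> d dvd b\<close> by (metis dvd_0_right)
      ultimately obtain x y where "b * x = d * y + 1" using bezout_nat[of b d] by auto
      then have "\<zeta> 1 ^ (b * x) = \<zeta> 1 ^ (d * y) * \<zeta> 1" by (simp add: power_add)
      moreover have "\<zeta> 1 ^ d = 1" using \<zeta>_Suc[of 0] \<zeta>_0 by simp
      ultimately show False using z1 \<zeta>_1 by (simp add: power_mult)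
    qed
    then show ?case by (auto simp: b)
  qed simp
qed

lemma \<zeta>_powi_eq_1: "\<zeta> n powi a = 1 \<longleftrightarrow> int (d ^ n) dvd a"
proof (cases "a \<ge> 0")
  case True
  then obtain b where "a = int b" by (metis nonneg_int_cases)
  then show ?thesis using \<zeta>_power_eq_1 by (simp only: power_int_of_nat int_dvd_int_iff)
next
  case False
  then obtain b where b: "a = - int b" by (metis neg_0_le_iff_le nonneg_int_cases linorder_le_cases minus_minus)
  then have "\<zeta> n powi a = 1 \<longleftrightarrow> \<zeta> n ^ b = 1" by (simp add: power_int_minus)
  then show ?thesis using \<zeta>_power_eq_1[of n b] unfolding b by (simp only: dvd_minus_iff int_dvd_int_iff)
qed

text \<open>The powers of \<open>\<zeta> n\<close> below d^n are distinct and already exhaust the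
  roots of X^(d^n) - 1.\<close>

lemma unity_is_power:
  assumes "w ^ (d ^ n) = 1" shows "\<exists>a. w = \<zeta> n ^ a"
proof (rule ccontr)
  assume no: "\<nexists>a. w = \<zeta> n ^ a"
  let ?N = "d ^ n"
  define P :: "'k alg_closure poly" where "P = Polynomial.monom 1 ?N - 1"
  have "Polynomial.coeff P ?N = 1" using d_pos(2)[of n] by (simp add: P_def)
  then have "P \<noteq> 0" by auto
  have "Polynomial.degree P \<le> ?N" unfolding P_def by (intro degree_diff_le) (auto simp: degree_monom_le)
  have inj: "inj_on (\<lambda>a. \<zeta> n ^ a) {..<?N}"
  proof (rule linorder_inj_onI')
    fix a b assume ab: "a \<in> {..<?N}" "b \<in> {..<?N}" "a < b"
    show "\<zeta> n ^ a \<noteq> \<zeta> n ^ b"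
    proof
      assume eq: "\<zeta> n ^ a = \<zeta> n ^ b"
      have "\<zeta> n ^ b = \<zeta> n ^ a * \<zeta> n ^ (b - a)" using ab(3) by (simp flip: power_add)
      then have "\<zeta> n ^ (b - a) = 1" using eq by simp
      then have "?N dvd b - a" by (simp add: \<zeta>_power_eq_1)
      then show False using ab by (auto dest!: dvd_imp_le)
    qed
  qed
  have "insert w ((\<lambda>a. \<zeta> n ^ a) ` {..<?N}) \<subseteq> {x. poly P x = 0}"
  proof -
    have "(\<zeta> n ^ a) ^ ?N = 1" for a by (metis mult.commute power_mult power_one \<zeta>_root)
    then show ?thesis using assms by (auto simp: P_def poly_monom)
  qed
  then have "card (insert w ((\<lambda>a. \<zeta> n ^ a) ` {..<?N})) \<le> card {x. poly P x = 0}"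
    by (rule card_mono[OF poly_roots_finite[OF \<open>P \<noteq> 0\<close>]])
  also have "\<dots> \<le> ?N" using card_poly_roots_bound[OF \<open>P \<noteq> 0\<close>] \<open>Polynomial.degree P \<le> ?N\<close> by linarith
  finally show False using no inj by (simp add: card_image image_iff)
qed

lemma kummer_is_power:
  assumes "w ^ (d ^ n) = pp" shows "\<exists>a. w = \<zeta> n ^ a * \<pi> n"
proof -
  have "(w / \<pi> n) ^ (d ^ n) = 1" using assms by (simp add: power_divide \<pi>_root)
  from unity_is_power[OF this] show ?thesis by (auto simp: field_simps)
qed

lemma root_locale: "unram_field_root A Ok R T p q m (\<zeta> n) (d ^ n)"
proof -
  have "coprime d p" using primes_coprime[OF prime_d prime_p] p_neq_d by auto
  then have "coprime (d ^ n) p" by simp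
  moreover have "\<zeta> n \<in> A" by (rule unity_A[OF \<zeta>_root d_pos(2)])
  ultimately show ?thesis
    by unfold_locales (use \<zeta>_root d_pos in auto)
qed

text \<open>Modulo Y^D = p the terms of P are grouped by the residue of their Y-exponent. Eisenstein
  independence makes each group coefficient vanish at \<zeta>, hence at any conjugate x', and the
  grouping is valid for any root y' of p. So the images of \<zeta> and \<pi> can be prescribed
  independently of each other.\<close>

lemma conj_pair:
  assumes P: "ev P (\<zeta> n) (\<pi> n) = 0"
    and x': "\<And>Q. ac_map Q (\<zeta> n) = 0 \<Longrightarrow> ac_map Q x' = 0" and y': "y' ^ (d ^ n) = pp"
  shows "ev P x' y' = 0"
proof -
  interpret Z: unram_field_root A Ok R T p q m "\<zeta> n" "d ^ n" by (rule root_locale)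
  let ?D = "d ^ n"
  define Q where "Q r = (\<Sum>j | j \<le> Polynomial.degree P \<and> j mod ?D = r. Polynomial.smult (of_nat p ^ (j div ?D)) (Polynomial.coeff P j))" for r
  have fold: "ev P x y = (\<Sum>r<?D. ac_map (Q r) x * y ^ r)" if y: "y ^ ?D = pp" for x y
  proof -
    have pw: "y ^ j = pp ^ (j div ?D) * y ^ (j mod ?D)" for j
    proof -
      have "y ^ j = y ^ (?D * (j div ?D) + j mod ?D)" by simp
      then show ?thesis by (simp only: power_add power_mult y)
    qed
    have "(\<Sum>r<?D. ac_map (Q r) x * y ^ r)
      = (\<Sum>r<?D. \<Sum>j | j \<in> {..Polynomial.degree P} \<and> j mod ?D = r. ac_map (Polynomial.coeff P j) x * y ^ j)"
    proof (rule sum.cong)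
      fix r
      have "ac_map (Q r) x * y ^ r = (\<Sum>j | j \<le> Polynomial.degree P \<and> j mod ?D = r. (pp ^ (j div ?D) * ac_map (Polynomial.coeff P j) x) * y ^ r)"
        by (simp add: Q_def ac_map_sum sum_distrib_right)
      also have "\<dots> = (\<Sum>j | j \<in> {..Polynomial.degree P} \<and> j mod ?D = r. ac_map (Polynomial.coeff P j) x * y ^ j)"
      proof (rule sum.cong)
        fix j assume "j \<in> {j. j \<in> {..Polynomial.degree P} \<and> j mod ?D = r}"
        then have "y ^ j = pp ^ (j div ?D) * y ^ r" using pw[of j] by simp
        then show "pp ^ (j div ?D) * ac_map (Polynomial.coeff P j) x * y ^ r = ac_map (Polynomial.coeff P j) x * y ^ j"
          by (simp only: ac_simps)
      qed simp
      finally show "ac_map (Q r) x * y ^ r = (\<Sum>j | j \<in> {..Polynomial.degree P} \<and> j mod ?D = r. ac_map (Polynomial.coeff P j) x * y ^ j)" .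
    qed simp
    also have "\<dots> = (\<Sum>j\<in>{..Polynomial.degree P}. ac_map (Polynomial.coeff P j) x * y ^ j)"
      by (rule sum.group) (use d_pos in auto)
    finally show ?thesis by (simp add: ev_altdef)
  qed
  have "ac_map (Q r) (\<zeta> n) = 0" if "r < ?D" for r
    using P unfolding fold[OF \<pi>_root] by (intro Z.Eisenstein_independent[OF \<pi>_root d_pos(2) _ that])
  then show ?thesis unfolding fold[OF y'] by (simp add: x')
qed

section \<open>The fields generated by the roots of each level\<close>

definition L :: "nat \<Rightarrow> 'k alg_closure set" where "L n = range (\<lambda>P. ev P (\<zeta> n) (\<pi> n))"

lemma subring_L: "subring_set (L n)"
  unfolding subring_set_def L_def
  by (auto simp flip: ev_add ev_mult ev_minus) (metis ev_simps(1) rangeI, metis ev_1 rangeI)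

lemma range_L: "range to_ac \<subseteq> L n"
  unfolding L_def by (auto intro!: image_eqI[of _ _ "[:[:_:]:]"])

lemma \<zeta>_L: "\<zeta> n \<in> L n" unfolding L_def by (auto intro!: image_eqI[of _ _ "[:[:0, 1:]:]"])

lemma \<pi>_L: "\<pi> n \<in> L n" unfolding L_def by (auto intro!: image_eqI[of _ _ "[:0, 1:]"])

lemmas L_intros = subring_set_intros[OF subring_L]

lemma ev_L: "x \<in> L n \<Longrightarrow> y \<in> L n \<Longrightarrow> ev P x y \<in> L n"
  by (rule ev_in_subring[OF subring_L range_L])

lemma L_mono: "n \<le> k \<Longrightarrow> L n \<subseteq> L k"
proof (rule lift_Suc_mono_le[of L])
  fix n
  have "\<zeta> n \<in> L (Suc n)" "\<pi> n \<in> L (Suc n)"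
    unfolding \<zeta>_Suc[of n, symmetric] \<pi>_Suc[of n, symmetric] by (intro L_intros \<zeta>_L \<pi>_L)+
  then show "L n \<subseteq> L (Suc n)" unfolding L_def[of n] using ev_L by blast
qed

text \<open>A nonzero algebraic element \<open>x\<close> satisfies an equation with nonzero constant term, so
  \<open>inverse x\<close> is a polynomial in \<open>x\<close>.\<close>

lemma inverse_in_algebraic_subring:
  fixes S :: "'k alg_closure set"
  assumes S: "subring_set S" "range to_ac \<subseteq> S" and "x \<in> S" shows "inverse x \<in> S"
proof (cases "x = 0")
  case False
  obtain g :: "'k poly" where g: "Polynomial.lead_coeff g = 1" "ac_map g x = 0"
    "\<And>P. ac_map P x = 0 \<Longrightarrow> g dvd P" using minimal_polynomial by blast
  obtain a h where gh: "g = pCons a h" by (cases g)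
  have h0: "h \<noteq> 0"
  proof
    assume "h = 0"
    then show False using g(1,2) by (simp add: gh)
  qed
  have "a \<noteq> 0"
  proof
    assume "a = 0"
    then have "ac_map h x = 0" using g(2) False by (simp add: gh)
    then have "Polynomial.degree g \<le> Polynomial.degree h" using dvd_imp_degree_le[OF g(3) h0] by blast
    then show False using h0 by (simp add: gh)
  qed
  have hS: "ac_map h x \<in> S"
    using S(2) assms(3) by (induction h) (auto intro!: subring_setD[OF S(1)])
  have "x * ac_map h x = - to_ac a" using g(2) by (simp add: gh eq_neg_iff_add_eq_0 add.commute)
  moreover have "x * (to_ac (- inverse a) * ac_map h x) = to_ac (- inverse a) * (x * ac_map h x)"
    by (simp only: mult.left_commute)
  ultimately have "x * (to_ac (- inverse a) * ac_map h x) = 1" using \<open>a \<noteq> 0\<close> by simp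
  then have "inverse x = to_ac (- inverse a) * ac_map h x" by (rule inverse_unique)
  moreover have "\<dots> \<in> S" by (rule subring_setD(4)[OF S(1) subsetD[OF S(2) rangeI] hS])
  ultimately show ?thesis by simp
qed (use subring_setD(1)[OF S(1)] in simp)

lemma inverse_L: "x \<in> L n \<Longrightarrow> inverse x \<in> L n"
  by (rule inverse_in_algebraic_subring[OF subring_L range_L])

text \<open>Automorphisms are built on the union of all levels, so that their restrictions to the
  levels are compatible by construction.\<close>

definition Linf :: "'k alg_closure set" where "Linf = (\<Union>n. L n)"

lemma L_Linf: "L n \<subseteq> Linf" by (auto simp: Linf_def)

lemma range_Linf: "range to_ac \<subseteq> Linf" using range_L[of 0] L_Linf by blast

lemma subring_Linf: "subring_set Linf"
proof -
  have "\<exists>k. x \<in> L k \<and> y \<in> L k" if "x \<in> Linf" "y \<in> Linf" for x y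
  proof -
    from that obtain i j where "x \<in> L i" "y \<in> L j" by (auto simp: Linf_def)
    then show ?thesis using L_mono[of i "max i j"] L_mono[of j "max i j"] by (intro exI[of _ "max i j"]) auto
  qed
  then have "x + y \<in> Linf \<and> x * y \<in> Linf" if "x \<in> Linf" "y \<in> Linf" for x y
    using that L_intros(3,4) L_Linf by blast
  moreover have "- x \<in> Linf" if "x \<in> Linf" for x
    using that L_intros(5) by (auto simp: Linf_def)
  moreover have "0 \<in> Linf" "1 \<in> Linf" using L_intros(1,2)[of 0] L_Linf by auto
  ultimately show ?thesis unfolding subring_set_def by blast
qed

text \<open>Admissible images for the two root systems: compatible under d-th powers and subject to
  every polynomial relation of the originals. The last clause keeps each level stable.\<close>

definition conj_seq :: "(nat \<Rightarrow> 'k alg_closure) \<Rightarrow> (nat \<Rightarrow> 'k alg_closure) \<Rightarrow> bool" where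
  "conj_seq xs ys \<longleftrightarrow> (\<forall>n. xs (Suc n) ^ d = xs n \<and> ys (Suc n) ^ d = ys n) \<and>
     (\<forall>n P. ev P (\<zeta> n) (\<pi> n) = 0 \<longrightarrow> ev P (xs n) (ys n) = 0) \<and>
     (\<forall>n. xs n \<in> L n \<and> ys n \<in> L n)"

definition lift_hom :: "(nat \<Rightarrow> 'k alg_closure) \<Rightarrow> (nat \<Rightarrow> 'k alg_closure) \<Rightarrow> 'k alg_closure \<Rightarrow> 'k alg_closure" where
  "lift_hom xs ys z = (THE w. \<exists>n P. z = ev P (\<zeta> n) (\<pi> n) \<and> w = ev P (xs n) (ys n))"

text \<open>The expression of the lower level is rewritten at the higher one by substituting powers.
  The difference of the two expressions is then a relation at a single level, and
  \<open>conj_seq\<close> preserves it.\<close>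

lemma conj_seq_well_defined:
  assumes c: "conj_seq xs ys" and eq: "ev P (\<zeta> n) (\<pi> n) = ev Q (\<zeta> k) (\<pi> k)" and "n \<le> k"
  shows "ev P (xs n) (ys n) = ev Q (xs k) (ys k)"
proof -
  define e where "e = d ^ (k - n)"
  have add: "xs (n + i) ^ (d ^ i) = xs n \<and> ys (n + i) ^ (d ^ i) = ys n" for i
  proof (induction i)
    case (Suc i)
    have "zs (n + Suc i) ^ (d ^ Suc i) = (zs (Suc (n + i)) ^ d) ^ (d ^ i)" for zs :: "nat \<Rightarrow> 'k alg_closure"
      by (simp add: power_mult)
    then show ?case using Suc c by (simp add: conj_seq_def)
  qed simp
  have k: "k = n + (k - n)" using \<open>n \<le> k\<close> by simp
  obtain P' where P': "\<And>x y. ev P (x ^ e) (y ^ e) = ev P' x y" using ev_subst_power by blast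
  have e1: "ev P (\<zeta> n) (\<pi> n) = ev P' (\<zeta> k) (\<pi> k)"
    using \<zeta>_add[of n "k - n"] \<pi>_add[of n "k - n"] P'[of "\<zeta> k" "\<pi> k"] k by (simp add: e_def)
  have e2: "ev P (xs n) (ys n) = ev P' (xs k) (ys k)"
    using add[of "k - n"] P'[of "xs k" "ys k"] k by (simp add: e_def)
  have "ev (P' - Q) (\<zeta> k) (\<pi> k) = 0" using e1 eq by simp
  then have "ev (P' - Q) (xs k) (ys k) = 0" using c unfolding conj_seq_def by blast
  then show ?thesis using e2 by simp
qed

lemma lift_hom_ev:
  assumes c: "conj_seq xs ys" shows "lift_hom xs ys (ev P (\<zeta> n) (\<pi> n)) = ev P (xs n) (ys n)"
  unfolding lift_hom_def
proof (rule the_equality)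
  fix w assume "\<exists>k Q. ev P (\<zeta> n) (\<pi> n) = ev Q (\<zeta> k) (\<pi> k) \<and> w = ev Q (xs k) (ys k)"
  then obtain k Q where "ev P (\<zeta> n) (\<pi> n) = ev Q (\<zeta> k) (\<pi> k)" "w = ev Q (xs k) (ys k)" by blast
  then show "w = ev P (xs n) (ys n)"
    using conj_seq_well_defined[OF c, of P n Q k] conj_seq_well_defined[OF c, of Q k P n]
    by (cases "n \<le> k") auto
qed blast

lemma Linf_ev: "z \<in> Linf \<Longrightarrow> \<exists>n P. z = ev P (\<zeta> n) (\<pi> n)"
  unfolding Linf_def L_def by blast

lemma common_level:
  assumes "x \<in> Linf" "y \<in> Linf"
  obtains n P Q where "x = ev P (\<zeta> n) (\<pi> n)" "y = ev Q (\<zeta> n) (\<pi> n)"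
proof -
  from assms obtain i j where "x \<in> L i" "y \<in> L j" by (auto simp: Linf_def)
  then have "x \<in> L (max i j)" "y \<in> L (max i j)" using L_mono[of i "max i j"] L_mono[of j "max i j"] by auto
  then show ?thesis using that unfolding L_def by blast
qed

lemma khom_lift_hom:
  assumes c: "conj_seq xs ys" shows "khom Linf (lift_hom xs ys)"
  unfolding khom_def
proof (intro conjI ballI allI)
  fix x assume "x \<in> Linf"
  then obtain n P where "x = ev P (\<zeta> n) (\<pi> n)" using Linf_ev by blast
  then have "lift_hom xs ys x = ev P (xs n) (ys n)" using lift_hom_ev[OF c] by simp
  also have "\<dots> \<in> L n" using c by (intro ev_L) (auto simp: conj_seq_def)
  finally show "lift_hom xs ys x \<in> Linf" using L_Linf by blast
next
  fix x y assume "x \<in> Linf" "y \<in> Linf"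
  then obtain n P Q where xy: "x = ev P (\<zeta> n) (\<pi> n)" "y = ev Q (\<zeta> n) (\<pi> n)" using common_level by blast
  show "lift_hom xs ys (x + y) = lift_hom xs ys x + lift_hom xs ys y"
    "lift_hom xs ys (x * y) = lift_hom xs ys x * lift_hom xs ys y"
    using lift_hom_ev[OF c, of "P + Q" n] lift_hom_ev[OF c, of "P * Q" n] by (simp_all add: xy lift_hom_ev[OF c])
next
  fix a show "lift_hom xs ys (to_ac a) = to_ac a" using lift_hom_ev[OF c, of "[:[:a:]:]" 0] by simp
qed

text \<open>A homomorphism of fields is injective. It is onto once the generators of every level
  have preimages, since polynomial expressions in those preimages reach everything.\<close>

lemma lift_hom_Bij:
  assumes c: "conj_seq xs ys"
    and onto: "\<And>n. \<zeta> n \<in> lift_hom xs ys ` L n" "\<And>n. \<pi> n \<in> lift_hom xs ys ` L n"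
  shows "restrict (lift_hom xs ys) Linf \<in> carrier (galois_group Linf)"
proof -
  let ?h = "lift_hom xs ys"
  have h: "khom Linf ?h" by (rule khom_lift_hom[OF c])
  have inv: "inverse x \<in> Linf" if "x \<in> Linf" for x
    using inverse_in_algebraic_subring[OF subring_Linf range_Linf that] .
  have "inj_on ?h Linf"
  proof (rule inj_onI)
    fix x y assume xy: "x \<in> Linf" "y \<in> Linf" "?h x = ?h y"
    show "x = y"
    proof (rule ccontr)
      assume "x \<noteq> y"
      define z where "z = x - y"
      have z: "z \<in> Linf" "inverse z \<in> Linf" "z \<noteq> 0"
        using xy \<open>x \<noteq> y\<close> inv subring_setD[OF subring_Linf] by (auto simp: z_def)
      have "?h x = ?h (z + y)" by (simp add: z_def)
      then have "?h z = 0" using khomD(2)[OF h z(1) xy(2)] xy(3) by simp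
      moreover have "?h z * ?h (inverse z) = 1"
        using khomD(3)[OF h z(1,2)] z(3) khomD(6)[OF h] by simp
      ultimately show False by simp
    qed
  qed
  moreover have "?h ` Linf = Linf"
  proof
    show "?h ` Linf \<subseteq> Linf" using khomD(1)[OF h] by blast
    show "Linf \<subseteq> ?h ` Linf"
    proof
      fix z assume "z \<in> Linf"
      then obtain n P where z: "z = ev P (\<zeta> n) (\<pi> n)" using Linf_ev by blast
      from onto obtain u w where uw: "u \<in> L n" "w \<in> L n" "\<zeta> n = ?h u" "\<pi> n = ?h w" by blast
      have "?h (ev P u w) = z"
        unfolding z uw(3,4) by (rule khom_ev[OF subring_Linf range_Linf h]) (use uw L_Linf in auto)
      moreover have "ev P u w \<in> Linf" using ev_L[OF uw(1,2)] L_Linf by blast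
      ultimately show "z \<in> ?h ` Linf" by blast
    qed
  qed
  ultimately have "restrict ?h Linf \<in> Bij Linf"
    unfolding Bij_def by (auto simp: bij_betw_def inj_on_restrict_eq image_restrict_eq)
  moreover have "to_ac a \<in> Linf" for a using range_Linf by blast
  then have "khom Linf (restrict ?h Linf)"
    using khomD[OF h] subring_setD[OF subring_Linf] unfolding khom_def by auto
  ultimately show ?thesis unfolding carrier_galois_group[OF subring_Linf] by simp
qed

section \<open>The automorphisms \<sigma> and \<tau>\<close>

lemma \<zeta>_frob_conj: "ac_map Q (\<zeta> n) = 0 \<Longrightarrow> ac_map Q (\<zeta> n ^ q) = 0"
  using unram_field_root.conj_frobenius[OF root_locale] .

lemma \<zeta>_frob_order: obtains s where "s > 0" "\<zeta> n ^ (q ^ s) = \<zeta> n"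
proof -
  interpret Z: unram_field_root A Ok R T p q m "\<zeta> n" "d ^ n" by (rule root_locale)
  show ?thesis using Z.frob_order that by blast
qed

definition \<sigma>' :: "'k alg_closure \<Rightarrow> 'k alg_closure" where
  "\<sigma>' = restrict (lift_hom (\<lambda>n. \<zeta> n ^ q) \<pi>) Linf"

definition \<tau>' :: "'k alg_closure \<Rightarrow> 'k alg_closure" where
  "\<tau>' = restrict (lift_hom \<zeta> (\<lambda>n. \<zeta> n * \<pi> n)) Linf"

lemma conj_seq_\<sigma>: "conj_seq (\<lambda>n. \<zeta> n ^ q) \<pi>"
proof -
  have "ev P (\<zeta> n ^ q) (\<pi> n) = 0" if "ev P (\<zeta> n) (\<pi> n) = 0" for n P
    by (rule conj_pair[OF that \<zeta>_frob_conj \<pi>_root])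
  moreover have "(\<zeta> (Suc n) ^ q) ^ d = \<zeta> n ^ q" for n
    unfolding \<zeta>_Suc[of n, symmetric] by (simp flip: power_mult add: mult.commute)
  moreover have "\<zeta> n ^ q \<in> L n" for n by (rule L_intros(9)[OF \<zeta>_L])
  ultimately show ?thesis unfolding conj_seq_def using \<pi>_Suc \<pi>_L by blast
qed

lemma conj_seq_\<tau>: "conj_seq \<zeta> (\<lambda>n. \<zeta> n * \<pi> n)"
proof -
  have "ev P (\<zeta> n) (\<zeta> n * \<pi> n) = 0" if "ev P (\<zeta> n) (\<pi> n) = 0" for n P
    by (rule conj_pair[OF that]) (simp_all add: power_mult_distrib \<zeta>_root \<pi>_root)
  moreover have "(\<zeta> (Suc n) * \<pi> (Suc n)) ^ d = \<zeta> n * \<pi> n" for n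
    by (simp add: power_mult_distrib \<pi>_Suc \<zeta>_Suc)
  moreover have "\<zeta> n * \<pi> n \<in> L n" for n by (rule L_intros(4)[OF \<zeta>_L \<pi>_L])
  ultimately show ?thesis unfolding conj_seq_def using \<zeta>_Suc \<zeta>_L by blast
qed

lemma \<sigma>'_values: "\<sigma>' (\<zeta> n) = \<zeta> n ^ q" "\<sigma>' (\<pi> n) = \<pi> n"
  and \<tau>'_values: "\<tau>' (\<zeta> n) = \<zeta> n" "\<tau>' (\<pi> n) = \<zeta> n * \<pi> n"
proof -
  have "\<zeta> n \<in> Linf" "\<pi> n \<in> Linf" using \<zeta>_L \<pi>_L L_Linf by blast+
  then show "\<sigma>' (\<zeta> n) = \<zeta> n ^ q" "\<sigma>' (\<pi> n) = \<pi> n" "\<tau>' (\<zeta> n) = \<zeta> n" "\<tau>' (\<pi> n) = \<zeta> n * \<pi> n"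
    using lift_hom_ev[OF conj_seq_\<sigma>, of "[:[:0, 1:]:]" n] lift_hom_ev[OF conj_seq_\<sigma>, of "[:0, 1:]" n]
      lift_hom_ev[OF conj_seq_\<tau>, of "[:[:0, 1:]:]" n] lift_hom_ev[OF conj_seq_\<tau>, of "[:0, 1:]" n]
    by (simp_all add: \<sigma>'_def \<tau>'_def)
qed

lemma \<sigma>'_galois: "\<sigma>' \<in> carrier (galois_group Linf)"
  unfolding \<sigma>'_def
proof (rule lift_hom_Bij[OF conj_seq_\<sigma>])
  fix n
  obtain s where s: "s > 0" "\<zeta> n ^ (q ^ s) = \<zeta> n" using \<zeta>_frob_order by blast
  \<comment> \<open>Frobenius returns \<open>\<zeta> n\<close> to itself after s steps, so s - 1
    steps supply the preimage.\<close>
  then have "(\<zeta> n ^ q) ^ (q ^ (s - 1)) = \<zeta> n" by (simp flip: power_mult power_Suc)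
  then have "lift_hom (\<lambda>n. \<zeta> n ^ q) \<pi> (\<zeta> n ^ (q ^ (s - 1))) = \<zeta> n"
    using lift_hom_ev[OF conj_seq_\<sigma>, of "[:[:0, 1:]:] ^ (q ^ (s - 1))" n] by simp
  then show "\<zeta> n \<in> lift_hom (\<lambda>n. \<zeta> n ^ q) \<pi> ` L n"
    by (rule image_eqI[OF sym]) (rule L_intros(9)[OF \<zeta>_L])
  have "lift_hom (\<lambda>n. \<zeta> n ^ q) \<pi> (\<pi> n) = \<pi> n"
    using lift_hom_ev[OF conj_seq_\<sigma>, of "[:0, 1:]" n] by simp
  then show "\<pi> n \<in> lift_hom (\<lambda>n. \<zeta> n ^ q) \<pi> ` L n" by (metis \<pi>_L image_eqI)
qed

lemma \<tau>'_galois: "\<tau>' \<in> carrier (galois_group Linf)"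
  unfolding \<tau>'_def
proof (rule lift_hom_Bij[OF conj_seq_\<tau>])
  fix n
  have "lift_hom \<zeta> (\<lambda>n. \<zeta> n * \<pi> n) (\<zeta> n) = \<zeta> n"
    using lift_hom_ev[OF conj_seq_\<tau>, of "[:[:0, 1:]:]" n] by simp
  then show "\<zeta> n \<in> lift_hom \<zeta> (\<lambda>n. \<zeta> n * \<pi> n) ` L n" by (metis \<zeta>_L image_eqI)
  \<comment> \<open>The power d^n - 1 of \<open>\<zeta> n\<close> undoes the multiplication that
    \<tau> performs on \<open>\<pi> n\<close>.\<close>
  have "\<zeta> n * \<zeta> n ^ (d ^ n - 1) = 1" using \<zeta>_root[of n] d_pos(2)[of n] by (simp flip: power_Suc)
  then have "lift_hom \<zeta> (\<lambda>n. \<zeta> n * \<pi> n) (\<zeta> n ^ (d ^ n - 1) * \<pi> n) = \<pi> n"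
    using lift_hom_ev[OF conj_seq_\<tau>, of "[:[:0, 1:]:] ^ (d ^ n - 1) * [:0, 1:]" n]
    by (simp add: mult.assoc[symmetric] mult.commute)
  then show "\<pi> n \<in> lift_hom \<zeta> (\<lambda>n. \<zeta> n * \<pi> n) ` L n"
    by (rule image_eqI[OF sym]) (rule L_intros(4)[OF L_intros(9)[OF \<zeta>_L] \<pi>_L])
qed

lemma galois_values:
  assumes S: "subring_set S" and \<phi>: "khom S \<phi>" and mem: "\<zeta> n \<in> S" "\<pi> n \<in> S"
  shows "\<exists>a. \<phi> (\<zeta> n) = \<zeta> n ^ a" "\<exists>a. \<phi> (\<pi> n) = \<zeta> n ^ a * \<pi> n"
proof -
  have "\<phi> (\<zeta> n) ^ (d ^ n) = 1" using khom_power[OF \<phi> S mem(1), of "d ^ n"] khomD(6)[OF \<phi>] by (simp add: \<zeta>_root)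
  then show "\<exists>a. \<phi> (\<zeta> n) = \<zeta> n ^ a" by (rule unity_is_power)
  have "\<phi> (\<pi> n) ^ (d ^ n) = pp" using khom_power[OF \<phi> S mem(2), of "d ^ n"] khomD(7)[OF \<phi>] by (simp add: \<pi>_root)
  then show "\<exists>a. \<phi> (\<pi> n) = \<zeta> n ^ a * \<pi> n" by (rule kummer_is_power)
qed

text \<open>The image of \<zeta> is a conjugate, and all conjugates are Frobenius powers. This is
  the upper bound on the Galois group.\<close>

lemma galois_frobenius:
  assumes "khom (L n) \<phi>" shows "\<exists>i. \<phi> (\<zeta> n) = \<zeta> n ^ (q ^ i)"
proof -
  interpret Z: unram_field_root A Ok R T p q m "\<zeta> n" "d ^ n" by (rule root_locale)
  have "\<phi> (\<zeta> n) ^ (d ^ n) = 1"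
    using khom_power[OF assms subring_L \<zeta>_L, of "d ^ n"] khomD(6)[OF assms] by (simp add: \<zeta>_root)
  moreover have "ac_map Q (\<phi> (\<zeta> n)) = 0" if "ac_map Q (\<zeta> n) = 0" for Q
    using khom_ev[OF subring_L range_L assms \<zeta>_L \<pi>_L, of "[:Q:]"] that khomD(5)[OF assms] by simp
  ultimately show ?thesis by (rule Z.conj_is_frobenius_power)
qed

text \<open>The generators are sent to a power of \<zeta> and to such a power times \<pi>, so each
  level is stable: it is a normal extension of K.\<close>

lemma khom_Linf_L:
  assumes "khom Linf \<phi>" "x \<in> L n" shows "\<phi> x \<in> L n"
proof -
  have mem: "\<zeta> n \<in> Linf" "\<pi> n \<in> Linf" using \<zeta>_L \<pi>_L L_Linf by blast+
  obtain P where P: "x = ev P (\<zeta> n) (\<pi> n)" using assms(2) by (auto simp: L_def)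
  have "\<phi> (\<zeta> n) \<in> L n" "\<phi> (\<pi> n) \<in> L n"
    using galois_values[OF subring_Linf assms(1) mem] L_intros(4,9) \<zeta>_L \<pi>_L by metis+
  then show ?thesis unfolding P khom_ev[OF subring_Linf range_Linf assms(1) mem] by (rule ev_L)
qed

lemma khom_eq_on_L:
  assumes S: "subring_set S" "range to_ac \<subseteq> S" "L n \<subseteq> S" and S': "subring_set S'" "range to_ac \<subseteq> S'" "L n \<subseteq> S'"
    and h: "khom S \<phi>" "khom S' \<psi>"
    and "\<phi> (\<zeta> n) = \<psi> (\<zeta> n)" "\<phi> (\<pi> n) = \<psi> (\<pi> n)" and "x \<in> L n"
  shows "\<phi> x = \<psi> x"
proof -
  obtain P where P: "x = ev P (\<zeta> n) (\<pi> n)" using assms by (auto simp: L_def)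
  have "\<zeta> n \<in> S" "\<pi> n \<in> S" "\<zeta> n \<in> S'" "\<pi> n \<in> S'" using S S' \<zeta>_L \<pi>_L by blast+
  then show ?thesis using P khom_ev[OF S(1,2) h(1)] khom_ev[OF S'(1,2) h(2)] assms by simp
qed

end

section \<open>Presented groups\<close>

lemma pres_class_eq_iff: "pres_class R u = pres_class R w \<longleftrightarrow> pres_cong R u w"
proof
  assume "pres_class R u = pres_class R w"
  then have "w \<in> pres_class R u" by (simp add: pres_class_def pres_cong.cong_refl)
  then show "pres_cong R u w" by (simp add: pres_class_def)
next
  assume *: "pres_cong R u w"
  show "pres_class R u = pres_class R w"
    unfolding pres_class_def using pres_cong.cong_trans[OF *] pres_cong.cong_trans[OF pres_cong.cong_sym[OF *]] by blast
qed

lemma pres_class_mult: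
  "pres_class R u \<otimes>\<^bsub>presented_group R\<^esub> pres_class R w = pres_class R (u @ w)"
proof -
  have "{z. \<exists>u'\<in>pres_class R u. \<exists>w'\<in>pres_class R w. pres_cong R (u' @ w') z} = pres_class R (u @ w)"
  proof (intro equalityI subsetI)
    fix z assume "z \<in> {z. \<exists>u'\<in>pres_class R u. \<exists>w'\<in>pres_class R w. pres_cong R (u' @ w') z}"
    then obtain u' w' where "pres_cong R u u'" "pres_cong R w w'" "pres_cong R (u' @ w') z"
      by (auto simp: pres_class_def)
    then have "pres_cong R (u @ w) z" by (rule pres_cong.cong_trans[OF pres_cong.cong_append])
    then show "z \<in> pres_class R (u @ w)" by (simp add: pres_class_def)
  next
    fix z assume "z \<in> pres_class R (u @ w)"
    then show "z \<in> {z. \<exists>u'\<in>pres_class R u. \<exists>w'\<in>pres_class R w. pres_cong R (u' @ w') z}"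
      by (auto simp: pres_class_def intro: pres_cong.cong_refl)
  qed
  then show ?thesis by (simp add: presented_group_def)
qed

lemma presented_group_simps:
  "carrier (presented_group R) = range (pres_class R)" "\<one>\<^bsub>presented_group R\<^esub> = pres_class R []"
  by (simp_all add: presented_group_def)

definition word_inv :: "'g word \<Rightarrow> 'g word" where
  "word_inv u = rev (map (\<lambda>(g, b). (g, \<not> b)) u)"

lemma word_inv_right: "pres_cong R (u @ word_inv u) []"
proof (induction u)
  case (Cons l u)
  obtain g b where l: "l = (g, b)" by (cases l)
  have "pres_cong R ([l] @ (u @ word_inv u) @ [(g, \<not> b)]) ([l] @ [] @ [(g, \<not> b)])"
    by (intro pres_cong.cong_append pres_cong.cong_refl Cons)
  moreover have "pres_cong R ([l] @ [] @ [(g, \<not> b)]) []" using pres_cong.cong_cancel[of R g b] by (simp add: l)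
  ultimately have "pres_cong R ([l] @ (u @ word_inv u) @ [(g, \<not> b)]) []" by (rule pres_cong.cong_trans)
  then show ?case by (simp add: word_inv_def l)
qed (simp add: word_inv_def pres_cong.cong_refl)

lemma word_inv_left: "pres_cong R (word_inv u @ u) []"
proof -
  have "word_inv (word_inv u) = u" by (simp add: word_inv_def rev_map comp_def case_prod_unfold)
  then show ?thesis using word_inv_right[of R "word_inv u"] by simp
qed

lemma group_presented_group: "group (presented_group R)"
proof (rule groupI)
  fix x assume "x \<in> carrier (presented_group R)"
  then obtain u where "x = pres_class R u" by (auto simp: presented_group_simps)
  then show "\<exists>y\<in>carrier (presented_group R). y \<otimes>\<^bsub>presented_group R\<^esub> x = \<one>\<^bsub>presented_group R\<^esub>"
    using word_inv_left[of R u]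
    by (intro bexI[of _ "pres_class R (word_inv u)"])
      (auto simp: pres_class_mult presented_group_simps pres_class_eq_iff)
qed (auto simp: presented_group_simps pres_class_mult)

lemma pres_class_inv: "inv\<^bsub>presented_group R\<^esub> (pres_class R u) = pres_class R (word_inv u)"
proof -
  interpret group "presented_group R" by (rule group_presented_group)
  show ?thesis using word_inv_left[of R u]
    by (intro inv_equality) (auto simp: presented_group_simps pres_class_mult pres_class_eq_iff)
qed

lemma pres_gen_carrier: "pres_gen R g \<in> carrier (presented_group R)"
  by (simp add: pres_gen_def presented_group_simps)

lemma pres_class_letter:
  "pres_class R [(g, b)] = (if b then pres_gen R g else inv\<^bsub>presented_group R\<^esub> (pres_gen R g))"
  by (simp add: pres_gen_def pres_class_inv word_inv_def)

lemma presented_group_induct [consumes 1, case_names one letter]: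
  assumes "x \<in> carrier (presented_group R)" and "P \<one>\<^bsub>presented_group R\<^esub>"
    and "\<And>g b x. x \<in> carrier (presented_group R) \<Longrightarrow> P x \<Longrightarrow>
      P ((if b then pres_gen R g else inv\<^bsub>presented_group R\<^esub> (pres_gen R g)) \<otimes>\<^bsub>presented_group R\<^esub> x)"
  shows "P x"
proof -
  from assms(1) obtain u where u: "x = pres_class R u" by (auto simp: presented_group_simps)
  have "P (pres_class R u)"
  proof (induction u)
    case Nil then show ?case using assms(2) by (simp add: presented_group_simps)
  next
    case (Cons l u)
    obtain g b where l: "l = (g, b)" by (cases l)
    have "P (pres_class R [(g, b)] \<otimes>\<^bsub>presented_group R\<^esub> pres_class R u)"
      unfolding pres_class_letter by (rule assms(3)[OF _ Cons]) (simp add: presented_group_simps)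
    then show ?case by (simp add: pres_class_mult l)
  qed
  then show ?thesis by (simp add: u)
qed

section \<open>Evaluation of words and the universal property of a presentation\<close>

definition word_eval :: "('a, 'b) monoid_scheme \<Rightarrow> ('g \<Rightarrow> 'a) \<Rightarrow> 'g word \<Rightarrow> 'a" where
  "word_eval H h w = foldr (\<lambda>(g, b) y. (if b then h g else inv\<^bsub>H\<^esub> (h g)) \<otimes>\<^bsub>H\<^esub> y) w \<one>\<^bsub>H\<^esub>"

text \<open>An arbitrary representative of the class is evaluated; the choice is immaterial as soon
  as the relations hold in the target group.\<close>

definition pres_lift :: "('a, 'b) monoid_scheme \<Rightarrow> ('g \<Rightarrow> 'a) \<Rightarrow> 'g word set \<Rightarrow> 'a" where
  "pres_lift H h A = word_eval H h (SOME u. u \<in> A)"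

context group
begin

lemma word_eval_closed: "range h \<subseteq> carrier G \<Longrightarrow> word_eval G h u \<in> carrier G"
proof -
  assume "range h \<subseteq> carrier G"
  then have "h g \<in> carrier G" for g by blast
  then show ?thesis by (induction u) (auto simp: word_eval_def)
qed

lemma word_eval_append:
  "range h \<subseteq> carrier G \<Longrightarrow> word_eval G h (u @ w) = word_eval G h u \<otimes> word_eval G h w"
proof (induction u)
  case Nil then show ?case using word_eval_closed[of h w] by (simp add: word_eval_def)
next
  case (Cons l u)
  have "h g \<in> carrier G" for g using Cons.prems by blast
  then show ?case using Cons word_eval_closed[of h]
    by (cases l) (simp add: word_eval_def m_assoc)
qed

lemma word_eval_cong:
  assumes h: "range h \<subseteq> carrier G" and R: "\<And>u w. (u, w) \<in> R \<Longrightarrow> word_eval G h u = word_eval G h w"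
  shows "pres_cong R u w \<Longrightarrow> word_eval G h u = word_eval G h w"
proof (induction rule: pres_cong.induct)
  case (cong_cancel g b)
  have "h g \<in> carrier G" using h by blast
  then show ?case by (simp add: word_eval_def)
qed (use R word_eval_append[OF h] in auto)

lemma pres_lift_class:
  assumes h: "range h \<subseteq> carrier G" and R: "\<And>u w. (u, w) \<in> R \<Longrightarrow> word_eval G h u = word_eval G h w"
  shows "pres_lift G h (pres_class R u) = word_eval G h u"
proof -
  have "(SOME w. w \<in> pres_class R u) \<in> pres_class R u"
    by (rule someI[of _ u]) (simp add: pres_class_def pres_cong.cong_refl)
  then show ?thesis unfolding pres_lift_def pres_class_def using word_eval_cong[OF h R] by fastforce
qed

lemma pres_lift_hom:
  assumes h: "range h \<subseteq> carrier G" and R: "\<And>u w. (u, w) \<in> R \<Longrightarrow> word_eval G h u = word_eval G h w"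
  shows "pres_lift G h \<in> hom (presented_group R) G" "pres_lift G h (pres_gen R g) = h g"
proof -
  show "pres_lift G h \<in> hom (presented_group R) G"
    by (rule homI) (auto simp: presented_group_simps pres_class_mult pres_lift_class[OF h R]
        word_eval_append[OF h] word_eval_closed[OF h])
  have "h g \<in> carrier G" using h by blast
  then show "pres_lift G h (pres_gen R g) = h g"
    using pres_lift_class[of h R "[(g, True)]", OF h R] by (simp add: pres_gen_def word_eval_def)
qed

lemma word_eval_pow:
  assumes "range h \<subseteq> carrier G" shows "word_eval G h (word_pow g k) = h g [^] (k :: int)"
proof -
  have hg: "h g \<in> carrier G" using assms by blast
  have "word_eval G h (replicate n (g, b)) = (if b then h g else inv (h g)) [^] (n :: nat)" for n b
    using hg by (induction n) (auto simp: word_eval_def simp flip: nat_pow_Suc2)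
  then have "word_eval G h (word_pow g k) = (if k \<ge> 0 then h g else inv (h g)) [^] nat \<bar>k\<bar>"
    by (simp add: word_pow_def)
  also have "\<dots> = h g [^] k"
  proof (cases "k \<ge> 0")
    case True
    then obtain n where "k = int n" by (metis nonneg_int_cases)
    then show ?thesis by (simp add: int_pow_int)
  next
    case False
    define n where "n = nat (- k)"
    have k: "k = - int n" "nat \<bar>k\<bar> = n" using False by (simp_all add: n_def)
    show ?thesis using False nat_pow_inv[OF hg, of n] int_pow_neg_int[OF hg, of n] unfolding k(1) by simp
  qed
  finally show ?thesis .
qed

end

lemma word_eval_pres_gen: "word_eval (presented_group R) (pres_gen R) u = pres_class R u"
proof (induction u)
  case Nil then show ?case by (simp add: word_eval_def presented_group_simps)
next
  case (Cons l u)
  obtain g b where l: "l = (g, b)" by (cases l)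
  have "word_eval (presented_group R) (pres_gen R) (l # u) = pres_class R [l] \<otimes>\<^bsub>presented_group R\<^esub> pres_class R u"
    using Cons by (simp add: word_eval_def l pres_class_letter)
  then show ?case by (simp add: pres_class_mult)
qed

lemma pres_class_pow: "pres_class R (word_pow g k) = pres_gen R g [^]\<^bsub>presented_group R\<^esub> (k :: int)"
proof -
  interpret group "presented_group R" by (rule group_presented_group)
  have "range (pres_gen R) \<subseteq> carrier (presented_group R)" by (auto intro: pres_gen_carrier)
  from word_eval_pow[OF this, of g k] show ?thesis by (simp only: word_eval_pres_gen)
qed

section \<open>Normal forms under the relation s t s^-1 = t^q\<close>

locale bs_pair = group G for G (structure) +
  fixes t s :: 'a and q :: nat
  assumes t: "t \<in> carrier G" and s: "s \<in> carrier G" and rel: "s \<otimes> t \<otimes> inv s = t [^] int q"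
begin

text \<open>Conjugation by s is an endomorphism, so the relation extends from t to all its integer
  powers.\<close>

lemma s_t_pow: "s \<otimes> t [^] (a :: int) = t [^] (int q * a) \<otimes> s"
proof -
  have "group_hom G G (\<lambda>x. s \<otimes> x \<otimes> inv s)"
    by unfold_locales (use s in \<open>auto intro!: homI simp: m_assoc inv_solve_left\<close>)
  then have "s \<otimes> t [^] a \<otimes> inv s = (t [^] int q) [^] a"
    using group_hom.hom_int_pow[of G G "\<lambda>x. s \<otimes> x \<otimes> inv s" t a] t by (simp add: rel)
  then have "s \<otimes> t [^] a \<otimes> inv s = t [^] (int q * a)" using t by (simp add: int_pow_pow)
  then have "s \<otimes> t [^] a \<otimes> inv s \<otimes> s = t [^] (int q * a) \<otimes> s" by simp
  then show ?thesis using s t by (simp add: m_assoc)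
qed

lemma s_pow_t_pow: "s [^] int k \<otimes> t [^] a = t [^] (int (q ^ k) * a) \<otimes> s [^] int k"
proof (induction k arbitrary: a)
  case (Suc k)
  have sk: "s [^] int (Suc k) = s [^] int k \<otimes> s"
    using s int_pow_mult[of s "int k" 1] by (simp add: add.commute int_pow_1)
  have "s [^] int (Suc k) \<otimes> t [^] a = s [^] int k \<otimes> t [^] (int q * a) \<otimes> s"
    unfolding sk using s t by (simp add: m_assoc s_t_pow)
  also have "\<dots> = t [^] (int (q ^ k) * (int q * a)) \<otimes> s [^] int k \<otimes> s" unfolding Suc ..
  also have "\<dots> = t [^] (int (q ^ Suc k) * a) \<otimes> s [^] int (Suc k)"
    unfolding sk using s t by (simp add: m_assoc mult.assoc mult.left_commute)
  finally show ?case .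
qed (use t in simp)

lemma t_pow_s_neg: "t [^] a \<otimes> s [^] (- int k) = s [^] (- int k) \<otimes> t [^] (int (q ^ k) * a)"
proof -
  have c: "s [^] int k \<in> carrier G" "s [^] (- int k) \<in> carrier G" using s by auto
  have i: "s [^] (- int k) \<otimes> s [^] int k = \<one>" "s [^] int k \<otimes> s [^] (- int k) = \<one>"
    using s by (simp_all add: int_pow_mult[symmetric])
  have "s [^] (- int k) \<otimes> t [^] (int (q ^ k) * a) = s [^] (- int k) \<otimes> (t [^] (int (q ^ k) * a) \<otimes> s [^] int k) \<otimes> s [^] (- int k)"
    using c i t by (simp add: m_assoc)
  also have "\<dots> = s [^] (- int k) \<otimes> (s [^] int k \<otimes> t [^] a) \<otimes> s [^] (- int k)" unfolding s_pow_t_pow ..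
  also have "\<dots> = t [^] a \<otimes> s [^] (- int k)" using c i t by (simp flip: m_assoc)
  finally show ?thesis by simp
qed

text \<open>Negative powers of s stand on the left and positive ones on the right, because moving t
  past s in these directions multiplies its exponent by q, whereas the opposite moves would have to
  divide by q. The form is not unique: (k, a, l) and (k + 1, q a, l + 1) give the same
  element.\<close>

definition nf :: "nat \<Rightarrow> int \<Rightarrow> nat \<Rightarrow> 'a" where
  "nf k a l = s [^] (- int k) \<otimes> t [^] a \<otimes> s [^] int l"

lemma nf_closed [simp]: "nf k a l \<in> carrier G"
  using s t by (simp add: nf_def)

lemma t_pow_nf: "t [^] (b :: int) \<otimes> nf k a l = nf k (int (q ^ k) * b + a) l"
proof -
  have "t [^] b \<otimes> nf k a l = (t [^] b \<otimes> s [^] (- int k)) \<otimes> t [^] a \<otimes> s [^] int l"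
    using s t by (simp add: nf_def m_assoc)
  also have "\<dots> = s [^] (- int k) \<otimes> (t [^] (int (q ^ k) * b) \<otimes> t [^] a) \<otimes> s [^] int l"
    unfolding t_pow_s_neg using s t by (simp add: m_assoc)
  also have "t [^] (int (q ^ k) * b) \<otimes> t [^] a = t [^] (int (q ^ k) * b + a)" using t by (simp add: int_pow_mult)
  finally show ?thesis by (simp add: nf_def)
qed

text \<open>A factor s on the left cancels a negative power if there is one, and otherwise passes
  through t^a to join the positive powers.\<close>

lemma s_nf: "\<exists>k' a' l'. s \<otimes> nf k a l = nf k' a' l'"
proof (cases k)
  case 0
  have "s \<otimes> nf 0 a l = (s \<otimes> t [^] a) \<otimes> s [^] int l" using s t by (simp add: nf_def m_assoc)
  also have "\<dots> = t [^] (int q * a) \<otimes> (s \<otimes> s [^] int l)" unfolding s_t_pow using s t by (simp add: m_assoc)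
  also have "s \<otimes> s [^] int l = s [^] int (Suc l)" using s int_pow_mult[of s 1 "int l"] by (simp add: int_pow_1)
  also have "t [^] (int q * a) \<otimes> s [^] int (Suc l) = nf 0 (int q * a) (Suc l)" using s t by (simp add: nf_def)
  finally show ?thesis using 0 by blast
next
  case (Suc k')
  have "s \<otimes> s [^] (- int k) = s [^] (- int k')" using s int_pow_mult[of s 1 "- int k"] by (simp add: int_pow_1 Suc)
  then have "s \<otimes> nf k a l = nf k' a l" using s t by (simp add: nf_def flip: m_assoc)
  then show ?thesis by blast
qed

lemma inv_s_nf: "inv s \<otimes> nf k a l = nf (Suc k) a l"
proof -
  have "inv s \<otimes> s [^] (- int k) = s [^] (- int (Suc k))"
    using s int_pow_mult[of s "- 1" "- int k"] int_pow_neg[of s 1] by (simp add: int_pow_1)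
  then show ?thesis using s t by (simp add: nf_def flip: m_assoc)
qed

end

lemma bs_pair_presented:
  assumes "bs_rels q \<subseteq> R"
  shows "bs_pair (presented_group R) (pres_gen R GTau) (pres_gen R GSigma) q"
proof -
  interpret group "presented_group R" by (rule group_presented_group)
  have "pres_cong R [(GSigma, True), (GTau, True), (GSigma, False)] (word_pow GTau (int q))"
    using assms by (intro pres_cong.cong_rel) (auto simp: bs_rels_def)
  then have "pres_class R [(GSigma, True), (GTau, True), (GSigma, False)] = pres_class R (word_pow GTau (int q))"
    by (simp add: pres_class_eq_iff)
  moreover have "pres_class R [(GSigma, True), (GTau, True), (GSigma, False)]
      = pres_class R [(GSigma, True)] \<otimes>\<^bsub>presented_group R\<^esub> pres_class R [(GTau, True)] \<otimes>\<^bsub>presented_group R\<^esub> pres_class R [(GSigma, False)]"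
    by (simp add: pres_class_mult)
  ultimately have "pres_gen R GSigma \<otimes>\<^bsub>presented_group R\<^esub> pres_gen R GTau \<otimes>\<^bsub>presented_group R\<^esub> inv\<^bsub>presented_group R\<^esub> pres_gen R GSigma
      = pres_gen R GTau [^]\<^bsub>presented_group R\<^esub> int q"
    by (simp add: pres_class_letter pres_class_pow)
  then show ?thesis
    by unfold_locales (auto simp: pres_gen_carrier)
qed

lemma presented_bs_nf:
  assumes R: "bs_rels q \<subseteq> R" and x: "x \<in> carrier (presented_group R)"
  shows "\<exists>k a l. x = bs_pair.nf (presented_group R) (pres_gen R GTau) (pres_gen R GSigma) k a l"
proof -
  let ?G = "presented_group R"
  interpret bs_pair ?G "pres_gen R GTau" "pres_gen R GSigma" q by (rule bs_pair_presented[OF R])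
  show ?thesis using x
  proof (induction rule: presented_group_induct)
    case one
    show ?case by (intro exI[of _ 0]) (simp add: nf_def)
  next
    case (letter g b x)
    then obtain k a l where x: "x = nf k a l" by blast
    show ?case
    proof (cases g)
      case GSigma
      then show ?thesis using s_nf[of k a l] inv_s_nf[of k a l] x by (cases b) auto
    next
      case GTau
      have "pres_gen R GTau = pres_gen R GTau [^]\<^bsub>?G\<^esub> (1 :: int)" using t by (simp add: int_pow_1)
      moreover have "inv\<^bsub>?G\<^esub> pres_gen R GTau = pres_gen R GTau [^]\<^bsub>?G\<^esub> (- 1 :: int)"
        using t int_pow_neg[of _ 1] by (simp add: int_pow_1)
      ultimately show ?thesis using t_pow_nf[of _ k a l] x GTau by (cases b) (metis, metis)
    qed
  qed
qed

section \<open>The action of the Baumslag-Solitar group on the tower\<close>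

lemma galois_groupD:
  assumes "subring_set S" "\<phi> \<in> carrier (galois_group S)"
  shows "\<phi> \<in> Bij S" "khom S \<phi>" "bij_betw \<phi> S S" "\<phi> \<in> extensional S"
  using assms by (auto simp: carrier_galois_group Bij_def)

lemma galois_group_mult_apply:
  assumes "subring_set S" "\<phi> \<in> carrier (galois_group S)" "\<psi> \<in> carrier (galois_group S)" "x \<in> S"
  shows "(\<phi> \<otimes>\<^bsub>galois_group S\<^esub> \<psi>) x = \<phi> (\<psi> x)"
  using galois_groupD(1)[OF assms(1,2)] galois_groupD(1)[OF assms(1,3)] assms(4)
  by (simp add: galois_group_mult compose_eq)

context kummer_tower
begin

abbreviation GL where "GL n \<equiv> galois_group (L n)"
abbreviation Ginf where "Ginf \<equiv> galois_group Linf"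

definition so :: "nat \<Rightarrow> nat" where "so n = Pocklington.ord (d ^ n) q"

lemma coprime_dn_q: "coprime (d ^ n) q"
proof -
  have "coprime d p" using primes_coprime[OF prime_d prime_p] p_neq_d by auto
  then show ?thesis by (simp add: q_eq)
qed

lemma so_pos: "so n > 0" unfolding so_def using coprime_dn_q by simp

lemma so_dvd: "n \<le> k \<Longrightarrow> so n dvd so k"
proof -
  assume "n \<le> k"
  have "[q ^ so k = 1] (mod d ^ k)" unfolding so_def by (rule ord)
  then have "[q ^ so k = 1] (mod d ^ n)" using \<open>n \<le> k\<close> by (rule cong_dvd_modulus_nat[OF _ le_imp_power_dvd])
  then show ?thesis unfolding so_def by (simp only: ord_divides)
qed

lemma so_mono: "n \<le> k \<Longrightarrow> so n \<le> so k"
  using so_dvd so_pos by (meson dvd_imp_le)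

text \<open>Since d^n divides q^(so n) - 1, a bound M on the orders gives d^n <= q^M for every n,
  which fails at n = q^M.\<close>

lemma so_unbounded: "\<exists>n. so n > M"
proof (rule ccontr)
  assume "\<nexists>n. so n > M"
  then have le: "so n \<le> M" for n by (meson not_le)
  have d2: "d \<ge> 2" using prime_d prime_ge_2_nat by blast
  have "d ^ n \<le> q ^ M" for n
  proof -
    have "[q ^ so n = 1] (mod d ^ n)" unfolding so_def by (rule ord)
    then have "d ^ n dvd q ^ so n - 1" by (metis cong_altdef_nat cong_sym_eq one_le_power q_ge_2 le_trans one_le_numeral)
    moreover have "q ^ so n > 1" using so_pos q_ge_2 by (intro one_less_power) auto
    ultimately have "d ^ n \<le> q ^ so n - 1" by (intro dvd_imp_le) auto
    moreover have "q ^ so n \<le> q ^ M" using le q_ge_2 by (intro power_increasing) auto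
    ultimately show ?thesis by linarith
  qed
  then have "d ^ (q ^ M) \<le> q ^ M" .
  moreover have "q ^ M < 2 ^ (q ^ M)" by (rule less_exp)
  moreover have "(2 :: nat) ^ (q ^ M) \<le> d ^ (q ^ M)" using d2 by (intro power_mono) auto
  ultimately show False by linarith
qed

lemma \<zeta>_power_eq: "\<zeta> n ^ a = \<zeta> n ^ b \<longleftrightarrow> [a = b] (mod d ^ n)"
proof -
  have *: "\<zeta> n ^ a = \<zeta> n ^ b \<longleftrightarrow> [a = b] (mod d ^ n)" if "a \<le> b" for a b
  proof -
    have "\<zeta> n ^ b = \<zeta> n ^ a * \<zeta> n ^ (b - a)" using that by (simp flip: power_add)
    then have "\<zeta> n ^ a = \<zeta> n ^ b \<longleftrightarrow> \<zeta> n ^ (b - a) = 1" by auto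
    then show ?thesis using \<zeta>_power_eq_1[of n "b - a"] cong_altdef_nat[OF that, of "d ^ n"] by (simp add: cong_sym_eq)
  qed
  show ?thesis using *[of a b] *[of b a] by (cases "a \<le> b") (auto simp: cong_sym_eq)
qed

lemma \<zeta>_frob_power_eq: "\<zeta> n ^ (q ^ k) = \<zeta> n ^ (q ^ l) \<longleftrightarrow> [k = l] (mod so n)"
  unfolding \<zeta>_power_eq so_def by (rule order_divides_expdiff[OF coprime_dn_q])

section \<open>Restriction of automorphisms to a finite level\<close>

lemma group_GL: "group (GL n)"
  by (rule group_galois_group[OF subring_L range_L])

lemma group_Ginf: "group (Ginf)"
  by (rule group_galois_group[OF subring_Linf range_Linf])

lemma restrict_galois:
  assumes \<phi>: "\<phi> \<in> carrier (Ginf)"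
  shows "restrict \<phi> (L n) \<in> carrier (GL n)"
proof -
  interpret G: group "Ginf" by (rule group_Ginf)
  note D = galois_groupD[OF subring_Linf \<phi>]
  define \<psi> where "\<psi> = inv\<^bsub>Ginf\<^esub> \<phi>"
  have \<psi>: "\<psi> \<in> carrier (Ginf)" using \<phi> by (simp add: \<psi>_def)
  have "inj_on \<phi> (L n)" using D(3) L_Linf by (auto simp: bij_betw_def intro: inj_on_subset)
  moreover have "\<phi> ` L n = L n"
  proof
    show "\<phi> ` L n \<subseteq> L n" using khom_Linf_L[OF D(2)] by blast
    show "L n \<subseteq> \<phi> ` L n"
    proof
      fix y assume y: "y \<in> L n"
      have yi: "y \<in> Linf" using y L_Linf by blast
      have "\<psi> y \<in> L n" using khom_Linf_L[OF galois_groupD(2)[OF subring_Linf \<psi>] y] .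
      moreover have "\<phi> (\<psi> y) = y"
        using galois_group_mult_apply[OF subring_Linf \<phi> \<psi> yi] yi \<phi>
        by (simp add: \<psi>_def galois_group_one)
      ultimately show "y \<in> \<phi> ` L n" by (metis image_eqI)
    qed
  qed
  ultimately have "restrict \<phi> (L n) \<in> Bij (L n)"
    by (auto simp: Bij_def bij_betw_def inj_on_restrict_eq)
  moreover have "to_ac a \<in> L n" for a using range_L by blast
  then have "khom (L n) (restrict \<phi> (L n))"
    using khomD[OF D(2)] khom_Linf_L[OF D(2)] subring_setD[OF subring_L[of n]] L_Linf[of n]
    unfolding khom_def by (auto simp: subset_iff)
  ultimately show ?thesis unfolding carrier_galois_group[OF subring_L] by simp
qed

lemma restrict_galois_hom: "(\<lambda>\<phi>. restrict \<phi> (L n)) \<in> hom (Ginf) (GL n)"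
proof (rule homI)
  fix \<phi> \<psi> assume h: "\<phi> \<in> carrier (Ginf)" "\<psi> \<in> carrier (Ginf)"
  note r = restrict_galois[OF h(1)] restrict_galois[OF h(2)]
  have "compose Linf \<phi> \<psi> x = \<phi> (\<psi> x)" if "x \<in> L n" for x using that L_Linf by (auto simp: compose_def)
  moreover have "\<psi> x \<in> L n" if "x \<in> L n" for x
    by (rule khom_Linf_L[OF galois_groupD(2)[OF subring_Linf h(2)] that])
  ultimately have "restrict (compose Linf \<phi> \<psi>) (L n) = compose (L n) (restrict \<phi> (L n)) (restrict \<psi> (L n))"
    by (auto simp: compose_def restrict_def fun_eq_iff)
  then show "restrict (\<phi> \<otimes>\<^bsub>Ginf\<^esub> \<psi>) (L n) = restrict \<phi> (L n) \<otimes>\<^bsub>GL n\<^esub> restrict \<psi> (L n)"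
    using galois_group_mult[OF galois_groupD(1)[OF subring_Linf h(1)] galois_groupD(1)[OF subring_Linf h(2)]]
      galois_group_mult[OF galois_groupD(1)[OF subring_L r(1)] galois_groupD(1)[OF subring_L r(2)]] by simp
qed (rule restrict_galois)

lemma galois_L_eqI:
  assumes "\<phi> \<in> carrier (GL n)" "\<psi> \<in> carrier (GL n)"
    and "\<phi> (\<zeta> n) = \<psi> (\<zeta> n)" "\<phi> (\<pi> n) = \<psi> (\<pi> n)"
  shows "\<phi> = \<psi>"
proof (rule extensionalityI)
  note D = galois_groupD[OF subring_L assms(1)] galois_groupD[OF subring_L assms(2)]
  show "\<phi> \<in> extensional (L n)" "\<psi> \<in> extensional (L n)" using D by blast+
  show "\<phi> x = \<psi> x" if "x \<in> L n" for x
    by (rule khom_eq_on_L[OF subring_L range_L order_refl subring_L range_L order_refl D(2) D(6) assms(3,4) that])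
qed

lemma galois_Linf_eqI:
  assumes "\<phi> \<in> carrier (Ginf)" "\<psi> \<in> carrier (Ginf)"
    and "\<And>n. \<phi> (\<zeta> n) = \<psi> (\<zeta> n)" "\<And>n. \<phi> (\<pi> n) = \<psi> (\<pi> n)"
  shows "\<phi> = \<psi>"
proof (rule extensionalityI)
  note D = galois_groupD[OF subring_Linf assms(1)] galois_groupD[OF subring_Linf assms(2)]
  show "\<phi> \<in> extensional Linf" "\<psi> \<in> extensional Linf" using D by blast+
  fix x assume "x \<in> Linf"
  then obtain n where "x \<in> L n" by (auto simp: Linf_def)
  then show "\<phi> x = \<psi> x"
    by (rule khom_eq_on_L[OF subring_Linf range_Linf L_Linf subring_Linf range_Linf L_Linf D(2) D(6) assms(3,4)])
qed

lemma \<zeta>\<pi>_Linf: "\<zeta> n \<in> Linf" "\<pi> n \<in> Linf" using \<zeta>_L \<pi>_L L_Linf by blast+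

definition \<sigma>n :: "nat \<Rightarrow> 'k alg_closure \<Rightarrow> 'k alg_closure" where "\<sigma>n n = restrict \<sigma>' (L n)"
definition \<tau>n :: "nat \<Rightarrow> 'k alg_closure \<Rightarrow> 'k alg_closure" where "\<tau>n n = restrict \<tau>' (L n)"

lemma \<sigma>n_galois: "\<sigma>n n \<in> carrier (GL n)" and \<tau>n_galois: "\<tau>n n \<in> carrier (GL n)"
  unfolding \<sigma>n_def \<tau>n_def by (rule restrict_galois \<sigma>'_galois \<tau>'_galois)+

lemma \<sigma>n_values: "\<sigma>n n (\<zeta> n) = \<zeta> n ^ q" "\<sigma>n n (\<pi> n) = \<pi> n"
  and \<tau>n_values: "\<tau>n n (\<zeta> n) = \<zeta> n" "\<tau>n n (\<pi> n) = \<zeta> n * \<pi> n"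
  using \<sigma>'_values \<tau>'_values \<zeta>_L \<pi>_L by (simp_all add: \<sigma>n_def \<tau>n_def)

lemma \<sigma>n_pow_values:
  "(\<sigma>n n [^]\<^bsub>GL n\<^esub> k) (\<zeta> n) = \<zeta> n ^ (q ^ k) \<and> (\<sigma>n n [^]\<^bsub>GL n\<^esub> k) (\<pi> n) = \<pi> n" for k :: nat
proof (induction k)
  case 0
  then show ?case using \<zeta>_L \<pi>_L by (simp add: galois_group_one)
next
  case (Suc k)
  interpret G: group "GL n" by (rule group_GL)
  let ?g = "\<sigma>n n [^]\<^bsub>GL n\<^esub> k"
  have g: "?g \<in> carrier (GL n)" using \<sigma>n_galois by simp
  have "?g (\<zeta> n ^ q) = ?g (\<zeta> n) ^ q"
    by (rule khom_power[OF galois_groupD(2)[OF subring_L g] subring_L \<zeta>_L])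
  then show ?case using Suc galois_group_mult_apply[OF subring_L g \<sigma>n_galois] \<zeta>_L \<pi>_L
    by (simp add: \<sigma>n_values power_mult[symmetric] mult.commute)
qed

lemma \<tau>n_nat_pow_values:
  "(\<tau>n n [^]\<^bsub>GL n\<^esub> k) (\<zeta> n) = \<zeta> n \<and> (\<tau>n n [^]\<^bsub>GL n\<^esub> k) (\<pi> n) = \<zeta> n ^ k * \<pi> n" for k :: nat
proof (induction k)
  case 0
  then show ?case using \<zeta>_L \<pi>_L by (simp add: galois_group_one)
next
  case (Suc k)
  interpret G: group "GL n" by (rule group_GL)
  let ?g = "\<tau>n n [^]\<^bsub>GL n\<^esub> k"
  have g: "?g \<in> carrier (GL n)" using \<tau>n_galois by simp
  have "?g (\<zeta> n * \<pi> n) = ?g (\<zeta> n) * ?g (\<pi> n)"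
    by (rule khomD(3)[OF galois_groupD(2)[OF subring_L g] \<zeta>_L \<pi>_L])
  then show ?case using Suc galois_group_mult_apply[OF subring_L g \<tau>n_galois] \<zeta>_L \<pi>_L
    by (simp add: \<tau>n_values mult.assoc)
qed

lemma \<tau>n_pow_values:
  fixes a :: int
  shows "(\<tau>n n [^]\<^bsub>GL n\<^esub> a) (\<zeta> n) = \<zeta> n" "(\<tau>n n [^]\<^bsub>GL n\<^esub> a) (\<pi> n) = \<zeta> n powi a * \<pi> n"
proof -
  interpret G: group "GL n" by (rule group_GL)
  have "(\<tau>n n [^]\<^bsub>GL n\<^esub> a) (\<zeta> n) = \<zeta> n \<and> (\<tau>n n [^]\<^bsub>GL n\<^esub> a) (\<pi> n) = \<zeta> n powi a * \<pi> n"
  proof (cases "a \<ge> 0")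
    case True
    then obtain k where "a = int k" by (metis nonneg_int_cases)
    then show ?thesis using \<tau>n_nat_pow_values[of n k] by (simp add: int_pow_int)
  next
    case False
    define k where "k = nat (- a)"
    have a: "a = - int k" using False by (simp add: k_def)
    let ?g = "\<tau>n n [^]\<^bsub>GL n\<^esub> k"
    let ?i = "inv\<^bsub>GL n\<^esub> ?g"
    have g: "?g \<in> carrier (GL n)" using \<tau>n_galois by simp
    note h = galois_groupD(2)[OF subring_L g]
    have ig: "?i (?g x) = x" if "x \<in> L n" for x
      using galois_group_mult_apply[OF subring_L G.inv_closed[OF g] g that] g that by (simp add: galois_group_one)
    have zk: "\<zeta> n ^ k \<in> L n" by (intro L_intros(9) \<zeta>_L)
    then have z: "inverse (\<zeta> n ^ k) \<in> L n" by (rule inverse_L)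
    have "?g (inverse (\<zeta> n ^ k)) = inverse (\<zeta> n ^ k)"
    proof -
      have "?g (\<zeta> n ^ k) = \<zeta> n ^ k" using khom_power[OF h subring_L \<zeta>_L] \<tau>n_nat_pow_values by simp
      then have "\<zeta> n ^ k * ?g (inverse (\<zeta> n ^ k)) = 1"
        using khomD(3)[OF h zk z] khomD(6)[OF h] by simp
      then show ?thesis by (metis inverse_unique)
    qed
    then have "?g (inverse (\<zeta> n ^ k) * \<pi> n) = \<pi> n"
      using khomD(3)[OF h z \<pi>_L] \<tau>n_nat_pow_values[of n k] by simp
    then have "?i (\<pi> n) = inverse (\<zeta> n ^ k) * \<pi> n" using ig[OF L_intros(4)[OF z \<pi>_L]] by simp
    moreover have "?i (\<zeta> n) = \<zeta> n" using ig[OF \<zeta>_L] \<tau>n_nat_pow_values[of n k] by simp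
    moreover have "\<tau>n n [^]\<^bsub>GL n\<^esub> a = ?i" unfolding a by (rule G.int_pow_neg_int[OF \<tau>n_galois])
    ultimately show ?thesis by (simp add: a power_int_minus)
  qed
  then show "(\<tau>n n [^]\<^bsub>GL n\<^esub> a) (\<zeta> n) = \<zeta> n" "(\<tau>n n [^]\<^bsub>GL n\<^esub> a) (\<pi> n) = \<zeta> n powi a * \<pi> n" by auto
qed

text \<open>Automorphisms of the union are determined by their values on all
  \<open>\<zeta> n\<close> and \<open>\<pi> n\<close>. Both \<sigma>\<tau> and \<tau>^q \<sigma>
  send \<open>\<zeta> n\<close> to its q-th power and \<open>\<pi> n\<close> to that power times
  \<open>\<pi> n\<close>.\<close>

lemma \<sigma>'\<tau>'_relation:
  "\<sigma>' \<otimes>\<^bsub>Ginf\<^esub> \<tau>' \<otimes>\<^bsub>Ginf\<^esub> inv\<^bsub>Ginf\<^esub> \<sigma>' = \<tau>' [^]\<^bsub>Ginf\<^esub> int q"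
proof -
  interpret G: group "Ginf" by (rule group_Ginf)
  note st = \<sigma>'_galois \<tau>'_galois
  have pow: "(\<tau>' [^]\<^bsub>Ginf\<^esub> k) (\<zeta> n) = \<zeta> n \<and> (\<tau>' [^]\<^bsub>Ginf\<^esub> k) (\<pi> n) = \<zeta> n ^ k * \<pi> n" for n and k :: nat
  proof -
    have "restrict (\<tau>' [^]\<^bsub>Ginf\<^esub> k) (L n) = \<tau>n n [^]\<^bsub>GL n\<^esub> k"
      unfolding \<tau>n_def by (rule hom_nat_pow[OF restrict_galois_hom st(2) group_Ginf group_GL])
    then show ?thesis using \<tau>n_nat_pow_values[of n k] \<zeta>_L[of n] \<pi>_L[of n] by (metis restrict_apply')
  qed
  have tq: "\<tau>' [^]\<^bsub>Ginf\<^esub> q \<in> carrier (Ginf)" using st by simp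
  have "\<sigma>' \<otimes>\<^bsub>Ginf\<^esub> \<tau>' = \<tau>' [^]\<^bsub>Ginf\<^esub> q \<otimes>\<^bsub>Ginf\<^esub> \<sigma>'"
  proof (rule galois_Linf_eqI)
    show "\<sigma>' \<otimes>\<^bsub>Ginf\<^esub> \<tau>' \<in> carrier (Ginf)"
      "\<tau>' [^]\<^bsub>Ginf\<^esub> q \<otimes>\<^bsub>Ginf\<^esub> \<sigma>' \<in> carrier (Ginf)" using st by simp_all
    fix n
    note a = galois_group_mult_apply[OF subring_Linf st \<zeta>\<pi>_Linf(1)] galois_group_mult_apply[OF subring_Linf st \<zeta>\<pi>_Linf(2)]
      galois_group_mult_apply[OF subring_Linf tq st(1) \<zeta>\<pi>_Linf(1)] galois_group_mult_apply[OF subring_Linf tq st(1) \<zeta>\<pi>_Linf(2)]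
    have "(\<tau>' [^]\<^bsub>Ginf\<^esub> q) (\<zeta> n ^ q) = \<zeta> n ^ q"
      using khom_power[OF galois_groupD(2)[OF subring_Linf tq] subring_Linf \<zeta>\<pi>_Linf(1)] pow by simp
    then show "(\<sigma>' \<otimes>\<^bsub>Ginf\<^esub> \<tau>') (\<zeta> n) = (\<tau>' [^]\<^bsub>Ginf\<^esub> q \<otimes>\<^bsub>Ginf\<^esub> \<sigma>') (\<zeta> n)"
      by (simp add: a \<sigma>'_values \<tau>'_values)
    have "\<sigma>' (\<zeta> n * \<pi> n) = \<zeta> n ^ q * \<pi> n"
      using khomD(3)[OF galois_groupD(2)[OF subring_Linf st(1)] \<zeta>\<pi>_Linf] by (simp add: \<sigma>'_values)
    then show "(\<sigma>' \<otimes>\<^bsub>Ginf\<^esub> \<tau>') (\<pi> n) = (\<tau>' [^]\<^bsub>Ginf\<^esub> q \<otimes>\<^bsub>Ginf\<^esub> \<sigma>') (\<pi> n)"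
      using pow by (simp add: a \<sigma>'_values \<tau>'_values)
  qed
  then show ?thesis using st by (simp add: G.m_assoc int_pow_int)
qed

text \<open>This applies both to \<open>BS q\<close> and to its presented finite quotients.\<close>

lemma nf_fixes:
  assumes bs: "bs_pair G t s q" and hom: "\<psi> \<in> hom G (GL n)"
    and \<psi>t: "\<psi> t = \<tau>n n" and \<psi>s: "\<psi> s = \<sigma>n n"
  shows "\<psi> (bs_pair.nf G t s k a l) (\<pi> n) = \<pi> n \<longleftrightarrow> int (d ^ n) dvd a"
    "\<psi> (bs_pair.nf G t s k a l) (\<zeta> n) = \<zeta> n \<longleftrightarrow> [k = l] (mod so n)"
proof -
  interpret bs_pair G t s q by (rule bs)
  interpret H: group "GL n" by (rule group_GL)
  interpret h: group_hom G "GL n" \<psi> by unfold_locales (rule hom)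
  let ?g = "\<psi> (nf k a l)" and ?S = "\<lambda>k :: nat. \<sigma>n n [^]\<^bsub>GL n\<^esub> k" and ?T = "\<tau>n n [^]\<^bsub>GL n\<^esub> a"
  have c: "?g \<in> carrier (GL n)" "?S k \<in> carrier (GL n)" "?S l \<in> carrier (GL n)"
    "?T \<in> carrier (GL n)" using \<sigma>n_galois \<tau>n_galois by simp_all
  \<comment> \<open>Moving the negative power of s to the other side leaves only nonnegative powers
    of \<sigma> to be evaluated.\<close>
  have "s [^]\<^bsub>G\<^esub> int k \<otimes>\<^bsub>G\<^esub> nf k a l = t [^]\<^bsub>G\<^esub> a \<otimes>\<^bsub>G\<^esub> s [^]\<^bsub>G\<^esub> int l"
    using bs_pair.t[OF bs] bs_pair.s[OF bs] unfolding nf_def by (simp add: m_assoc[symmetric] int_pow_mult[symmetric])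
  then have "?S k \<otimes>\<^bsub>GL n\<^esub> ?g = ?T \<otimes>\<^bsub>GL n\<^esub> ?S l"
  proof -
    note tc = bs_pair.t[OF bs] and sc = bs_pair.s[OF bs]
    assume "s [^]\<^bsub>G\<^esub> int k \<otimes>\<^bsub>G\<^esub> nf k a l = t [^]\<^bsub>G\<^esub> a \<otimes>\<^bsub>G\<^esub> s [^]\<^bsub>G\<^esub> int l"
    then have "\<psi> (s [^]\<^bsub>G\<^esub> int k \<otimes>\<^bsub>G\<^esub> nf k a l) = \<psi> (t [^]\<^bsub>G\<^esub> a \<otimes>\<^bsub>G\<^esub> s [^]\<^bsub>G\<^esub> int l)" by (simp only:)
    then have "\<psi> (s [^]\<^bsub>G\<^esub> int k) \<otimes>\<^bsub>GL n\<^esub> ?g = \<psi> (t [^]\<^bsub>G\<^esub> a) \<otimes>\<^bsub>GL n\<^esub> \<psi> (s [^]\<^bsub>G\<^esub> int l)"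
      using tc sc by (simp only: h.hom_mult nf_closed int_pow_closed)
    then show ?thesis
      by (simp only: int_pow_int h.hom_int_pow[OF tc] h.hom_nat_pow[OF sc] \<psi>s \<psi>t)
  qed
  then have key: "?S k (?g x) = ?T (?S l x)" if "x \<in> L n" for x
    using galois_group_mult_apply[OF subring_L c(2) c(1) that] galois_group_mult_apply[OF subring_L c(4) c(3) that] by simp
  have inj: "?S k x = ?S k y \<longleftrightarrow> x = y" if "x \<in> L n" "y \<in> L n" for x y
    using galois_groupD(3)[OF subring_L c(2)] that by (auto simp: bij_betw_def inj_on_def)
  have mem: "?g (\<pi> n) \<in> L n" "?g (\<zeta> n) \<in> L n"
    using khomD(1)[OF galois_groupD(2)[OF subring_L c(1)]] \<pi>_L \<zeta>_L by auto
  have "?g (\<pi> n) = \<pi> n \<longleftrightarrow> ?S k (?g (\<pi> n)) = ?S k (\<pi> n)" using inj mem \<pi>_L by simp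
  also have "\<dots> \<longleftrightarrow> \<zeta> n powi a * \<pi> n = \<pi> n" using key[OF \<pi>_L] \<sigma>n_pow_values \<tau>n_pow_values by simp
  finally show "?g (\<pi> n) = \<pi> n \<longleftrightarrow> int (d ^ n) dvd a" by (simp add: \<zeta>_powi_eq_1)
  have "?T (\<zeta> n ^ (q ^ l)) = \<zeta> n ^ (q ^ l)"
    using khom_power[OF galois_groupD(2)[OF subring_L c(4)] subring_L \<zeta>_L] \<tau>n_pow_values by simp
  then have "?S k (?g (\<zeta> n)) = \<zeta> n ^ (q ^ l)" using key[OF \<zeta>_L] \<sigma>n_pow_values by simp
  moreover have "?g (\<zeta> n) = \<zeta> n \<longleftrightarrow> ?S k (?g (\<zeta> n)) = ?S k (\<zeta> n)" using inj mem \<zeta>_L by simp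
  ultimately show "?g (\<zeta> n) = \<zeta> n \<longleftrightarrow> [k = l] (mod so n)"
    using \<zeta>_frob_power_eq[of n k l] \<sigma>n_pow_values by (metis)
qed

text \<open>An automorphism raises \<zeta> to some power q^i and multiplies \<pi> by some \<zeta>^a,
  so it equals \<tau>^a \<sigma>^i.\<close>

lemma galois_L_generated:
  assumes bs: "bs_pair G t s q" and hom: "\<psi> \<in> hom G (GL n)"
    and \<psi>t: "\<psi> t = \<tau>n n" and \<psi>s: "\<psi> s = \<sigma>n n"
  shows "\<psi> ` carrier G = carrier (GL n)"
proof
  interpret bs_pair G t s q by (rule bs)
  interpret H: group "GL n" by (rule group_GL)
  interpret h: group_hom G "GL n" \<psi> by unfold_locales (rule hom)
  show "\<psi> ` carrier G \<subseteq> carrier (GL n)" by auto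
  show "carrier (GL n) \<subseteq> \<psi> ` carrier G"
  proof
    fix \<phi> assume \<phi>: "\<phi> \<in> carrier (GL n)"
    note h = galois_groupD(2)[OF subring_L \<phi>]
    obtain i where i: "\<phi> (\<zeta> n) = \<zeta> n ^ (q ^ i)" using galois_frobenius[OF h] by blast
    obtain a where a: "\<phi> (\<pi> n) = \<zeta> n ^ a * \<pi> n" using galois_values[OF subring_L h \<zeta>_L \<pi>_L] by blast
    let ?S = "\<sigma>n n [^]\<^bsub>GL n\<^esub> i" and ?T = "\<tau>n n [^]\<^bsub>GL n\<^esub> a"
    have c: "?S \<in> carrier (GL n)" "?T \<in> carrier (GL n)" using \<sigma>n_galois \<tau>n_galois by simp_all
    have TS: "(?T \<otimes>\<^bsub>GL n\<^esub> ?S) x = ?T (?S x)" if "x \<in> L n" for x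
      by (rule galois_group_mult_apply[OF subring_L c(2) c(1) that])
    have "?T (\<zeta> n ^ (q ^ i)) = \<zeta> n ^ (q ^ i)"
      using khom_power[OF galois_groupD(2)[OF subring_L c(2)] subring_L \<zeta>_L] \<tau>n_nat_pow_values by simp
    then have "\<phi> = ?T \<otimes>\<^bsub>GL n\<^esub> ?S"
      using c by (intro galois_L_eqI[where n = n] \<phi> H.m_closed)
        (simp_all add: TS \<zeta>_L \<pi>_L i a \<sigma>n_pow_values \<tau>n_nat_pow_values)
    also have "\<dots> = \<psi> (t [^]\<^bsub>G\<^esub> a \<otimes>\<^bsub>G\<^esub> s [^]\<^bsub>G\<^esub> i)"
      using bs_pair.t[OF bs] bs_pair.s[OF bs] by (simp add: h.hom_mult h.hom_nat_pow \<psi>s \<psi>t)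
    finally show "\<phi> \<in> \<psi> ` carrier G" using bs_pair.t[OF bs] bs_pair.s[OF bs] by blast
  qed
qed

lemma galois_L_one_iff:
  assumes "\<phi> \<in> carrier (GL n)"
  shows "\<phi> = \<one>\<^bsub>GL n\<^esub> \<longleftrightarrow> \<phi> (\<zeta> n) = \<zeta> n \<and> \<phi> (\<pi> n) = \<pi> n"
proof -
  interpret H: group "GL n" by (rule group_GL)
  show ?thesis
    using galois_L_eqI[OF assms H.one_closed] \<zeta>_L \<pi>_L by (auto simp: galois_group_one)
qed

end

section \<open>Actions on the tree and on its boundary\<close>

lemma (in group) int_pow_dvd_one:
  assumes "x \<in> carrier G" "x [^] (N :: int) = \<one>" "N dvd a" shows "x [^] a = \<one>"
proof -
  from assms(3) obtain b where "a = N * b" by blast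
  then have "x [^] a = (x [^] N) [^] b" using assms(1) by (simp add: int_pow_pow)
  then show ?thesis by (simp add: assms(2))
qed

lemma group_actionI:
  assumes G: "group G"
    and closed: "\<And>g x. g \<in> carrier G \<Longrightarrow> x \<in> E \<Longrightarrow> \<phi> g x \<in> E"
    and ext: "\<And>g. g \<in> carrier G \<Longrightarrow> \<phi> g \<in> extensional E"
    and mult: "\<And>g h x. g \<in> carrier G \<Longrightarrow> h \<in> carrier G \<Longrightarrow> x \<in> E \<Longrightarrow> \<phi> (g \<otimes>\<^bsub>G\<^esub> h) x = \<phi> g (\<phi> h x)"
    and one: "\<And>x. x \<in> E \<Longrightarrow> \<phi> \<one>\<^bsub>G\<^esub> x = x"
  shows "group_action G E \<phi>"
proof -
  interpret group G by (rule G)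
  have Bij: "\<phi> g \<in> Bij E" if g: "g \<in> carrier G" for g
  proof -
    have "bij_betw (\<phi> g) E E"
      by (rule bij_betw_byWitness[where f' = "\<phi> (inv\<^bsub>G\<^esub> g)"])
        (use g closed one mult[of g "inv\<^bsub>G\<^esub> g"] mult[of "inv\<^bsub>G\<^esub> g" g] in auto)
    then show ?thesis using ext[OF g] by (simp add: Bij_def)
  qed
  have "\<phi> \<in> hom G (BijGroup E)"
  proof (rule homI)
    fix g h assume gh: "g \<in> carrier G" "h \<in> carrier G"
    have "\<phi> (g \<otimes>\<^bsub>G\<^esub> h) = compose E (\<phi> g) (\<phi> h)"
      by (rule extensionalityI[OF ext compose_extensional]) (use gh mult in \<open>auto simp: compose_def\<close>)
    then show "\<phi> (g \<otimes>\<^bsub>G\<^esub> h) = \<phi> g \<otimes>\<^bsub>BijGroup E\<^esub> \<phi> h" using Bij gh by (simp add: BijGroup_def)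
  qed (simp add: Bij BijGroup_def)
  then show ?thesis
    unfolding group_action_def group_hom_def group_hom_axioms_def using G group_BijGroup by blast
qed

lemma group_action_Bij: "group_action G E \<phi> \<Longrightarrow> g \<in> carrier G \<Longrightarrow> \<phi> g \<in> Bij E"
  using group_action.group_hom[of G E \<phi>] group_hom.hom_closed by (fastforce simp: BijGroup_def)

context kummer_tower
begin

section \<open>The iterates of f and their roots\<close>

abbreviation ff :: "'k poly" where "ff \<equiv> [:of_nat p, 1:] ^ d - [:of_nat p:]"

lemma ac_map_ff: "ac_map ff x = (x + pp) ^ d - pp"
  by (simp add: ac_map_def add.commute)

lemma ac_map_ff_iter: "(ac_map ff ^^ n) x = (x + pp) ^ (d ^ n) - pp"
  by (induction n) (simp_all add: ac_map_ff power_mult[symmetric] mult.commute)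

text \<open>For P = (X + p)^N - p the combination (X + p) P' - N P is the nonzero constant N p, so P
  is separable. Hence all roots lie in the separable closure.\<close>

lemma preims_iff: "x \<in> preims ff n \<longleftrightarrow> (x + pp) ^ (d ^ n) = pp"
proof -
  have "x \<in> sep_closure" if x: "(x + pp) ^ (d ^ n) = pp"
  proof -
    define N where "N = d ^ n"
    define P :: "'k poly" where "P = [:of_nat p, 1:] ^ N - [:of_nat p:]"
    have N0: "N > 0" using d_pos(2) by (simp add: N_def)
    have der: "pderiv P = Polynomial.smult (of_nat N) ([:of_nat p, 1:] ^ (N - 1))"
      unfolding P_def by (simp add: pderiv_diff pderiv_power pderiv_pCons)
    have "[:of_nat p, 1:] * pderiv P = Polynomial.smult (of_nat N) ([:of_nat p, 1:] ^ N)"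
      unfolding der using N0 by (simp flip: power_Suc)
    then have eq: "[:of_nat p, 1:] * pderiv P - [:of_nat N:] * P = [:of_nat N * of_nat p:]"
      by (simp add: P_def smult_diff_right)
    have "coprime P (pderiv P)"
    proof (rule coprimeI)
      fix c assume "c dvd P" "c dvd pderiv P"
      then have "c dvd [:of_nat N * of_nat p:]" unfolding eq[symmetric] by (intro dvd_diff dvd_mult)
      moreover have "[:of_nat N * of_nat p :: 'k:] dvd 1" using N0 by (simp add: is_unit_pCons_iff)
      ultimately show "c dvd 1" by (rule dvd_trans)
    qed
    moreover have "P \<noteq> 0" using eq N0 by auto
    moreover have "poly (map_poly to_ac P) x = 0" using x by (simp add: P_def N_def add.commute)
    ultimately show ?thesis unfolding sep_closure_def by blast
  qed
  then show ?thesis unfolding preims_def ac_map_ff_iter by auto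
qed

lemma preims_L: "preims ff n \<subseteq> L n"
proof
  fix x assume "x \<in> preims ff n"
  then obtain a where a: "x + pp = \<zeta> n ^ a * \<pi> n" using kummer_is_power by (auto simp: preims_iff)
  have "\<zeta> n ^ a * \<pi> n - pp \<in> L n"
    by (intro L_intros(4,6) L_intros(9) \<zeta>_L \<pi>_L subring_set_of_nat[OF subring_L])
  moreover have "x = \<zeta> n ^ a * \<pi> n - pp" using a by (simp add: eq_diff_eq)
  ultimately show "x \<in> L n" by simp
qed

lemma preims_Linf: "preims ff n \<subseteq> Linf" using preims_L L_Linf by blast

text \<open>Adding p to preimages gives \<open>\<pi> n\<close> and
  \<open>\<zeta> n * \<pi> n\<close>, and their quotient recovers \<open>\<zeta> n\<close>; so the
  field generated by the preimages contains both generators of \<open>L n\<close>.\<close>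

lemma preim_field_eq: "preim_field ff n = L n"
proof
  let ?R = "ring_of_type_algebra :: 'k alg_closure ring"
  show "preim_field ff n \<subseteq> L n"
  proof
    fix x assume "x \<in> preim_field ff n"
    then show "x \<in> L n" unfolding preim_field_def
    proof (induction rule: generate_field.induct)
      case (incl h) then show ?case using range_L preims_L by blast
    next
      case (m_inv h) then show ?case using inverse_L by simp
    qed (auto intro: L_intros)
  qed
  let ?F = "preim_field ff n"
  have one: "1 \<in> ?F" and minus: "x \<in> ?F \<Longrightarrow> - x \<in> ?F" and add: "x \<in> ?F \<Longrightarrow> y \<in> ?F \<Longrightarrow> x + y \<in> ?F"
    and mult: "x \<in> ?F \<Longrightarrow> y \<in> ?F \<Longrightarrow> x * y \<in> ?F" for x y
    using generate_field.one[of ?R] generate_field.a_inv[of x ?R] generate_field.eng_add[of x ?R _ y]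
      generate_field.eng_mult[of x ?R _ y] unfolding preim_field_def by auto
  have inv: "inverse x \<in> ?F" if "x \<in> ?F" "x \<noteq> 0" for x
    using generate_field.m_inv[of x ?R] that unfolding preim_field_def by simp
  have zero: "0 \<in> ?F" using add[OF one minus[OF one]] by simp
  have S: "subring_set ?F" unfolding subring_set_def using one zero minus add mult by blast
  have K: "range to_ac \<subseteq> ?F" unfolding preim_field_def by (auto intro: generate_field.incl)
  have V: "preims ff n \<subseteq> ?F" unfolding preim_field_def by (auto intro: generate_field.incl)
  have V': "x \<in> ?F" if "x ^ (d ^ n) = pp" for x
  proof -
    have "x - pp \<in> preims ff n" using that by (simp add: preims_iff)
    then have "x - pp \<in> ?F" using V by blast
    from add[OF this subring_set_of_nat[OF S]] have "(x - pp) + pp \<in> ?F" .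
    then show ?thesis by simp
  qed
  have p: "\<pi> n \<in> ?F" "\<zeta> n * \<pi> n \<in> ?F"
    by (rule V'; simp add: \<pi>_root \<zeta>_root power_mult_distrib)+
  have "\<zeta> n * \<pi> n * inverse (\<pi> n) \<in> ?F" by (rule mult[OF p(2) inv[OF p(1) \<pi>_nz]])
  then have "\<zeta> n \<in> ?F" by (simp add: mult.assoc)
  then show "L n \<subseteq> ?F" unfolding L_def using ev_in_subring[OF S K _ p(1)] by blast
qed

lemma iter_galois_eq: "iter_galois ff n = GL n"
  by (simp add: iter_galois_def preim_field_eq)

text \<open>The homomorphism that the universal property attaches to the relation between
  \<open>\<sigma>'\<close> and \<open>\<tau>'\<close>. \<open>\<Theta>\<close> below is its family
  of restrictions to the levels.\<close>

definition \<Gamma> :: "bs_gen word set \<Rightarrow> 'k alg_closure \<Rightarrow> 'k alg_closure" where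
  "\<Gamma> = pres_lift (Ginf) (case_bs_gen \<sigma>' \<tau>')"

definition \<Theta> :: "bs_gen word set \<Rightarrow> nat \<Rightarrow> 'k alg_closure \<Rightarrow> 'k alg_closure" where
  "\<Theta> g n = restrict (\<Gamma> g) (L n)"

abbreviation B where "B \<equiv> BS q"
abbreviation bt where "bt \<equiv> bs_tau q"
abbreviation bs where "bs \<equiv> bs_sigma q"

lemma group_B: "group B"
  unfolding BS_def by (rule group_presented_group)

lemma \<Gamma>_hom: "\<Gamma> \<in> hom B (Ginf)" and \<Gamma>_gens: "\<Gamma> bt = \<tau>'" "\<Gamma> bs = \<sigma>'"
proof -
  interpret G: group "Ginf" by (rule group_Ginf)
  have r: "range (case_bs_gen \<sigma>' \<tau>') \<subseteq> carrier (Ginf)"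
    using \<sigma>'_galois \<tau>'_galois by (auto split: bs_gen.split)
  have "word_eval (Ginf) (case_bs_gen \<sigma>' \<tau>') [(GSigma, True), (GTau, True), (GSigma, False)]
    = word_eval (Ginf) (case_bs_gen \<sigma>' \<tau>') (word_pow GTau (int q))"
    using \<sigma>'\<tau>'_relation \<sigma>'_galois \<tau>'_galois
    unfolding G.word_eval_pow[OF r] by (simp add: word_eval_def G.m_assoc)
  then have rel: "word_eval (Ginf) (case_bs_gen \<sigma>' \<tau>') u = word_eval (Ginf) (case_bs_gen \<sigma>' \<tau>') w"
    if "(u, w) \<in> bs_rels q" for u w using that by (auto simp: bs_rels_def)
  show "\<Gamma> \<in> hom B (Ginf)" unfolding \<Gamma>_def BS_def by (rule G.pres_lift_hom(1)[OF r rel])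
  show "\<Gamma> bt = \<tau>'" "\<Gamma> bs = \<sigma>'"
    unfolding \<Gamma>_def bs_tau_def bs_sigma_def using G.pres_lift_hom(2)[OF r rel] by simp_all
qed

lemma bsp: "bs_pair B bt bs q"
  unfolding BS_def bs_tau_def bs_sigma_def by (rule bs_pair_presented) simp

lemma B_nf: "g \<in> carrier B \<Longrightarrow> \<exists>k a l. g = bs_pair.nf B bt bs k a l"
  unfolding BS_def bs_tau_def bs_sigma_def by (rule presented_bs_nf[of q]) simp_all

lemma \<Gamma>_galois: "g \<in> carrier B \<Longrightarrow> \<Gamma> g \<in> carrier (Ginf)"
  by (rule hom_in_carrier[OF \<Gamma>_hom])

lemma \<Gamma>_khom: "g \<in> carrier B \<Longrightarrow> khom Linf (\<Gamma> g)"
  using galois_groupD(2)[OF subring_Linf \<Gamma>_galois] .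

lemma \<Gamma>_mult: "g \<in> carrier B \<Longrightarrow> h \<in> carrier B \<Longrightarrow> x \<in> Linf \<Longrightarrow> \<Gamma> (g \<otimes>\<^bsub>B\<^esub> h) x = \<Gamma> g (\<Gamma> h x)"
  using galois_group_mult_apply[OF subring_Linf \<Gamma>_galois \<Gamma>_galois] hom_mult[OF \<Gamma>_hom] by simp

lemma \<Gamma>_one: "x \<in> Linf \<Longrightarrow> \<Gamma> \<one>\<^bsub>B\<^esub> x = x"
  using hom_one[OF \<Gamma>_hom group_B group_Ginf] by (simp add: galois_group_one)

lemma \<Gamma>_inv:
  assumes "g \<in> carrier B" "x \<in> Linf"
  shows "\<Gamma> (inv\<^bsub>B\<^esub> g) (\<Gamma> g x) = x" "\<Gamma> g (\<Gamma> (inv\<^bsub>B\<^esub> g) x) = x"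
proof -
  interpret B: group B by (rule group_B)
  show "\<Gamma> (inv\<^bsub>B\<^esub> g) (\<Gamma> g x) = x" "\<Gamma> g (\<Gamma> (inv\<^bsub>B\<^esub> g) x) = x"
    using \<Gamma>_mult[of "inv\<^bsub>B\<^esub> g" g x] \<Gamma>_mult[of g "inv\<^bsub>B\<^esub> g" x] \<Gamma>_one assms by simp_all
qed

lemma \<Theta>_hom: "(\<lambda>g. \<Theta> g n) \<in> hom B (GL n)"
  using hom_compose[OF \<Gamma>_hom restrict_galois_hom[of n]] by (simp add: comp_def \<Theta>_def)

lemma \<Theta>_gens: "\<Theta> bt n = \<tau>n n" "\<Theta> bs n = \<sigma>n n"
  by (simp_all add: \<Theta>_def \<Gamma>_gens \<tau>n_def \<sigma>n_def)

lemmas \<Theta>_fixes = nf_fixes[OF bsp \<Theta>_hom \<Theta>_gens]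

lemma \<Theta>_onto: "(\<lambda>g. \<Theta> g n) ` carrier B = carrier (GL n)"
  by (rule galois_L_generated[OF bsp \<Theta>_hom \<Theta>_gens])

subsection \<open>The finite quotients\<close>

text \<open>The factor 1 is the constant c_n.\<close>

definition quot_rels where "quot_rels n = bs_quot_rels q (1 * int (d ^ n)) (int (so n))"

definition \<phi> :: "nat \<Rightarrow> bs_gen word set \<Rightarrow> 'k alg_closure \<Rightarrow> 'k alg_closure" where
  "\<phi> n = pres_lift (GL n) (case_bs_gen (\<sigma>n n) (\<tau>n n))"

lemma \<tau>n_order: "\<tau>n n [^]\<^bsub>GL n\<^esub> int (d ^ n) = \<one>\<^bsub>GL n\<^esub>"
proof -
  interpret G: group "GL n" by (rule group_GL)
  have "\<zeta> n powi int (d ^ n) = 1" by (subst \<zeta>_powi_eq_1) simp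
  then show ?thesis using \<tau>n_galois \<tau>n_pow_values[of n "int (d ^ n)"] by (subst galois_L_one_iff) simp_all
qed

lemma \<sigma>n_order: "\<sigma>n n [^]\<^bsub>GL n\<^esub> int (so n) = \<one>\<^bsub>GL n\<^esub>"
proof -
  interpret G: group "GL n" by (rule group_GL)
  have "\<zeta> n ^ (q ^ so n) = \<zeta> n ^ (q ^ 0)" by (subst \<zeta>_frob_power_eq) (simp add: cong_def)
  then show ?thesis using \<sigma>n_galois \<sigma>n_pow_values[of n "so n"]
    by (subst galois_L_one_iff) (simp_all add: int_pow_int)
qed

lemma \<phi>_hom: "\<phi> n \<in> hom (presented_group (quot_rels n)) (GL n)"
  and \<phi>_gens: "\<phi> n (pres_gen (quot_rels n) GTau) = \<tau>n n" "\<phi> n (pres_gen (quot_rels n) GSigma) = \<sigma>n n"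
proof -
  interpret G: group "GL n" by (rule group_GL)
  let ?h = "case_bs_gen (\<sigma>n n) (\<tau>n n)"
  have r: "range ?h \<subseteq> carrier (GL n)"
    using \<sigma>n_galois \<tau>n_galois by (auto split: bs_gen.split)
  have "\<sigma>n n \<otimes>\<^bsub>GL n\<^esub> \<tau>n n \<otimes>\<^bsub>GL n\<^esub> inv\<^bsub>GL n\<^esub> \<sigma>n n = \<tau>n n [^]\<^bsub>GL n\<^esub> int q"
  proof -
    interpret h: group_hom B "GL n" "\<lambda>g. \<Theta> g n"
      by (rule group_hom.intro[OF group_B group_GL]) (rule group_hom_axioms.intro[OF \<Theta>_hom])
    note c = bs_pair.t[OF bsp] bs_pair.s[OF bsp]
    show ?thesis using arg_cong[OF bs_pair.rel[OF bsp], of "\<lambda>g. \<Theta> g n"] c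
      by (simp add: h.hom_int_pow \<Theta>_gens)
  qed
  then have "word_eval (GL n) ?h u = word_eval (GL n) ?h w"
    if "(u, w) \<in> bs_rels q" for u w
    using that \<sigma>n_galois[of n] \<tau>n_galois[of n] G.word_eval_pow[OF r]
    by (auto simp: bs_rels_def) (simp add: word_eval_def G.m_assoc)
  moreover have "word_eval (GL n) ?h [] = \<one>\<^bsub>GL n\<^esub>" by (simp add: word_eval_def)
  ultimately have rel: "word_eval (GL n) ?h u = word_eval (GL n) ?h w"
    if "(u, w) \<in> quot_rels n" for u w
    using that \<tau>n_order[of n] \<sigma>n_order[of n] G.word_eval_pow[OF r]
    by (auto simp: quot_rels_def bs_quot_rels_def)
  show "\<phi> n \<in> hom (presented_group (quot_rels n)) (GL n)"
    unfolding \<phi>_def by (rule G.pres_lift_hom(1)[OF r rel])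
  show "\<phi> n (pres_gen (quot_rels n) GTau) = \<tau>n n" "\<phi> n (pres_gen (quot_rels n) GSigma) = \<sigma>n n"
    unfolding \<phi>_def using G.pres_lift_hom(2)[OF r rel] by simp_all
qed

lemma quot_rels_sub: "bs_rels q \<subseteq> quot_rels n" by (auto simp: quot_rels_def bs_quot_rels_def)

text \<open>A kernel element s^(-k) t^a s^l fixes \<pi> and \<zeta>, so d^n divides a, and k and l
  agree modulo \<open>so n\<close>. The two added relations then make it trivial.\<close>

lemma \<phi>_iso: "\<phi> n \<in> iso (presented_group (quot_rels n)) (GL n)"
proof -
  let ?P = "presented_group (quot_rels n)" and ?t = "pres_gen (quot_rels n) GTau" and ?s = "pres_gen (quot_rels n) GSigma"
  have bp: "bs_pair ?P ?t ?s q" by (rule bs_pair_presented[OF quot_rels_sub])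
  interpret bs_pair ?P ?t ?s q by (rule bp)
  interpret h: group_hom ?P "GL n" "\<phi> n"
    by (rule group_hom.intro[OF is_group group_GL]) (rule group_hom_axioms.intro[OF \<phi>_hom])
  have pow1: "pres_gen (quot_rels n) g [^]\<^bsub>?P\<^esub> k = \<one>\<^bsub>?P\<^esub>" if "(word_pow g k, []) \<in> quot_rels n" for g k
    using pres_cong.cong_rel[OF that] by (simp add: pres_class_pow[symmetric] presented_group_simps pres_class_eq_iff)
  have t1: "?t [^]\<^bsub>?P\<^esub> int (d ^ n) = \<one>\<^bsub>?P\<^esub>" and s1: "?s [^]\<^bsub>?P\<^esub> int (so n) = \<one>\<^bsub>?P\<^esub>"
    by (rule pow1; simp add: quot_rels_def bs_quot_rels_def)+
  have "x = \<one>\<^bsub>?P\<^esub>" if x: "x \<in> carrier ?P" "\<phi> n x = \<one>\<^bsub>GL n\<^esub>" for x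
  proof -
    obtain k a l where nf: "x = nf k a l" using presented_bs_nf[OF quot_rels_sub x(1)] by blast
    have "\<phi> n (nf k a l) (\<pi> n) = \<pi> n" "\<phi> n (nf k a l) (\<zeta> n) = \<zeta> n"
      using x(2) \<zeta>_L \<pi>_L unfolding nf by (simp_all add: galois_group_one)
    then have a: "int (d ^ n) dvd a" and kl: "[k = l] (mod so n)"
      using nf_fixes[OF bp \<phi>_hom \<phi>_gens] by auto
    have "[int k = int l] (mod int (so n))" using kl by (simp add: cong_int_iff)
    then have "int (so n) dvd - int k + int l" by (metis cong_iff_dvd_diff cong_sym uminus_add_conv_diff)
    then have "?s [^]\<^bsub>?P\<^esub> (- int k + int l) = \<one>\<^bsub>?P\<^esub>" by (rule int_pow_dvd_one[OF s s1])
    moreover have "?t [^]\<^bsub>?P\<^esub> a = \<one>\<^bsub>?P\<^esub>" by (rule int_pow_dvd_one[OF t t1 a])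
    ultimately show ?thesis unfolding nf nf_def using s by (simp only: int_pow_mult r_one int_pow_closed)
  qed
  then have "inj_on (\<phi> n) (carrier ?P)"
    by (subst h.inj_on_one_iff) blast
  moreover have "\<phi> n ` carrier ?P = carrier (GL n)"
    by (rule galois_L_generated[OF bp \<phi>_hom \<phi>_gens])
  ultimately show ?thesis using \<phi>_hom by (auto simp: iso_def bij_betw_def)
qed

definition C where "C n = generate B {bt [^]\<^bsub>B\<^esub> (1 * int (d ^ n)), bs [^]\<^bsub>B\<^esub> int (so n)}"

text \<open>\<open>C n\<close> is a generated subgroup, not a normal closure; that it is
  nevertheless normal comes from identifying it with a kernel. So kernel elements have to be written
  as products of powers of the two generators, without conjugates.\<close>

lemma kernel_\<Theta>: "kernel B (GL n) (\<lambda>g. \<Theta> g n) = C n"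
proof
  interpret bs_pair B bt bs q by (rule bsp)
  interpret h: group_hom B "GL n" "\<lambda>g. \<Theta> g n"
    by (rule group_hom.intro[OF is_group group_GL]) (rule group_hom_axioms.intro[OF \<Theta>_hom])
  let ?K = "kernel B (GL n) (\<lambda>g. \<Theta> g n)"
  have gens: "{bt [^]\<^bsub>B\<^esub> (1 * int (d ^ n)), bs [^]\<^bsub>B\<^esub> int (so n)} \<subseteq> ?K"
    using t s \<tau>n_order \<sigma>n_order by (auto simp: kernel_def h.hom_int_pow \<Theta>_gens)
  show "C n \<subseteq> ?K" unfolding C_def by (rule generate_subgroup_incl[OF gens h.subgroup_kernel])
  have subC: "subgroup (C n) B" unfolding C_def by (rule generate_is_subgroup) (use t s in auto)
  note Cm = subgroup.m_closed[OF subC]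
  have tC: "bt [^]\<^bsub>B\<^esub> int (d ^ n) \<in> C n" and sC: "bs [^]\<^bsub>B\<^esub> int (so n) \<in> C n"
    unfolding C_def by (auto intro: generate.incl)
  have multC: "x [^]\<^bsub>B\<^esub> a \<in> C n" if "x \<in> carrier B" "x [^]\<^bsub>B\<^esub> N \<in> C n" "N dvd a" for x and N a :: int
  proof -
    from that(3) obtain b where "a = N * b" by blast
    then have "x [^]\<^bsub>B\<^esub> a = (x [^]\<^bsub>B\<^esub> N) [^]\<^bsub>B\<^esub> b" using that(1) by (simp add: int_pow_pow)
    then show ?thesis using subgroup_int_pow_closed[OF subC that(2)] by simp
  qed
  show "?K \<subseteq> C n"
  proof
    fix x assume x: "x \<in> ?K"
    then have "x \<in> carrier B" by (simp add: kernel_def)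
    from B_nf[OF this] obtain k a l where nf: "x = nf k a l" by blast
    have "\<Theta> (nf k a l) n (\<pi> n) = \<pi> n" "\<Theta> (nf k a l) n (\<zeta> n) = \<zeta> n"
      using x \<zeta>_L \<pi>_L unfolding nf by (simp_all add: kernel_def galois_group_one)
    then have a: "int (d ^ n) dvd a" and kl: "[k = l] (mod so n)" using \<Theta>_fixes by auto
    define e where "e = so n * k"
    have ek: "e \<ge> k" using so_pos[of n] by (simp add: e_def Suc_leI)
    have kl': "int (so n) dvd - int k + int l"
      using kl by (metis cong_iff_dvd_diff cong_int_iff cong_sym uminus_add_conv_diff)
    text \<open>Conjugating by a power of \<open>\<sigma>\<^sup>s\<close> turns the negative exponent \<open>- k\<close> into a nonnegative one.\<close>
    have "x = bs [^]\<^bsub>B\<^esub> (- int e) \<otimes>\<^bsub>B\<^esub> (bs [^]\<^bsub>B\<^esub> int (e - k) \<otimes>\<^bsub>B\<^esub> bt [^]\<^bsub>B\<^esub> a) \<otimes>\<^bsub>B\<^esub> bs [^]\<^bsub>B\<^esub> int l"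
      unfolding nf nf_def using s t ek by (simp add: m_assoc[symmetric] int_pow_mult[symmetric])
    also have "\<dots> = bs [^]\<^bsub>B\<^esub> (- int e) \<otimes>\<^bsub>B\<^esub> bt [^]\<^bsub>B\<^esub> (int (q ^ (e - k)) * a) \<otimes>\<^bsub>B\<^esub> bs [^]\<^bsub>B\<^esub> (int (e - k) + int l)"
      unfolding s_pow_t_pow using s t by (simp add: m_assoc int_pow_mult)
    also have "\<dots> \<in> C n"
    proof (intro Cm)
      show "bs [^]\<^bsub>B\<^esub> (- int e) \<in> C n" by (rule multC[OF s sC]) (simp add: e_def)
      show "bt [^]\<^bsub>B\<^esub> (int (q ^ (e - k)) * a) \<in> C n" by (rule multC[OF t tC]) (use a in simp)
      have "int (e - k) + int l = int (so n) * int k + (- int k + int l)" using ek by (simp add: e_def of_nat_diff)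
      then have "int (so n) dvd int (e - k) + int l" using kl' by (metis dvd_add dvd_triv_left)
      then show "bs [^]\<^bsub>B\<^esub> (int (e - k) + int l) \<in> C n" by (rule multC[OF s sC])
    qed
    finally show "x \<in> C n" .
  qed
qed

lemma C_normal: "C n \<lhd> B"
  and C_quotient: "(\<lambda>A. the_elem ((\<lambda>g. \<Theta> g n) ` A)) \<in> iso (B Mod C n) (GL n)"
proof -
  interpret h: group_hom B "GL n" "\<lambda>g. \<Theta> g n"
    by (rule group_hom.intro[OF group_B group_GL]) (rule group_hom_axioms.intro[OF \<Theta>_hom])
  show "C n \<lhd> B" using h.normal_kernel by (simp add: kernel_\<Theta>)
  show "(\<lambda>A. the_elem ((\<lambda>g. \<Theta> g n) ` A)) \<in> iso (B Mod C n) (GL n)"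
    using h.FactGroup_iso_set[OF \<Theta>_onto] by (simp add: kernel_\<Theta>)
qed

lemma \<Theta>_arboreal: "\<Theta> \<in> hom B (arboreal_group ff)"
proof (rule homI)
  fix g assume g: "g \<in> carrier B"
  have "restrict (\<Theta> g (Suc j)) (L j) = \<Theta> g j" for j
    using L_mono[of j "Suc j"] by (auto simp: \<Theta>_def restrict_def fun_eq_iff)
  then show "\<Theta> g \<in> carrier (arboreal_group ff)"
    using hom_in_carrier[OF \<Theta>_hom g]
    by (simp add: arboreal_group_def inv_limit_def iter_galois_eq preim_field_eq PiE_UNIV_domain atLeast_0)
next
  fix g h assume gh: "g \<in> carrier B" "h \<in> carrier B"
  show "\<Theta> (g \<otimes>\<^bsub>B\<^esub> h) = \<Theta> g \<otimes>\<^bsub>arboreal_group ff\<^esub> \<Theta> h"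
    using hom_mult[OF \<Theta>_hom gh]
    by (simp add: arboreal_group_def inv_limit_def iter_galois_eq product_group_def fun_eq_iff)
qed

end

context kummer_tower
begin

section \<open>The actions on vertices, levels and paths\<close>

lemma preims_LinfD: "x \<in> preims ff n \<Longrightarrow> x \<in> Linf"
  using preims_Linf by blast

lemma tree_verts_Linf: "a \<in> tree_verts ff \<Longrightarrow> snd a \<in> Linf"
  by (auto simp: tree_verts_def intro: preims_LinfD)

lemma \<Gamma>_minus_p:
  assumes "g \<in> carrier B" "x \<in> Linf" shows "\<Gamma> g (x - pp) = \<Gamma> g x - pp"
proof -
  have "to_ac (- of_nat p) \<in> Linf" using range_Linf by blast
  then show ?thesis
    using khomD(2)[OF \<Gamma>_khom[OF assms(1)] assms(2), of "to_ac (- of_nat p)"] khomD(4)[OF \<Gamma>_khom[OF assms(1)], of "- of_nat p"] by simp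
qed

lemma \<Gamma>_ff: "g \<in> carrier B \<Longrightarrow> x \<in> Linf \<Longrightarrow> ac_map ff (\<Gamma> g x) = \<Gamma> g (ac_map ff x)"
proof -
  assume g: "g \<in> carrier B" and x: "x \<in> Linf"
  note h = \<Gamma>_khom[OF g] and S = subring_setD[OF subring_Linf]
  have pL: "pp \<in> Linf" "- pp \<in> Linf" using subring_set_of_nat[OF subring_Linf] S(5) by auto
  have xp: "x + pp \<in> Linf" "(x + pp) ^ d \<in> Linf" using x pL subring_set_power[OF subring_Linf] S(3) by auto
  have neg: "- pp = to_ac (- of_nat p)" by simp
  have "\<Gamma> g ((x + pp) ^ d + - pp) = (\<Gamma> g x + pp) ^ d + - pp"
    using khomD(2)[OF h xp(2) pL(2)] khom_power[OF h subring_Linf xp(1)] khomD(2)[OF h x pL(1)]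
      khomD(7)[OF h, of p] khomD(4)[OF h, of "- of_nat p"] by simp
  then show ?thesis unfolding ac_map_ff by simp
qed

lemma \<Gamma>_preims: "g \<in> carrier B \<Longrightarrow> x \<in> preims ff n \<Longrightarrow> \<Gamma> g x \<in> preims ff n"
proof -
  assume g: "g \<in> carrier B" and x: "x \<in> preims ff n"
  have xL: "x \<in> Linf" using x preims_Linf by blast
  note h = \<Gamma>_khom[OF g]
  have pL: "pp \<in> Linf" using subring_set_of_nat[OF subring_Linf] .
  have "(\<Gamma> g x + pp) ^ (d ^ n) = \<Gamma> g ((x + pp) ^ (d ^ n))"
    using khom_power[OF h subring_Linf subring_setD(3)[OF subring_Linf xL pL]] khomD(2)[OF h xL pL] khomD(7)[OF h, of p] by simp
  also have "\<dots> = pp" using x khomD(7)[OF h, of p] by (simp add: preims_iff)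
  finally show ?thesis by (simp add: preims_iff)
qed

lemma \<Theta>_preims: "x \<in> preims ff n \<Longrightarrow> \<Theta> g n x = \<Gamma> g x"
  using preims_L by (auto simp: \<Theta>_def)

lemma tree_act_apply:
  assumes "a \<in> tree_verts ff" shows "tree_act ff (\<Theta> g) a = (fst a, \<Gamma> g (snd a))"
  using assms \<Theta>_preims[of "snd a" "fst a" g] by (auto simp: tree_act_def tree_verts_def)

lemma tree_action: "group_action B (tree_verts ff) (\<lambda>g. tree_act ff (\<Theta> g))"
proof (rule group_actionI[OF group_B])
  fix g a assume g: "g \<in> carrier B" and a: "a \<in> tree_verts ff"
  show "tree_act ff (\<Theta> g) a \<in> tree_verts ff"
    unfolding tree_act_apply[OF a] using a \<Gamma>_preims[OF g] by (auto simp: tree_verts_def)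
next
  fix g h a assume g: "g \<in> carrier B" and h: "h \<in> carrier B" and a: "a \<in> tree_verts ff"
  have "tree_act ff (\<Theta> h) a \<in> tree_verts ff"
    unfolding tree_act_apply[OF a] using a \<Gamma>_preims[OF h] by (auto simp: tree_verts_def)
  moreover have "snd a \<in> Linf" by (rule tree_verts_Linf[OF a])
  ultimately show "tree_act ff (\<Theta> (g \<otimes>\<^bsub>B\<^esub> h)) a = tree_act ff (\<Theta> g) (tree_act ff (\<Theta> h) a)"
    using tree_act_apply[of "tree_act ff (\<Theta> h) a" g] by (simp add: tree_act_apply[OF a] \<Gamma>_mult[OF g h])
next
  fix a assume a: "a \<in> tree_verts ff"
  then have "snd a \<in> Linf" by (rule tree_verts_Linf)
  then show "tree_act ff (\<Theta> \<one>\<^bsub>B\<^esub>) a = a" by (simp add: tree_act_apply[OF a] \<Gamma>_one)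
qed (simp add: tree_act_def)

lemma tree_adj_\<Gamma>:
  assumes g: "g \<in> carrier B" and ab: "a \<in> tree_verts ff" "b \<in> tree_verts ff" and adj: "tree_adj ff a b"
  shows "tree_adj ff (tree_act ff (\<Theta> g) a) (tree_act ff (\<Theta> g) b)"
proof -
  have "snd a \<in> Linf" "snd b \<in> Linf" using ab tree_verts_Linf by blast+
  note f = this[THEN \<Gamma>_ff[OF g]]
  show ?thesis using adj unfolding tree_adj_def tree_act_apply[OF ab(1)] tree_act_apply[OF ab(2)]
    by (simp only: f fst_conv snd_conv) metis
qed

lemma tree_act_hom: "(\<lambda>g. tree_act ff (\<Theta> g)) \<in> hom B (tree_aut ff)"
proof -
  interpret act: group_action B "tree_verts ff" "\<lambda>g. tree_act ff (\<Theta> g)" by (rule tree_action)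
  interpret B: group B by (rule group_B)
  have hom: "(\<lambda>g. tree_act ff (\<Theta> g)) \<in> hom B (BijGroup (tree_verts ff))"
    using act.group_hom by (simp add: group_hom_def group_hom_axioms_def)
  show ?thesis
  proof (rule homI)
    fix g assume g: "g \<in> carrier B"
    have ig: "inv\<^bsub>B\<^esub> g \<in> carrier B" using g by simp
    \<comment> \<open>Preservation of adjacency by the inverse element turns the implication of
      \<open>tree_adj_\<Gamma>\<close> into an equivalence.\<close>
    have retract: "tree_act ff (\<Theta> (inv\<^bsub>B\<^esub> g)) (tree_act ff (\<Theta> g) a) = a" if "a \<in> tree_verts ff" for a
      using act.composition_rule[OF that ig g] tree_act_apply[OF that, of "\<one>\<^bsub>B\<^esub>"] \<Gamma>_one[OF tree_verts_Linf[OF that]] g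
      by simp
    have "tree_act ff (\<Theta> g) a \<in> tree_verts ff" if "a \<in> tree_verts ff" for a
      using act.element_image[OF g that] by simp
    then have "tree_adj ff (tree_act ff (\<Theta> g) a) (tree_act ff (\<Theta> g) b) \<longleftrightarrow> tree_adj ff a b"
      if "a \<in> tree_verts ff" "b \<in> tree_verts ff" for a b
      using tree_adj_\<Gamma>[OF g that] tree_adj_\<Gamma>[OF ig, of "tree_act ff (\<Theta> g) a" "tree_act ff (\<Theta> g) b"] retract that by metis
    moreover have "fst (tree_act ff (\<Theta> g) a) = fst a" if "a \<in> tree_verts ff" for a
      by (simp add: tree_act_apply[OF that])
    ultimately show "tree_act ff (\<Theta> g) \<in> carrier (tree_aut ff)"
      using group_action_Bij[OF tree_action g] by (simp add: tree_aut_def)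
  next
    fix g h assume "g \<in> carrier B" "h \<in> carrier B"
    then show "tree_act ff (\<Theta> (g \<otimes>\<^bsub>B\<^esub> h)) = tree_act ff (\<Theta> g) \<otimes>\<^bsub>tree_aut ff\<^esub> tree_act ff (\<Theta> h)"
      using hom_mult[OF hom] by (simp add: tree_aut_def BijGroup_def)
  qed
qed

text \<open>Powers of \<tau> alone reach every vertex of a level, since \<tau>^a multiplies
  \<open>\<pi> n\<close> by the a-th power of \<open>\<zeta> n\<close>.\<close>

lemma nf_preims_transitive:
  assumes x: "x \<in> preims ff n" shows "\<exists>a :: nat. x = \<Gamma> (bt [^]\<^bsub>B\<^esub> a) (\<pi> n - pp)"
proof -
  interpret bs_pair B bt bs q by (rule bsp)
  obtain a where a: "x + pp = \<zeta> n ^ a * \<pi> n" using kummer_is_power x by (auto simp: preims_iff)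
  let ?g = "bt [^]\<^bsub>B\<^esub> a"
  have g: "?g \<in> carrier B" using t by simp
  interpret h: group_hom B "GL n" "\<lambda>g. \<Theta> g n"
    by (rule group_hom.intro[OF group_B group_GL]) (rule group_hom_axioms.intro[OF \<Theta>_hom])
  have "\<Theta> ?g n (\<pi> n) = \<zeta> n ^ a * \<pi> n"
    using h.hom_nat_pow[OF t, of a] \<tau>n_nat_pow_values[of n a] by (simp add: \<Theta>_gens)
  then have "\<Gamma> ?g (\<pi> n) = \<zeta> n ^ a * \<pi> n" using \<pi>_L by (simp add: \<Theta>_def)
  then have "\<Gamma> ?g (\<pi> n - pp) + pp = x + pp" using a \<Gamma>_minus_p[OF g \<zeta>\<pi>_Linf(2), of n] by simp
  then have "\<Gamma> ?g (\<pi> n - pp) = x" by (simp only: add_right_cancel)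
  then show ?thesis by blast
qed

lemma level_action: "transitive_action B (preims ff n) (\<lambda>g. restrict (\<Theta> g n) (preims ff n))"
proof -
  interpret B: group B by (rule group_B)
  have val: "restrict (\<Theta> g n) (preims ff n) x = \<Gamma> g x" if "x \<in> preims ff n" for g x
    using \<Theta>_preims that by simp
  have act: "group_action B (preims ff n) (\<lambda>g. restrict (\<Theta> g n) (preims ff n))"
  proof (rule group_actionI[OF group_B])
    fix g h x assume "g \<in> carrier B" "h \<in> carrier B" "x \<in> preims ff n"
    then show "restrict (\<Theta> (g \<otimes>\<^bsub>B\<^esub> h) n) (preims ff n) x = restrict (\<Theta> g n) (preims ff n) (restrict (\<Theta> h n) (preims ff n) x)"
      using \<Gamma>_preims[of h x n] \<Gamma>_mult[of g h x] preims_LinfD[of x n] by (auto simp: val simp del: restrict_apply)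
  qed (use \<Gamma>_preims \<Gamma>_one preims_LinfD in \<open>auto simp: val simp del: restrict_apply\<close>)
  have "\<exists>g\<in>carrier B. restrict (\<Theta> g n) (preims ff n) x = y" if xy: "x \<in> preims ff n" "y \<in> preims ff n" for x y
  proof -
    let ?v = "\<pi> n - pp"
    have v: "?v \<in> Linf" by (rule preims_LinfD[of _ n]) (simp add: preims_iff \<pi>_root)
    obtain a b :: nat where ab: "x = \<Gamma> (bt [^]\<^bsub>B\<^esub> a) ?v" "y = \<Gamma> (bt [^]\<^bsub>B\<^esub> b) ?v"
      using nf_preims_transitive xy by metis
    have c: "bt [^]\<^bsub>B\<^esub> a \<in> carrier B" "bt [^]\<^bsub>B\<^esub> b \<in> carrier B" using bs_pair.t[OF bsp] by simp_all
    have xL: "x \<in> Linf" using xy preims_Linf by blast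
    have "\<Gamma> (bt [^]\<^bsub>B\<^esub> b \<otimes>\<^bsub>B\<^esub> inv\<^bsub>B\<^esub> (bt [^]\<^bsub>B\<^esub> a)) x = y"
      using \<Gamma>_mult[OF c(2) B.inv_closed[OF c(1)] xL] \<Gamma>_inv(1)[OF c(1) v] by (simp add: ab)
    then show ?thesis using c val[OF xy(1)]
      by (intro bexI[of _ "bt [^]\<^bsub>B\<^esub> b \<otimes>\<^bsub>B\<^esub> inv\<^bsub>B\<^esub> (bt [^]\<^bsub>B\<^esub> a)"]) auto
  qed
  then show ?thesis using act by (simp add: transitive_action_def transitive_action_axioms_def)
qed

lemma path_mem:
  assumes "v \<in> path_space ff" shows "v n \<in> preims ff n" "v n \<in> Linf" "ac_map ff (v (Suc n)) = v n"
  using assms preims_Linf by (auto simp: path_space_def tree_adj_def)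

lemma path_act_apply: "v \<in> path_space ff \<Longrightarrow> path_act ff (\<Theta> g) v = (\<lambda>n. \<Gamma> g (v n))"
  using \<Theta>_preims path_mem(1) by (auto simp: path_act_def)

lemma path_act_closed: "g \<in> carrier B \<Longrightarrow> v \<in> path_space ff \<Longrightarrow> path_act ff (\<Theta> g) v \<in> path_space ff"
proof -
  assume g: "g \<in> carrier B" and v: "v \<in> path_space ff"
  have "\<Gamma> g (v n) \<in> preims ff n \<and> tree_adj ff (n, \<Gamma> g (v n)) (Suc n, \<Gamma> g (v (Suc n)))" for n
    using \<Gamma>_preims[OF g path_mem(1)[OF v]] \<Gamma>_ff[OF g path_mem(2)[OF v, of "Suc n"]] path_mem(3)[OF v, of n]
    by (simp add: tree_adj_def)
  then show ?thesis unfolding path_act_apply[OF v] path_space_def by blast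
qed

lemma path_action: "group_action B (path_space ff) (\<lambda>g. path_act ff (\<Theta> g))"
proof (rule group_actionI[OF group_B path_act_closed])
  fix g h v assume "g \<in> carrier B" "h \<in> carrier B" "v \<in> path_space ff"
  then show "path_act ff (\<Theta> (g \<otimes>\<^bsub>B\<^esub> h)) v = path_act ff (\<Theta> g) (path_act ff (\<Theta> h) v)"
    using path_act_apply[OF path_act_closed[of h v], of g] by (simp add: path_act_apply \<Gamma>_mult path_mem)
next
  fix v assume "v \<in> path_space ff"
  then show "path_act ff (\<Theta> \<one>\<^bsub>B\<^esub>) v = v" by (simp add: path_act_apply \<Gamma>_one path_mem)
qed (simp_all add: path_act_def extensional_def)

text \<open>Each coordinate of the image path depends only on the same coordinate of the path, and
  the levels are discrete.\<close>

lemma path_act_continuous: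
  assumes g: "g \<in> carrier B"
  shows "continuous_map (path_topology ff) (path_topology ff) (path_act ff (\<Theta> g))"
proof -
  have ts: "topspace (path_topology ff) = path_space ff"
    unfolding path_topology_def by (auto simp: path_space_def)
  have proj: "continuous_map (path_topology ff) (discrete_topology (preims ff n)) (\<lambda>v. v n)" for n
    unfolding path_topology_def
    by (rule continuous_map_from_subtopology) (rule continuous_map_product_projection, simp)
  have "continuous_map (path_topology ff) (discrete_topology (preims ff n)) (\<lambda>v. path_act ff (\<Theta> g) v n)" for n
  proof (rule continuous_map_eq)
    have "continuous_map (discrete_topology (preims ff n)) (discrete_topology (preims ff n)) (\<Gamma> g)"
      using \<Gamma>_preims[OF g] by (simp add: continuous_map_from_discrete_topology)
    from continuous_map_compose[OF proj this]
    show "continuous_map (path_topology ff) (discrete_topology (preims ff n)) (\<Gamma> g \<circ> (\<lambda>v. v n))" .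
    show "(\<Gamma> g \<circ> (\<lambda>v. v n)) v = path_act ff (\<Theta> g) v n" if "v \<in> topspace (path_topology ff)" for v
      using path_act_apply that by (simp add: ts)
  qed
  then have "continuous_map (path_topology ff) (product_topology (\<lambda>n. discrete_topology (preims ff n)) UNIV) (path_act ff (\<Theta> g))"
    by (simp add: continuous_map_componentwise_UNIV)
  moreover have "path_act ff (\<Theta> g) \<in> topspace (path_topology ff) \<rightarrow> path_space ff"
    using path_act_closed[OF g] by (auto simp: ts)
  ultimately show ?thesis
    unfolding path_topology_def[of ff] using path_topology_def[of ff] continuous_map_into_subtopology by metis
qed

lemma path_act_homeomorphic:
  assumes g: "g \<in> carrier B"
  shows "homeomorphic_map (path_topology ff) (path_topology ff) (path_act ff (\<Theta> g))"
proof -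
  interpret B: group B by (rule group_B)
  have ts: "topspace (path_topology ff) = path_space ff"
    unfolding path_topology_def by (auto simp: path_space_def)
  have ig: "inv\<^bsub>B\<^esub> g \<in> carrier B" using g by simp
  have "homeomorphic_maps (path_topology ff) (path_topology ff) (path_act ff (\<Theta> g)) (path_act ff (\<Theta> (inv\<^bsub>B\<^esub> g)))"
    unfolding homeomorphic_maps_def ts
    using path_act_continuous[OF g] path_act_continuous[OF ig] path_act_closed[OF g] path_act_closed[OF ig]
    by (auto simp: path_act_apply \<Gamma>_inv[OF g] path_mem)
  then show ?thesis using homeomorphic_map_maps by blast
qed

subsection \<open>The group chain\<close>

definition v :: "nat \<Rightarrow> 'k alg_closure" where "v n = \<pi> n - pp"

lemma v_path: "v \<in> path_space ff"
  by (auto simp: path_space_def v_def preims_iff \<pi>_root tree_adj_def ac_map_ff \<pi>_Suc)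

abbreviation Gc where "Gc \<equiv> group_chain B (\<lambda>g. tree_act ff (\<Theta> g)) v"

lemma Gc_iff: "g \<in> Gc n \<longleftrightarrow> g \<in> carrier B \<and> \<Gamma> g (\<pi> n) = \<pi> n"
proof -
  have "(n, v n) \<in> tree_verts ff" using path_mem(1)[OF v_path] by (simp add: tree_verts_def)
  then show ?thesis
    using \<Gamma>_minus_p[of g "\<pi> n"] \<zeta>\<pi>_Linf
    by (auto simp: group_chain_def stabilizer_def tree_act_apply v_def)
qed

lemma Gc_nf: "bs_pair.nf B bt bs k a l \<in> Gc n \<longleftrightarrow> int (d ^ n) dvd a"
  using \<Theta>_fixes(1)[where n = n and k = k and a = a and l = l] \<pi>_L[of n] bs_pair.nf_closed[OF bsp] by (simp add: Gc_iff \<Theta>_def)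

lemma subgroup_Gc: "subgroup (Gc n) B"
proof -
  interpret B: group B by (rule group_B)
  show ?thesis
  proof (rule B.subgroupI)
    show "Gc n \<subseteq> carrier B" by (auto simp: Gc_iff)
    have "\<one>\<^bsub>B\<^esub> \<in> Gc n" by (simp add: Gc_iff \<Gamma>_one \<zeta>\<pi>_Linf)
    then show "Gc n \<noteq> {}" by blast
  next
    fix g assume "g \<in> Gc n"
    then show "inv\<^bsub>B\<^esub> g \<in> Gc n" using \<Gamma>_inv(1)[of g "\<pi> n"] \<zeta>\<pi>_Linf by (auto simp: Gc_iff)
  next
    fix g h assume "g \<in> Gc n" "h \<in> Gc n"
    then show "g \<otimes>\<^bsub>B\<^esub> h \<in> Gc n" using \<Gamma>_mult[of g h "\<pi> n"] \<zeta>\<pi>_Linf by (auto simp: Gc_iff)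
  qed
qed

text \<open>In normal form, fixing \<open>\<pi> n\<close> only says that d^n divides a, so the
  middle factor is a power of \<tau>^(d^n).\<close>

lemma Gc_generate: "Gc n = generate B {bt [^]\<^bsub>B\<^esub> (1 * int (d ^ n)), bs}"
proof
  interpret bs_pair B bt bs q by (rule bsp)
  let ?D = "generate B {bt [^]\<^bsub>B\<^esub> (1 * int (d ^ n)), bs}"
  have nfs: "bt [^]\<^bsub>B\<^esub> int (d ^ n) = nf 0 (int (d ^ n)) 0" "bs = nf 0 0 1" using s t by (simp_all add: nf_def int_pow_1)
  have mem: "bt [^]\<^bsub>B\<^esub> int (d ^ n) \<in> Gc n" "bs \<in> Gc n"
    by (subst nfs(1), simp only: Gc_nf dvd_refl) (subst nfs(2), simp only: Gc_nf dvd_0_right)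
  show "?D \<subseteq> Gc n" by (rule generate_subgroup_incl[OF _ subgroup_Gc]) (use mem in auto)
  have subD: "subgroup ?D B" by (rule generate_is_subgroup) (use t s in auto)
  show "Gc n \<subseteq> ?D"
  proof
    fix g assume g: "g \<in> Gc n"
    then have "g \<in> carrier B" by (simp add: Gc_iff)
    from B_nf[OF this] obtain k a l where nf: "g = nf k a l" by blast
    then obtain b where b: "a = int (d ^ n) * b" using g Gc_nf by blast
    have gens: "bt [^]\<^bsub>B\<^esub> int (d ^ n) \<in> ?D" "bs \<in> ?D" by (auto intro: generate.incl)
    have "bt [^]\<^bsub>B\<^esub> a = (bt [^]\<^bsub>B\<^esub> int (d ^ n)) [^]\<^bsub>B\<^esub> b" using t by (simp only: b int_pow_pow)
    then have "bt [^]\<^bsub>B\<^esub> a \<in> ?D" using subgroup_int_pow_closed[OF subD gens(1)] by simp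
    then show "g \<in> ?D" unfolding nf nf_def
      using subgroup_int_pow_closed[OF subD gens(2)] by (intro subgroup.m_closed[OF subD])
  qed
qed

lemma Gc_0: "Gc 0 = carrier B"
proof -
  have "\<Gamma> g pp = pp" if "g \<in> carrier B" for g using khomD(7)[OF \<Gamma>_khom[OF that]] .
  then show ?thesis by (auto simp: Gc_iff \<pi>_0)
qed

lemma Gc_Suc: "Gc (Suc n) \<subseteq> Gc n"
proof
  fix g assume "g \<in> Gc (Suc n)"
  then show "g \<in> Gc n"
    using khom_power[OF \<Gamma>_khom subring_Linf \<zeta>\<pi>_Linf(2), of g "Suc n" d] by (auto simp: Gc_iff \<pi>_Suc)
qed

text \<open>The exponent sum of \<sigma>. As \<tau> fixes all roots of unity, this integer alone
  determines how an element acts on them.\<close>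

definition \<kappa> :: "bs_gen word set \<Rightarrow> int" where
  "\<kappa> = pres_lift integer_group (case_bs_gen 1 0)"

lemma \<kappa>_hom: "\<kappa> \<in> hom B integer_group" and \<kappa>_gens: "\<kappa> bt = 0" "\<kappa> bs = 1"
proof -
  interpret Z: group integer_group by (rule group_integer_group)
  let ?h = "case_bs_gen 1 0 :: bs_gen \<Rightarrow> int"
  have r: "range ?h \<subseteq> carrier integer_group" by simp
  have rel: "word_eval integer_group ?h u = word_eval integer_group ?h w" if "(u, w) \<in> bs_rels q" for u w
    using that Z.word_eval_pow[OF r] by (auto simp: bs_rels_def) (simp add: word_eval_def)
  show "\<kappa> \<in> hom B integer_group" unfolding \<kappa>_def BS_def by (rule Z.pres_lift_hom(1)[OF r rel])
  show "\<kappa> bt = 0" "\<kappa> bs = 1"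
    unfolding \<kappa>_def bs_tau_def bs_sigma_def using Z.pres_lift_hom(2)[OF r rel] by simp_all
qed

lemma \<kappa>_mult: "g \<in> carrier B \<Longrightarrow> h \<in> carrier B \<Longrightarrow> \<kappa> (g \<otimes>\<^bsub>B\<^esub> h) = \<kappa> g + \<kappa> h"
  using hom_mult[OF \<kappa>_hom] by simp

lemma \<kappa>_fixes:
  assumes g: "g \<in> carrier B" shows "\<Gamma> g (\<zeta> n) = \<zeta> n \<longleftrightarrow> int (so n) dvd \<kappa> g"
proof -
  interpret bs_pair B bt bs q by (rule bsp)
  interpret h: group_hom B integer_group \<kappa>
    by (rule group_hom.intro[OF group_B group_integer_group]) (rule group_hom_axioms.intro[OF \<kappa>_hom])
  obtain k a l where nf: "g = nf k a l" using B_nf[OF g] by blast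
  have "\<kappa> g = int l - int k"
    unfolding nf nf_def using s t by (simp add: h.hom_mult h.hom_int_pow \<kappa>_gens)
  moreover have "\<Gamma> g (\<zeta> n) = \<Theta> g n (\<zeta> n)" using \<zeta>_L by (simp add: \<Theta>_def)
  moreover have "[k = l] (mod so n) \<longleftrightarrow> int (so n) dvd int l - int k"
    by (metis cong_iff_dvd_diff cong_int_iff cong_sym)
  ultimately show ?thesis using \<Theta>_fixes(2)[where n = n and k = k and a = a and l = l] by (simp add: nf)
qed

text \<open>The orbit of \<open>v j\<close> under \<open>G\<^sub>n\<close> consists of the points \<open>\<zeta>\<^bsub>j-n\<^esub>\<^sup>b \<pi>\<^sub>j - p\<close>, so its
  pointwise stabilizer in \<open>G\<^sub>j\<close> is the stabilizer of \<open>\<zeta>\<^bsub>j-n\<^esub>\<close>.\<close>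

lemma chain_core_Gc:
  assumes "n \<le> j" shows "chain_core B Gc n j = {g \<in> Gc j. int (so (j - n)) dvd \<kappa> g}"
proof -
  interpret bs_pair B bt bs q by (rule bsp)
  let ?z = "\<zeta> (j - n)"
  have zj: "\<zeta> j ^ (d ^ n) = ?z" using \<zeta>_add[of "j - n" n] assms by simp
  have pj: "\<pi> j ^ (d ^ (j - n)) = \<pi> n" using \<pi>_add[of n "j - n"] assms by simp
  have conj_iff: "g \<in> (\<lambda>x. h \<otimes>\<^bsub>B\<^esub> x \<otimes>\<^bsub>B\<^esub> inv\<^bsub>B\<^esub> h) ` Gc j \<longleftrightarrow> g \<in> carrier B \<and> \<Gamma> g (\<Gamma> h (\<pi> j)) = \<Gamma> h (\<pi> j)"
    if h: "h \<in> carrier B" for g h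
  proof
    assume "g \<in> (\<lambda>x. h \<otimes>\<^bsub>B\<^esub> x \<otimes>\<^bsub>B\<^esub> inv\<^bsub>B\<^esub> h) ` Gc j"
    then obtain x where x: "x \<in> carrier B" "\<Gamma> x (\<pi> j) = \<pi> j" "g = h \<otimes>\<^bsub>B\<^esub> x \<otimes>\<^bsub>B\<^esub> inv\<^bsub>B\<^esub> h" by (auto simp: Gc_iff)
    have "g \<otimes>\<^bsub>B\<^esub> h = h \<otimes>\<^bsub>B\<^esub> x" and g: "g \<in> carrier B" using x h by (simp_all add: m_assoc)
    then show "g \<in> carrier B \<and> \<Gamma> g (\<Gamma> h (\<pi> j)) = \<Gamma> h (\<pi> j)"
      using \<Gamma>_mult[OF g h \<zeta>\<pi>_Linf(2)] \<Gamma>_mult[OF h x(1) \<zeta>\<pi>_Linf(2)] x(2) by metis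
  next
    assume g: "g \<in> carrier B \<and> \<Gamma> g (\<Gamma> h (\<pi> j)) = \<Gamma> h (\<pi> j)"
    define x where "x = inv\<^bsub>B\<^esub> h \<otimes>\<^bsub>B\<^esub> (g \<otimes>\<^bsub>B\<^esub> h)"
    have gc: "g \<in> carrier B" using g by simp
    have xc: "x \<in> carrier B" using gc h by (simp add: x_def)
    have "\<Gamma> x (\<pi> j) = \<pi> j"
      using \<Gamma>_mult[of "inv\<^bsub>B\<^esub> h" "g \<otimes>\<^bsub>B\<^esub> h" "\<pi> j"] \<Gamma>_mult[OF gc h \<zeta>\<pi>_Linf(2)] \<Gamma>_inv(1)[OF h \<zeta>\<pi>_Linf(2)] g h \<zeta>\<pi>_Linf(2)
      by (simp add: x_def)
    moreover have "h \<otimes>\<^bsub>B\<^esub> x \<otimes>\<^bsub>B\<^esub> inv\<^bsub>B\<^esub> h = g"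
      using gc h by (simp add: x_def m_assoc[symmetric]) (simp add: m_assoc)
    ultimately show "g \<in> (\<lambda>x. h \<otimes>\<^bsub>B\<^esub> x \<otimes>\<^bsub>B\<^esub> inv\<^bsub>B\<^esub> h) ` Gc j"
      using xc by (intro image_eqI[of _ _ x]) (auto simp: Gc_iff)
  qed
  have Gcn: "h \<in> carrier B" if "h \<in> Gc n" for h using that by (simp add: Gc_iff)
  have core: "g \<in> chain_core B Gc n j \<longleftrightarrow> g \<in> carrier B \<and> (\<forall>h\<in>Gc n. \<Gamma> g (\<Gamma> h (\<pi> j)) = \<Gamma> h (\<pi> j))" for g
  proof -
    have "g \<in> chain_core B Gc n j \<longleftrightarrow> (\<forall>h\<in>Gc n. g \<in> carrier B \<and> \<Gamma> g (\<Gamma> h (\<pi> j)) = \<Gamma> h (\<pi> j))"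
      unfolding chain_core_def using conj_iff[OF Gcn] by simp
    then show ?thesis using subgroup.one_closed[OF subgroup_Gc[of n]] by blast
  qed
  have "g \<in> chain_core B Gc n j \<longleftrightarrow> g \<in> carrier B \<and> \<Gamma> g (\<pi> j) = \<pi> j \<and> \<Gamma> g ?z = ?z" for g
  proof
    assume "g \<in> chain_core B Gc n j"
    then have g: "g \<in> carrier B" and all: "\<And>h. h \<in> Gc n \<Longrightarrow> \<Gamma> g (\<Gamma> h (\<pi> j)) = \<Gamma> h (\<pi> j)" by (auto simp: core)
    have one: "\<Gamma> g (\<pi> j) = \<pi> j"
      using all[OF subgroup.one_closed[OF subgroup_Gc]] \<Gamma>_one \<zeta>\<pi>_Linf by simp
    \<comment> \<open>This element of the chain subgroup moves \<pi>_j to \<zeta>_(j-n) \<pi>_j.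
      Fixing both points means fixing the root of unity.\<close>
    let ?h = "bt [^]\<^bsub>B\<^esub> (d ^ n)"
    interpret h: group_hom B "GL j" "\<lambda>g. \<Theta> g j"
      by (rule group_hom.intro[OF group_B group_GL]) (rule group_hom_axioms.intro[OF \<Theta>_hom])
    have "?h \<in> Gc n" unfolding Gc_generate by (rule generate.incl) (simp add: int_pow_int[symmetric])
    moreover have "\<Gamma> ?h (\<pi> j) = ?z * \<pi> j"
      using h.hom_nat_pow[OF t, of "d ^ n"] \<tau>n_nat_pow_values[of j "d ^ n"] \<pi>_L[of j]
      by (simp add: \<Theta>_gens zj) (metis \<Theta>_def restrict_apply')
    ultimately have "\<Gamma> g (?z * \<pi> j) = ?z * \<pi> j" using all by metis
    then show "g \<in> carrier B \<and> \<Gamma> g (\<pi> j) = \<pi> j \<and> \<Gamma> g ?z = ?z"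
      using khomD(3)[OF \<Gamma>_khom[OF g] \<zeta>\<pi>_Linf(1) \<zeta>\<pi>_Linf(2), of "j - n" j] one g by simp
  next
    assume g: "g \<in> carrier B \<and> \<Gamma> g (\<pi> j) = \<pi> j \<and> \<Gamma> g ?z = ?z"
    then have gc: "g \<in> carrier B" by simp
    note hg = \<Gamma>_khom[OF gc]
    have "\<Gamma> g (\<Gamma> h (\<pi> j)) = \<Gamma> h (\<pi> j)" if h: "h \<in> Gc n" for h
    proof -
      obtain a where a: "\<Gamma> h (\<pi> j) = \<zeta> j ^ a * \<pi> j"
        using galois_values(2)[OF subring_Linf \<Gamma>_khom[OF Gcn[OF h]] \<zeta>\<pi>_Linf] by blast
      \<comment> \<open>As h fixes \<pi>_n, a power of \<pi>_j, the exponent a must be divisible by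
        d^n; so h moves \<pi>_j by a power of \<zeta>_(j-n).\<close>
      have "\<Gamma> h (\<pi> n) = \<Gamma> h (\<pi> j) ^ (d ^ (j - n))"
        unfolding pj[symmetric] by (rule khom_power[OF \<Gamma>_khom[OF Gcn[OF h]] subring_Linf \<zeta>\<pi>_Linf(2)])
      then have "\<pi> n = \<zeta> j ^ (a * d ^ (j - n)) * \<pi> n"
        using h by (simp add: a power_mult_distrib pj power_mult[symmetric] Gc_iff)
      then have "\<zeta> j ^ (a * d ^ (j - n)) = 1" by simp
      then have "d ^ j dvd a * d ^ (j - n)" by (simp only: \<zeta>_power_eq_1)
      moreover have "d ^ j = d ^ n * d ^ (j - n)" using assms by (simp flip: power_add)
      ultimately have "d ^ n dvd a" using d_pos by simp
      then obtain b where "a = d ^ n * b" by blast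
      then have za: "\<zeta> j ^ a = ?z ^ b" by (simp add: power_mult zj)
      have zb: "?z ^ b \<in> Linf" by (intro subring_set_power subring_Linf \<zeta>\<pi>_Linf)
      have "\<Gamma> g (?z ^ b) = ?z ^ b" using khom_power[OF hg subring_Linf \<zeta>\<pi>_Linf(1), of "j - n" b] g by simp
      then show ?thesis using khomD(3)[OF hg zb \<zeta>\<pi>_Linf(2), of j] g by (simp add: a za)
    qed
    then show "g \<in> chain_core B Gc n j" using gc core by blast
  qed
  then show ?thesis using \<kappa>_fixes by (auto simp: Gc_iff)
qed

end

section \<open>Cantor spaces and profinite groups\<close>

text \<open>A nonempty open set is cut by the \<open>n\<close>-th separating set if that set cuts it, and otherwise by
  any separating set that does. Iterating gives a binary tree of nonempty clopen sets; the branch of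
  a point determines the point because each \<open>C n\<close> has been tried.\<close>

lemma homeomorphic_cantor_space:
  fixes C :: "nat \<Rightarrow> 'a set"
  assumes compact: "compact_space S" and nonempty: "topspace S \<noteq> {}"
    and open_C: "\<And>n. openin S (C n)" and closed_C: "\<And>n. closedin S (C n)"
    and separate: "\<And>x y. x \<in> topspace S \<Longrightarrow> y \<in> topspace S \<Longrightarrow> x \<noteq> y \<Longrightarrow> \<exists>n. x \<in> C n \<and> y \<notin> C n"
    and perfect: "\<And>U x. openin S U \<Longrightarrow> x \<in> U \<Longrightarrow> \<exists>y\<in>U. y \<noteq> x"
  shows "S homeomorphic_space cantor_space"
proof -
  define cuts where "cuts k U \<longleftrightarrow> U \<inter> C k \<noteq> {} \<and> U - C k \<noteq> {}" for k U
  define ix where "ix n U = (if cuts n U then n else SOME k. cuts k U)" for n U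
  have ix: "cuts (ix n U) U" if U: "openin S U" "U \<noteq> {}" for n U
  proof -
    obtain x where x: "x \<in> U" using U by blast
    obtain y where y: "y \<in> U" "y \<noteq> x" using perfect[OF U(1) x] by blast
    have "x \<in> topspace S" "y \<in> topspace S" using x y openin_subset[OF U(1)] by auto
    then obtain k where "x \<in> C k" "y \<notin> C k" using separate y(2) by metis
    then have "cuts k U" using x y by (auto simp: cuts_def)
    then show ?thesis unfolding ix_def using someI[of "\<lambda>k. cuts k U"] by auto
  qed
  define W where "W b = rec_nat (topspace S) (\<lambda>n U. if b n then U \<inter> C (ix n U) else U - C (ix n U))" for b :: "nat \<Rightarrow> bool"
  have W0: "W b 0 = topspace S" and WS: "W b (Suc n) = (if b n then W b n \<inter> C (ix n (W b n)) else W b n - C (ix n (W b n)))" for b n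
    by (simp_all add: W_def)
  have W: "openin S (W b n) \<and> closedin S (W b n) \<and> W b n \<noteq> {}" for b n
  proof (induction n)
    case 0 then show ?case using nonempty by (simp add: W0)
  next
    case (Suc n)
    then have "cuts (ix n (W b n)) (W b n)" by (intro ix) auto
    then show ?case using Suc open_C closed_C by (auto simp: WS cuts_def intro: openin_Int closedin_Int openin_diff closedin_diff)
  qed
  have W_cong: "W b n = W b' n" if "\<And>i. i < n \<Longrightarrow> b i = b' i" for b b' n
    using that by (induction n) (simp_all add: W0 WS)
  \<comment> \<open>\<open>V\<close> follows a point down the tree and \<open>code\<close> records
    its turns, so that the sets \<open>V x n\<close> form the branch
    \<open>W (code x)\<close>.\<close>
  define V where "V x = rec_nat (topspace S) (\<lambda>n U. if x \<in> C (ix n U) then U \<inter> C (ix n U) else U - C (ix n U))" for x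
  define code where "code x n \<longleftrightarrow> x \<in> C (ix n (V x n))" for x n
  have VW: "V x n = W (code x) n" for x n
    by (induction n) (simp_all add: V_def W_def code_def)
  have code: "code x n \<longleftrightarrow> x \<in> C (ix n (W (code x) n))" for x n
    unfolding VW[symmetric] code_def ..
  have x_W: "x \<in> W (code x) n" if "x \<in> topspace S" for x n
    using that code by (induction n) (auto simp: W0 WS)
  have W_code: "b i = code x i" if "x \<in> W b n" "i < n" for b x n i
    using that
  proof (induction n arbitrary: i)
    case (Suc n)
    have xn: "x \<in> W b n" using Suc.prems(1) by (auto simp: WS split: if_splits)
    have eq: "W b n = W (code x) n" by (rule W_cong) (use Suc.IH[OF xn] in blast)
    have "b n = code x n" using Suc.prems(1) code[of x n] unfolding eq[symmetric] by (auto simp: WS split: if_splits)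
    then show ?case using Suc.IH[OF xn] Suc.prems(2) by (cases "i = n") auto
  qed simp
  have cont: "continuous_map S cantor_space code"
    unfolding cantor_space_def continuous_map_componentwise_UNIV
  proof
    fix n
    show "continuous_map S (discrete_topology UNIV) (\<lambda>x. code x n)"
      unfolding continuous_map_def
    proof (intro conjI allI impI)
      fix P :: "bool set"
      show "openin S {x \<in> topspace S. code x n \<in> P}"
      proof (subst openin_subopen, intro ballI)
        fix x assume x: "x \<in> {x \<in> topspace S. code x n \<in> P}"
        show "\<exists>T. openin S T \<and> x \<in> T \<and> T \<subseteq> {x \<in> topspace S. code x n \<in> P}"
        proof (intro exI[of _ "W (code x) (Suc n)"] conjI subsetI)
          fix y assume y: "y \<in> W (code x) (Suc n)"
          then have "code x n = code y n" using W_code by blast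
          moreover have "y \<in> topspace S" using y W openin_subset by blast
          ultimately show "y \<in> {x \<in> topspace S. code x n \<in> P}" using x by auto
        qed (use W x x_W in auto)
      qed
    qed auto
  qed
  have inj: "inj_on code (topspace S)"
  proof (rule inj_onI, rule ccontr)
    fix x y assume xy: "x \<in> topspace S" "y \<in> topspace S" "code x = code y" "x \<noteq> y"
    obtain n where n: "x \<in> C n" "y \<notin> C n" using separate[OF xy(1,2,4)] by blast
    have mem: "x \<in> W (code x) n" "y \<in> W (code x) n" using x_W[OF xy(1)] x_W[OF xy(2)] xy(3) by auto
    then have "ix n (W (code x) n) = n" using n by (auto simp: ix_def cuts_def)
    then show False using code[of x n] code[of y n] n xy(3) by simp
  qed
  have surj: "code ` topspace S = UNIV"
  proof (intro equalityI subsetI UNIV_I)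
    fix b :: "nat \<Rightarrow> bool"
    have dec: "W b n \<subseteq> W b m" if "m \<le> n" for m n
      by (rule lift_Suc_antimono_le[of "W b"]) (use that in \<open>auto simp: WS\<close>)
    \<comment> \<open>A branch is a decreasing sequence of nonempty closed sets, so compactness
      provides a point on it.\<close>
    have "(\<Inter>n. W b n) \<noteq> {}"
      by (rule compact_space_imp_nest[OF compact]) (use W dec in \<open>auto simp: decseq_def\<close>)
    then obtain x where x: "\<And>n. x \<in> W b n" by blast
    then have "x \<in> topspace S" using W0 by blast
    note x = x this
    have "b = code x" using W_code[OF x(1)] by blast
    then show "b \<in> code ` topspace S" using x(2) by blast
  qed
  have haus: "Hausdorff_space cantor_space"
    unfolding cantor_space_def Hausdorff_space_product_topology by simp
  have ts: "topspace cantor_space = UNIV" by (simp add: cantor_space_def)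
  have "homeomorphic_map S cantor_space code"
    by (rule continuous_imp_homeomorphic_map[OF cont compact haus]) (use inj surj ts in auto)
  then show ?thesis by (rule homeomorphic_map_imp_homeomorphic_space)
qed

section \<open>Inverse limits of finite groups\<close>

locale finite_inverse_system =
  fixes n0 :: nat and A :: "nat \<Rightarrow> 'a monoid" and \<pi> :: "nat \<Rightarrow> 'a \<Rightarrow> 'a"
  assumes groups: "\<And>j. j \<ge> n0 \<Longrightarrow> group (A j)"
    and finite_groups: "\<And>j. j \<ge> n0 \<Longrightarrow> finite (carrier (A j))"
    and bonding: "\<And>j. j \<ge> n0 \<Longrightarrow> \<pi> j \<in> hom (A (Suc j)) (A j)"
begin

abbreviation D where "D \<equiv> inv_limit n0 A \<pi>"
abbreviation TD where "TD \<equiv> inv_limit_topology n0 A \<pi>"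

lemma carrier_D: "carrier D = {x \<in> (\<Pi>\<^sub>E j\<in>{n0..}. carrier (A j)). \<forall>j\<ge>n0. \<pi> j (x (Suc j)) = x j}"
  by (simp add: inv_limit_def)

lemma D_mem: "x \<in> carrier D \<Longrightarrow> j \<ge> n0 \<Longrightarrow> x j \<in> carrier (A j)"
  by (auto simp: carrier_D)

lemma mult_D: "x \<otimes>\<^bsub>D\<^esub> y = (\<lambda>j\<in>{n0..}. x j \<otimes>\<^bsub>A j\<^esub> y j)"
  by (simp add: inv_limit_def product_group_def)

lemma subgroup_D: "subgroup (carrier D) (product_group {n0..} A)"
proof -
  interpret P: group "product_group {n0..} A" by (rule product_group) (simp add: groups)
  show ?thesis
  proof (rule P.subgroupI)
    show "carrier D \<subseteq> carrier (product_group {n0..} A)" by (auto simp: carrier_D)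
    have "\<one>\<^bsub>product_group {n0..} A\<^esub> \<in> carrier D"
      using P.one_closed hom_one[OF bonding groups groups] by (auto simp: carrier_D)
    then show "carrier D \<noteq> {}" by blast
  next
    fix x assume x: "x \<in> carrier D"
    then have mem: "x j \<in> carrier (A j)" if "j \<ge> n0" for j using that by (auto simp: carrier_D)
    have inv: "inv\<^bsub>product_group {n0..} A\<^esub> x = (\<lambda>j\<in>{n0..}. inv\<^bsub>A j\<^esub> x j)"
      by (rule inv_product_group) (use x groups in \<open>auto simp: carrier_D\<close>)
    have "\<pi> j (inv\<^bsub>A (Suc j)\<^esub> x (Suc j)) = inv\<^bsub>A j\<^esub> x j" if j: "j \<ge> n0" for j
    proof -
      interpret h: group_hom "A (Suc j)" "A j" "\<pi> j"
        using groups bonding j by (simp add: group_hom_def group_hom_axioms_def)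
      show ?thesis using h.hom_inv[OF mem] x j by (simp add: carrier_D)
    qed
    then show "inv\<^bsub>product_group {n0..} A\<^esub> x \<in> carrier D"
      using mem groups by (auto simp: inv carrier_D intro: group.inv_closed)
  next
    fix x y assume xy: "x \<in> carrier D" "y \<in> carrier D"
    have "\<pi> j (x (Suc j) \<otimes>\<^bsub>A (Suc j)\<^esub> y (Suc j)) = x j \<otimes>\<^bsub>A j\<^esub> y j" if j: "j \<ge> n0" for j
      using hom_mult[OF bonding[OF j], of "x (Suc j)" "y (Suc j)"] D_mem[of _ "Suc j"] xy j by (simp add: carrier_D)
    then show "x \<otimes>\<^bsub>product_group {n0..} A\<^esub> y \<in> carrier D"
      using xy P.m_closed[of x y] by (auto simp: carrier_D)
  qed
qed

lemma group_D: "group D"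
proof -
  interpret P: group "product_group {n0..} A" by (rule product_group) (simp add: groups)
  have "group (product_group {n0..} A\<lparr>carrier := carrier D\<rparr>)"
    by (rule subgroup.subgroup_is_group[OF subgroup_D P.is_group])
  then show ?thesis by (simp add: inv_limit_def)
qed

lemma inv_D: "x \<in> carrier D \<Longrightarrow> inv\<^bsub>D\<^esub> x = (\<lambda>j\<in>{n0..}. inv\<^bsub>A j\<^esub> x j)"
proof -
  assume x: "x \<in> carrier D"
  interpret P: group "product_group {n0..} A" by (rule product_group) (simp add: groups)
  have "inv\<^bsub>product_group {n0..} A\<lparr>carrier := carrier D\<rparr>\<^esub> x = inv\<^bsub>product_group {n0..} A\<^esub> x"
    by (rule P.m_inv_consistent[OF subgroup_D x])
  moreover have "product_group {n0..} A\<lparr>carrier := carrier D\<rparr> = D" by (simp add: inv_limit_def)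
  moreover have "inv\<^bsub>product_group {n0..} A\<^esub> x = (\<lambda>j\<in>{n0..}. inv\<^bsub>A j\<^esub> x j)"
    by (rule inv_product_group) (use x groups in \<open>auto simp: carrier_D\<close>)
  ultimately show ?thesis by simp
qed

lemma topspace_TD [simp]: "topspace TD = carrier D"
  by (auto simp: inv_limit_topology_def carrier_D)


lemma continuous_proj: "j \<ge> n0 \<Longrightarrow> continuous_map TD (discrete_topology (carrier (A j))) (\<lambda>x. x j)"
  unfolding inv_limit_topology_def
  by (rule continuous_map_from_subtopology) (rule continuous_map_product_projection, simp)

lemma continuous_map_into_TD:
  assumes "\<And>x. x \<in> topspace S \<Longrightarrow> f x \<in> carrier D"
    and "\<And>j. j \<ge> n0 \<Longrightarrow> continuous_map S (discrete_topology (carrier (A j))) (\<lambda>x. f x j)"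
  shows "continuous_map S TD f"
  unfolding inv_limit_topology_def continuous_map_in_subtopology continuous_map_componentwise
  using assms by (auto simp: carrier_D PiE_def)

lemma topological_group_D: "topological_group D TD"
  unfolding topological_group_def
proof (intro conjI group_D topspace_TD)
  interpret group D by (rule group_D)
  show "continuous_map (prod_topology TD TD) TD (\<lambda>(x, y). x \<otimes>\<^bsub>D\<^esub> y)"
  proof (rule continuous_map_into_TD)
    fix j assume j: "j \<ge> n0"
    let ?d = "discrete_topology (carrier (A j))"
    have "continuous_map (prod_topology TD TD) (prod_topology ?d ?d) (\<lambda>(x, y). (x j, y j))"
      using continuous_proj[OF j] continuous_map_prod_top[of TD TD ?d ?d "\<lambda>x. x j" "\<lambda>x. x j"] by simp
    moreover have "continuous_map (prod_topology ?d ?d) ?d (\<lambda>(a, b). a \<otimes>\<^bsub>A j\<^esub> b)"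
      unfolding prod_topology_discrete_topology[symmetric] continuous_map_from_discrete_topology
      using monoid.m_closed[OF group.is_monoid[OF groups[OF j]]] by auto
    ultimately have "continuous_map (prod_topology TD TD) ?d ((\<lambda>(a, b). a \<otimes>\<^bsub>A j\<^esub> b) \<circ> (\<lambda>(x, y). (x j, y j)))"
      by (rule continuous_map_compose)
    moreover have "(\<lambda>(a, b). a \<otimes>\<^bsub>A j\<^esub> b) \<circ> (\<lambda>(x, y). (x j, y j)) = (\<lambda>x. (case x of (x, y) \<Rightarrow> x \<otimes>\<^bsub>D\<^esub> y) j)"
      using j by (auto simp: mult_D)
    ultimately show "continuous_map (prod_topology TD TD) ?d (\<lambda>x. (case x of (x, y) \<Rightarrow> x \<otimes>\<^bsub>D\<^esub> y) j)" by simp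
  qed auto
  show "continuous_map TD TD (\<lambda>x. inv\<^bsub>D\<^esub> x)"
  proof (rule continuous_map_into_TD)
    fix j assume j: "j \<ge> n0"
    let ?d = "discrete_topology (carrier (A j))"
    have "continuous_map ?d ?d (\<lambda>a. inv\<^bsub>A j\<^esub> a)"
      unfolding continuous_map_from_discrete_topology using group.inv_closed[OF groups[OF j]] by auto
    from continuous_map_compose[OF continuous_proj[OF j] this]
    show "continuous_map TD ?d (\<lambda>x. (inv\<^bsub>D\<^esub> x) j)"
      by (rule continuous_map_eq) (use j in \<open>simp add: inv_D\<close>)
  qed simp
qed

lemma clopen_proj:
  assumes "j \<ge> n0" shows "openin TD {x \<in> carrier D. x j \<in> Q}" "closedin TD {x \<in> carrier D. x j \<in> Q}"
proof -
  have o: "openin TD {x \<in> carrier D. x j \<in> Q}" for Q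
  proof -
    have "openin TD {x \<in> topspace TD. x j \<in> Q \<inter> carrier (A j)}"
      using openin_continuous_map_preimage[OF continuous_proj[OF assms], of "Q \<inter> carrier (A j)"] by simp
    moreover have "{x \<in> topspace TD. x j \<in> Q \<inter> carrier (A j)} = {x \<in> carrier D. x j \<in> Q}"
      using D_mem[OF _ assms] by auto
    ultimately show ?thesis by simp
  qed
  show "openin TD {x \<in> carrier D. x j \<in> Q}" by (rule o)
  have "topspace TD - {x \<in> carrier D. x j \<in> Q} = {x \<in> carrier D. x j \<in> - Q}" by auto
  then show "closedin TD {x \<in> carrier D. x j \<in> Q}" using o[of "- Q"] by (auto simp: closedin_def)
qed

lemma D_ext: "x \<in> carrier D \<Longrightarrow> y \<in> carrier D \<Longrightarrow> (\<And>j. j \<ge> n0 \<Longrightarrow> x j = y j) \<Longrightarrow> x = y"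
  by (rule extensionalityI[of _ "{n0..}"]) (auto simp: carrier_D PiE_def)

lemma Hausdorff_TD: "Hausdorff_space TD"
  unfolding inv_limit_topology_def
  by (intro Hausdorff_space_subtopology) (simp add: Hausdorff_space_product_topology)

text \<open>Each compatibility condition equates two continuous maps into a discrete space, so the
  limit is closed in a product of finite discrete spaces.\<close>

lemma compact_TD: "compact_space TD"
proof -
  let ?P = "product_topology (\<lambda>j. discrete_topology (carrier (A j))) {n0..}"
  have comp: "compact_space ?P"
    by (simp add: compact_space_product_topology compact_space_discrete_topology finite_groups)
  have "closedin ?P (carrier D)"
  proof -
    have pr: "continuous_map ?P (discrete_topology (carrier (A j))) (\<lambda>x. x j)" if "j \<ge> n0" for j
      by (rule continuous_map_product_projection) (use that in simp)
    have cl: "closedin ?P {x \<in> topspace ?P. \<pi> j (x (Suc j)) = x j}" if j: "j \<ge> n0" for j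
    proof -
      have "continuous_map (discrete_topology (carrier (A (Suc j)))) (discrete_topology (carrier (A j))) (\<pi> j)"
        using bonding[OF j] by (auto simp: continuous_map_from_discrete_topology hom_def)
      moreover have "n0 \<le> Suc j" using j by simp
      ultimately have "continuous_map ?P (discrete_topology (carrier (A j))) (\<pi> j \<circ> (\<lambda>x. x (Suc j)))"
        using continuous_map_compose[OF pr] by blast
      then have c1: "continuous_map ?P (discrete_topology (carrier (A j))) (\<lambda>x. \<pi> j (x (Suc j)))"
        by (simp only: comp_def)
      show ?thesis
        by (rule closedin_continuous_maps_eq[OF _ c1 pr[OF j]]) simp
    qed
    have eq: "carrier D = (\<Inter>j\<in>{n0..}. {x \<in> topspace ?P. \<pi> j (x (Suc j)) = x j})"
      by (auto simp: carrier_D)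
    show ?thesis unfolding eq by (rule closedin_INT) (use cl in auto)
  qed
  then show ?thesis
    unfolding inv_limit_topology_def by (intro compact_space_subtopology closedin_compact_space comp)
qed

lemma connected_component_TD:
  assumes x: "x \<in> topspace TD" shows "connected_component_of_set TD x = {x}"
proof -
  have "y = x" if "connected_component_of TD x y" for y
  proof -
    from that obtain Z where Z: "connectedin TD Z" "x \<in> Z" "y \<in> Z" unfolding connected_component_of_def by blast
    have Zsub: "Z \<subseteq> carrier D" using connectedin_subset_topspace[OF Z(1)] by simp
    have "y j = x j" if j: "j \<ge> n0" for j
    proof (rule ccontr)
      assume ne: "y j \<noteq> x j"
      let ?U = "{w \<in> carrier D. w j \<in> {x j}}" and ?U' = "{w \<in> carrier D. w j \<in> - {x j}}"
      have "openin TD ?U \<and> openin TD ?U' \<and> Z \<subseteq> ?U \<union> ?U' \<and> ?U \<inter> ?U' \<inter> Z = {} \<and> ?U \<inter> Z \<noteq> {} \<and> ?U' \<inter> Z \<noteq> {}"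
        by (intro conjI clopen_proj(1)[OF j]) (use Z(2,3) Zsub ne in auto)
      then show False using Z(1) unfolding connectedin by blast
    qed
    then show ?thesis using D_ext[of y x] Z Zsub by blast
  qed
  moreover have "connected_component_of TD x x" using x by (simp add: connected_component_of_refl)
  ultimately show ?thesis by blast
qed

lemma profinite_D: "profinite_group D TD"
  unfolding profinite_group_def using topological_group_D compact_TD Hausdorff_TD connected_component_TD by blast

text \<open>A basic open set restricts finitely many coordinates. With j at least as large as all of
  them, the bonding maps determine these coordinates from coordinate j.\<close>

lemma open_TD_basic:
  assumes "openin TD U" "x \<in> U" shows "\<exists>j\<ge>n0. {y \<in> carrier D. y j = x j} \<subseteq> U"
proof -
  let ?P = "product_topology (\<lambda>j. discrete_topology (carrier (A j))) {n0..}"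
  obtain T where T: "openin ?P T" "U = T \<inter> carrier D"
    using assms(1) unfolding inv_limit_topology_def openin_subtopology by blast
  then obtain V where V: "finite {i \<in> {n0..}. V i \<noteq> topspace (discrete_topology (carrier (A i)))}" "x \<in> Pi\<^sub>E {n0..} V" "Pi\<^sub>E {n0..} V \<subseteq> T"
    using assms(2) unfolding openin_product_topology_alt by blast
  \<comment> \<open>Inserting \<open>n0\<close> keeps the maximum defined when no coordinate is
    restricted.\<close>
  define j where "j = Max (insert n0 {i \<in> {n0..}. V i \<noteq> topspace (discrete_topology (carrier (A i)))})"
  have j: "j \<ge> n0" "\<And>i. i \<ge> n0 \<Longrightarrow> V i \<noteq> carrier (A i) \<Longrightarrow> i \<le> j"
    using V(1) unfolding j_def by (auto intro: Max_ge)
  have xD: "x \<in> carrier D" using assms(2) T by blast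
  have "y \<in> U" if y: "y \<in> carrier D" "y j = x j" for y
  proof -
    have below: "y i = x i" if "n0 \<le> i" "i \<le> j" for i
      using that(2,1)
    proof (induction i rule: inc_induct)
      case (step i)
      have "\<pi> i (y (Suc i)) = y i" "\<pi> i (x (Suc i)) = x i" using y(1) xD step.prems by (auto simp: carrier_D)
      then show ?case using step by simp
    qed (use y in simp)
    have "y \<in> Pi\<^sub>E {n0..} V"
    proof (rule PiE_I)
      fix i assume i: "i \<in> {n0..}"
      show "y i \<in> V i"
      proof (cases "i \<le> j")
        case True
        then have "y i = x i" using below i by simp
        then show ?thesis using V(2) i by (auto simp: PiE_def)
      next
        case False
        then have "V i = carrier (A i)" using j(2) i by auto
        then show ?thesis using D_mem[OF y(1)] i by simp
      qed
    next
      fix i assume "i \<notin> {n0..}"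
      then show "y i = undefined" using y(1) by (auto simp: carrier_D PiE_def extensional_def)
    qed
    then show ?thesis using V(3) T(2) y(1) by blast
  qed
  then show ?thesis using j(1) by blast
qed

text \<open>Prescribing one coordinate gives a base of clopen sets, which is countable because all
  the groups are finite. These sets separate points, and the hypothesis says that none of them is a
  single point.\<close>

lemma cantor_group_D:
  assumes perfect: "\<And>x j. x \<in> carrier D \<Longrightarrow> j \<ge> n0 \<Longrightarrow> \<exists>y\<in>carrier D. y j = x j \<and> y \<noteq> x"
  shows "cantor_group D TD"
proof -
  interpret group D by (rule group_D)
  have perf: "\<exists>y\<in>U. y \<noteq> x" if U: "openin TD U" "x \<in> U" for U x
  proof -
    have xD: "x \<in> carrier D" using openin_subset[OF U(1)] U(2) by auto
    from open_TD_basic[OF U] obtain j where "j \<ge> n0" "{y \<in> carrier D. y j = x j} \<subseteq> U" by blast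
    then show ?thesis using perfect[OF xD, of j] by blast
  qed
  define \<B> where "\<B> = (\<lambda>(j, a). {x \<in> carrier D. x j \<in> {a}}) ` (SIGMA j:{n0..}. carrier (A j))"
  have count: "countable \<B>"
    unfolding \<B>_def by (intro countable_image countable_SIGMA) (auto intro: countable_finite finite_groups)
  have ne: "\<B> \<noteq> {}" unfolding \<B>_def using monoid.one_closed[OF group.is_monoid[OF groups[of n0]]] by fastforce
  define C where "C = from_nat_into \<B>"
  have C: "C n \<in> \<B>" for n unfolding C_def by (rule from_nat_into[OF ne])
  have homeo: "TD homeomorphic_space cantor_space"
  proof (rule homeomorphic_cantor_space[where C = C])
    show "topspace TD \<noteq> {}" using one_closed by auto
    fix n
    obtain j a where j: "j \<ge> n0" and Cn: "C n = {x \<in> carrier D. x j \<in> {a}}"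
      using C[of n] unfolding \<B>_def by auto
    show "openin TD (C n)" "closedin TD (C n)" unfolding Cn by (rule clopen_proj[OF j])+
  next
    fix x y assume xy: "x \<in> topspace TD" "y \<in> topspace TD" "x \<noteq> y"
    then obtain j where j: "j \<ge> n0" "x j \<noteq> y j" using D_ext by auto
    have "{w \<in> carrier D. w j \<in> {x j}} \<in> \<B>"
      unfolding \<B>_def using j(1) D_mem[of x j] xy(1) by (intro image_eqI[of _ _ "(j, x j)"]) auto
    then obtain n where "C n = {w \<in> carrier D. w j \<in> {x j}}"
      unfolding C_def using from_nat_into_surj[OF count] by blast
    then show "\<exists>n. x \<in> C n \<and> y \<notin> C n" using j xy by (intro exI[of _ n]) auto
  qed (use compact_TD perf in auto)
  have "infinite (carrier D)"
  proof
    assume fin: "finite (carrier D)"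
    have "openin TD {\<one>\<^bsub>D\<^esub>}"
    proof -
      have "closedin TD (carrier D - {\<one>\<^bsub>D\<^esub>})"
        using fin Hausdorff_TD by (intro closedin_Hausdorff_finite) auto
      then have "openin TD (topspace TD - (carrier D - {\<one>\<^bsub>D\<^esub>}))" by (rule openin_diff[OF openin_topspace])
      moreover have "topspace TD - (carrier D - {\<one>\<^bsub>D\<^esub>}) = {\<one>\<^bsub>D\<^esub>}" using one_closed by auto
      ultimately show ?thesis by simp
    qed
    then show False using perf[of "{\<one>\<^bsub>D\<^esub>}" "\<one>\<^bsub>D\<^esub>"] by auto
  qed
  then show ?thesis unfolding cantor_group_def using profinite_D homeo by blast
qed

end

section \<open>Group chains with cyclic discriminant quotients\<close>

text \<open>\<open>\<kappa>\<close> identifies \<open>H j\<close> modulo its core with the integers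
  modulo \<open>r (j - n)\<close>, the powers of s being representatives. Only the difference j - n
  enters, and this is what makes all discriminant groups isomorphic.\<close>

locale cyclic_chain = group G for G :: "'a monoid" (structure) +
  fixes H :: "nat \<Rightarrow> 'a set" and \<kappa> :: "'a \<Rightarrow> int" and s :: 'a and r :: "nat \<Rightarrow> nat"
  assumes sub: "\<And>n. subgroup (H n) G" and H_Suc: "\<And>n. H (Suc n) \<subseteq> H n"
    and \<kappa>_mult: "\<And>x y. x \<in> carrier G \<Longrightarrow> y \<in> carrier G \<Longrightarrow> \<kappa> (x \<otimes> y) = \<kappa> x + \<kappa> y"
    and s_H: "\<And>n. s \<in> H n" and \<kappa>_s: "\<kappa> s = 1"
    and r_pos: "\<And>n. r n > 0" and r_dvd: "\<And>n. r n dvd r (Suc n)" and r_unbounded: "\<And>M. \<exists>n. r n > M"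
    and core: "\<And>n j. n \<le> j \<Longrightarrow> chain_core G H n j = {g \<in> H j. int (r (j - n)) dvd \<kappa> g}"
begin

abbreviation N where "N \<equiv> chain_core G H"

lemma H_carrier: "x \<in> H n \<Longrightarrow> x \<in> carrier G"
  using subgroup.subset[OF sub] by blast

lemma H_mono: "n \<le> j \<Longrightarrow> H j \<subseteq> H n"
  by (rule lift_Suc_antimono_le[of H]) (use H_Suc in auto)

lemma r_dvd_mono: "n \<le> j \<Longrightarrow> r n dvd r j"
proof (induction rule: dec_induct)
  case (step k) then show ?case using r_dvd dvd_trans by blast
qed simp

lemma \<kappa>_group_hom: "group_hom G integer_group \<kappa>"
  by (rule group_hom.intro[OF is_group group_integer_group]) (auto intro!: group_hom_axioms.intro homI simp: \<kappa>_mult)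

lemma \<kappa>_inv: "x \<in> carrier G \<Longrightarrow> \<kappa> (inv x) = - \<kappa> x"
  using group_hom.hom_inv[OF \<kappa>_group_hom] by simp

lemma \<kappa>_pow: "\<kappa> (s [^] (i :: int)) = i"
  using group_hom.hom_int_pow[OF \<kappa>_group_hom H_carrier[OF s_H], of i] by (simp add: \<kappa>_s)

lemma pow_H: "s [^] (i :: int) \<in> H n"
  by (rule subgroup_int_pow_closed[OF sub s_H])

lemma subgroup_N: "n \<le> j \<Longrightarrow> subgroup (N n j) G"
proof (rule subgroupI)
  assume nj: "n \<le> j"
  note S = subgroup.one_closed[OF sub] subgroup.m_inv_closed[OF sub] subgroup.m_closed[OF sub]
  have "\<kappa> \<one> = 0" using \<kappa>_mult[of \<one> \<one>] by simp
  then show "N n j \<noteq> {}" using S(1)[of j] by (auto simp: core[OF nj])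
  show "N n j \<subseteq> carrier G" using H_carrier by (auto simp: core[OF nj])
  show "inv x \<in> N n j" if "x \<in> N n j" for x
    using that S(2)[of x j] H_carrier by (auto simp: core[OF nj] \<kappa>_inv)
  show "x \<otimes> y \<in> N n j" if "x \<in> N n j" "y \<in> N n j" for x y
    using that S(3)[of x j y] H_carrier by (auto simp: core[OF nj] \<kappa>_mult)
qed

lemma coset_eq_iff:
  assumes nj: "n \<le> j" and x: "x \<in> H j" and y: "y \<in> H j"
  shows "N n j #> x = N n j #> y \<longleftrightarrow> int (r (j - n)) dvd \<kappa> x - \<kappa> y"
proof -
  note c = H_carrier[OF x] H_carrier[OF y]
  have "N n j #> x = N n j #> y \<longleftrightarrow> x \<in> N n j #> y"
    using repr_independence[OF _ c(2) subgroup_N[OF nj]] rcos_self[OF c(1) subgroup_N[OF nj]] by metis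
  also have "\<dots> \<longleftrightarrow> x \<otimes> inv y \<in> N n j"
    by (rule subgroup.rcos_module[OF subgroup_N[OF nj] is_group c(2,1)])
  also have "\<dots> \<longleftrightarrow> int (r (j - n)) dvd \<kappa> x - \<kappa> y"
    using subgroup.m_closed[OF sub x subgroup.m_inv_closed[OF sub y]] c
    by (simp add: core[OF nj] \<kappa>_mult \<kappa>_inv)
  finally show ?thesis .
qed

definition E :: "nat \<Rightarrow> nat \<Rightarrow> int \<Rightarrow> 'a set" where "E n j i = N n j #> s [^] i"

lemma E_eq_iff: "n \<le> j \<Longrightarrow> E n j i = E n j i' \<longleftrightarrow> int (r (j - n)) dvd i - i'"
  unfolding E_def by (subst coset_eq_iff) (auto simp: pow_H \<kappa>_pow)

lemma normal_N: "n \<le> j \<Longrightarrow> N n j \<lhd> G\<lparr>carrier := H j\<rparr>"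
proof -
  assume nj: "n \<le> j"
  interpret Hj: group "G\<lparr>carrier := H j\<rparr>" by (rule subgroup.subgroup_is_group[OF sub is_group])
  have subN: "subgroup (N n j) (G\<lparr>carrier := H j\<rparr>)"
    by (rule subgroup_incl[OF subgroup_N[OF nj] sub]) (auto simp: core[OF nj])
  have "x \<otimes> h \<otimes> inv\<^bsub>G\<lparr>carrier := H j\<rparr>\<^esub> x \<in> N n j" if x: "x \<in> H j" and h: "h \<in> N n j" for x h
  proof -
    have hH: "h \<in> H j" using h by (simp add: core[OF nj])
    have "x \<otimes> h \<otimes> inv x \<in> H j"
      using x hH by (intro subgroup.m_closed[OF sub] subgroup.m_inv_closed[OF sub])
    moreover have "\<kappa> (x \<otimes> h \<otimes> inv x) = \<kappa> h"
      using H_carrier[OF x] H_carrier[OF hH] by (simp add: \<kappa>_mult \<kappa>_inv)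
    ultimately show ?thesis using h m_inv_consistent[OF sub x] by (simp add: core[OF nj])
  qed
  then show ?thesis using subN by (simp add: Hj.normal_inv_iff)
qed

lemma discr_quot_simps:
  assumes nj: "n \<le> j"
  shows "carrier (discr_quot G H n j) = range (E n j)" "E n j i \<otimes>\<^bsub>discr_quot G H n j\<^esub> E n j i' = E n j (i + i')"
    "group (discr_quot G H n j)" "finite (carrier (discr_quot G H n j))"
proof -
  interpret Nn: normal "N n j" "G\<lparr>carrier := H j\<rparr>" by (rule normal_N[OF nj])
  have rc: "N n j #>\<^bsub>G\<lparr>carrier := H j\<rparr>\<^esub> x = N n j #> x" for x by (simp add: r_coset_def)
  have cH: "carrier (discr_quot G H n j) = (\<lambda>x. N n j #> x) ` H j"
    by (auto simp: discr_quot_def FactGroup_def RCOSETS_def rc)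
  have NE: "N n j #> x = E n j (\<kappa> x)" if "x \<in> H j" for x
    unfolding E_def using coset_eq_iff[OF nj that pow_H] by (simp add: \<kappa>_pow)
  show c: "carrier (discr_quot G H n j) = range (E n j)"
    unfolding cH
  proof
    show "(\<lambda>x. N n j #> x) ` H j \<subseteq> range (E n j)" by (rule image_subsetI) (simp only: NE rangeI)
    show "range (E n j) \<subseteq> (\<lambda>x. N n j #> x) ` H j" by (rule image_subsetI) (unfold E_def, rule imageI[OF pow_H])
  qed
  show "E n j i \<otimes>\<^bsub>discr_quot G H n j\<^esub> E n j i' = E n j (i + i')"
    using Nn.rcos_sum[of "s [^] i" "s [^] i'"] pow_H H_carrier[OF s_H]
    by (simp add: discr_quot_def FactGroup_def E_def rc int_pow_mult)
  show "group (discr_quot G H n j)" unfolding discr_quot_def by (rule Nn.factorgroup_is_group)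
  have "E n j i \<in> E n j ` {0..<int (r (j - n))}" for i
  proof -
    have "E n j i = E n j (i mod int (r (j - n)))" by (subst E_eq_iff[OF nj]) (simp add: minus_mod_eq_mult_div)
    then show ?thesis using r_pos[of "j - n"] by (intro image_eqI[of _ _ "i mod int (r (j - n))"]) auto
  qed
  then show "finite (carrier (discr_quot G H n j))" unfolding c by (meson finite_atLeastLessThan_int finite_imageI finite_subset image_subsetI)
qed

text \<open>Covers the bonding maps (n = k, j' = j + 1) and the maps between discriminant groups (j'
  = j) at once: in both, the class of a power of s goes to the class of the same power.\<close>

lemma core_coset_E:
  assumes "n \<le> k" "k \<le> j" "j \<le> j'" shows "core_coset G H k j (E n j' i) = E k j i"
proof -
  have nj: "n \<le> j'" using assms by simp
  note N = subgroup_N[OF assms(2)] subgroup_N[OF nj]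
  have "r (j - k) dvd r (j' - n)" using assms by (intro r_dvd_mono) auto
  then have "int (r (j - k)) dvd int (r (j' - n))" by simp
  then have subs: "N n j' \<subseteq> N k j"
    using H_mono[OF assms(3)] dvd_trans by (auto simp: core[OF assms(2)] core[OF nj])
  have "N k j <#> N n j' = N k j"
  proof
    show "N k j <#> N n j' \<subseteq> N k j"
      using subs subgroup.m_closed[OF N(1)] by (auto simp: set_mult_def)
    show "N k j \<subseteq> N k j <#> N n j'"
    proof
      fix x assume x: "x \<in> N k j"
      then have "x = x \<otimes> \<one>" using subgroup.mem_carrier[OF N(1)] by simp
      then show "x \<in> N k j <#> N n j'" unfolding set_mult_def using x subgroup.one_closed[OF N(2)] by blast
    qed
  qed
  then show ?thesis unfolding core_coset_def E_def
    using setmult_rcos_assoc[OF subgroup.subset[OF N(1)] subgroup.subset[OF N(2)] H_carrier[OF pow_H]] by simp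
qed

lemma inverse_system: "finite_inverse_system n (discr_quot G H n) (core_coset G H n)"
proof (rule finite_inverse_system.intro)
  fix j assume j: "n \<le> j"
  show "group (discr_quot G H n j)" "finite (carrier (discr_quot G H n j))" using discr_quot_simps[OF j] by auto
  have j': "n \<le> Suc j" using j by simp
  show "core_coset G H n j \<in> hom (discr_quot G H n (Suc j)) (discr_quot G H n j)"
    by (rule homI) (auto simp: discr_quot_simps[OF j] discr_quot_simps[OF j'] core_coset_E j)
qed

text \<open>Integer representatives for the inverse limit of the integers modulo \<open>r t\<close>;
  different sequences may represent the same element.\<close>

definition Z :: "(nat \<Rightarrow> int) set" where "Z = {i. \<forall>t. int (r t) dvd i (Suc t) - i t}"

text \<open>The shift by n lets the same sequence i serve as coordinates on the discriminant group
  of every index.\<close>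

definition xs :: "nat \<Rightarrow> (nat \<Rightarrow> int) \<Rightarrow> nat \<Rightarrow> 'a set" where "xs n i = (\<lambda>j\<in>{n..}. E n j (i (j - n)))"

lemma Z_mono:
  assumes "i \<in> Z" "t \<le> u" shows "int (r t) dvd i u - i t"
  using assms(2)
proof (induction u rule: dec_induct)
  case (step u)
  have "int (r t) dvd int (r u)" using r_dvd_mono[OF step(1)] by simp
  moreover have "int (r u) dvd i (Suc u) - i u" using assms(1) by (simp add: Z_def)
  ultimately have "int (r t) dvd i (Suc u) - i u" by (rule dvd_trans)
  then have "int (r t) dvd (i (Suc u) - i u) + (i u - i t)" using step.IH by (rule dvd_add)
  then show ?case by simp
qed simp

lemma carrier_discr_group: "carrier (discr_group G H n) = xs n ` Z"
proof -
  interpret S: finite_inverse_system n "discr_quot G H n" "core_coset G H n" by (rule inverse_system)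
  show ?thesis
  proof (intro equalityI subsetI)
    fix x assume "x \<in> carrier (discr_group G H n)"
    then have x: "x \<in> (\<Pi>\<^sub>E j\<in>{n..}. carrier (discr_quot G H n j))" "\<And>j. j \<ge> n \<Longrightarrow> core_coset G H n j (x (Suc j)) = x j"
      by (auto simp: discr_group_def S.carrier_D)
    have "\<exists>i. x (n + t) = E n (n + t) i" for t
      using x(1) discr_quot_simps(1)[of n "n + t"] by (auto dest!: PiE_mem[of _ _ _ "n + t"])
    then obtain i where i: "\<And>t. x (n + t) = E n (n + t) (i t)" by metis
    have "i \<in> Z" unfolding Z_def
    proof (intro CollectI allI)
      fix t
      have "E n (n + t) (i (Suc t)) = E n (n + t) (i t)"
        using x(2)[of "n + t"] i[of t] i[of "Suc t"] core_coset_E[of n n "n + t" "Suc (n + t)"] by simp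
      then show "int (r t) dvd i (Suc t) - i t" by (simp add: E_eq_iff)
    qed
    moreover have "x = xs n i"
    proof (rule extensionalityI)
      show "x \<in> extensional {n..}" using x(1) by (simp add: PiE_def)
      show "xs n i \<in> extensional {n..}" by (simp add: xs_def)
      show "x j = xs n i j" if "j \<in> {n..}" for j using that i[of "j - n"] by (simp add: xs_def)
    qed
    ultimately show "x \<in> xs n ` Z" by blast
  next
    fix x assume "x \<in> xs n ` Z"
    then obtain i where i: "i \<in> Z" "x = xs n i" by blast
    have "core_coset G H n j (x (Suc j)) = x j" if "j \<ge> n" for j
    proof -
      have "int (r (j - n)) dvd i (Suc j - n) - i (j - n)" using Z_mono[OF i(1), of "j - n" "Suc j - n"] by simp
      then show ?thesis using that by (simp add: i(2) xs_def core_coset_E E_eq_iff)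
    qed
    then show "x \<in> carrier (discr_group G H n)"
      by (auto simp: discr_group_def S.carrier_D discr_quot_simps i(2) xs_def)
  qed
qed

lemma xs_eq_iff: "xs n i = xs n i' \<longleftrightarrow> (\<forall>t. int (r t) dvd i t - i' t)"
proof
  assume eq: "xs n i = xs n i'"
  show "\<forall>t. int (r t) dvd i t - i' t"
  proof
    fix t
    have "xs n i (n + t) = xs n i' (n + t)" using eq by simp
    then show "int (r t) dvd i t - i' t" by (simp add: xs_def E_eq_iff)
  qed
qed (auto simp: xs_def fun_eq_iff restrict_def E_eq_iff)

lemma xs_mult: "xs n i \<otimes>\<^bsub>discr_group G H n\<^esub> xs n i' = xs n (\<lambda>t. i t + i' t)"
proof -
  interpret S: finite_inverse_system n "discr_quot G H n" "core_coset G H n" by (rule inverse_system)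
  show ?thesis by (auto simp: discr_group_def S.mult_D xs_def restrict_def fun_eq_iff discr_quot_simps)
qed

text \<open>At level j the source carries the entry of i at j - n and the target the entry at j - k.
  These agree modulo r(j - k) by compatibility, so in the coordinates \<open>xs\<close> the map is
  the identity.\<close>

lemma discr_map_xs:
  assumes "n \<le> k" "i \<in> Z" shows "discr_map G H k (xs n i) = xs k i"
proof -
  have "core_coset G H k j (xs n i j) = E k j (i (j - k))" if "j \<ge> k" for j
  proof -
    have "int (r (j - k)) dvd i (j - n) - i (j - k)" using assms by (intro Z_mono) auto
    then show ?thesis using that assms by (simp add: xs_def core_coset_E E_eq_iff)
  qed
  then show ?thesis by (auto simp: discr_map_def xs_def restrict_def fun_eq_iff)
qed

lemma discr_map_iso:
  assumes "n \<le> k" shows "discr_map G H k \<in> iso (discr_group G H n) (discr_group G H k)"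
proof -
  have add: "(\<lambda>t. i t + i' t) \<in> Z" if "i \<in> Z" "i' \<in> Z" for i i'
  proof -
    have "int (r t) dvd (i (Suc t) - i t) + (i' (Suc t) - i' t)" for t
      using that by (intro dvd_add) (auto simp: Z_def)
    then show ?thesis by (simp add: Z_def algebra_simps)
  qed
  have "discr_map G H k \<in> hom (discr_group G H n) (discr_group G H k)"
    by (rule homI) (auto simp: carrier_discr_group discr_map_xs[OF assms] xs_mult add)
  moreover have "bij_betw (discr_map G H k) (xs n ` Z) (xs k ` Z)"
    unfolding bij_betw_def
  proof
    show "inj_on (discr_map G H k) (xs n ` Z)"
      by (rule inj_onI) (auto simp: discr_map_xs[OF assms] xs_eq_iff)
    show "discr_map G H k ` xs n ` Z = xs k ` Z"
      unfolding image_image by (rule image_cong) (simp_all add: discr_map_xs[OF assms])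
  qed
  ultimately show ?thesis by (simp add: iso_def carrier_discr_group)
qed

lemma cantor_discr_group: "cantor_group (discr_group G H n) (discr_topology G H n)"
proof -
  interpret S: finite_inverse_system n "discr_quot G H n" "core_coset G H n" by (rule inverse_system)
  show ?thesis unfolding discr_group_def discr_topology_def
  proof (rule S.cantor_group_D)
    fix x j assume x: "x \<in> carrier (inv_limit n (discr_quot G H n) (core_coset G H n))" and j: "n \<le> j"
    then obtain i where i: "i \<in> Z" "x = xs n i" using carrier_discr_group[of n] by (auto simp: discr_group_def)
    \<comment> \<open>Adding the constant r(j - n) is invisible at level j, but it is seen further
      up because the moduli are unbounded.\<close>
    define i' where "i' t = i t + int (r (j - n))" for t
    have "i' \<in> Z" using i(1) by (simp add: Z_def i'_def)
    then have "xs n i' \<in> carrier (inv_limit n (discr_quot G H n) (core_coset G H n))"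
      using carrier_discr_group[of n] by (auto simp: discr_group_def)
    moreover have "xs n i' j = x j" using j by (simp add: i(2) xs_def E_eq_iff i'_def)
    moreover have "xs n i' \<noteq> x"
    proof
      assume "xs n i' = x"
      then have all: "int (r t) dvd int (r (j - n))" for t
        unfolding i(2) xs_eq_iff by (simp add: i'_def)
      obtain t where "r t > r (j - n)" using r_unbounded by blast
      moreover have "r t dvd r (j - n)" using all[of t] by simp
      ultimately show False using r_pos[of "j - n"] by (meson dvd_imp_le not_le)
    qed
    ultimately show "\<exists>y\<in>carrier (inv_limit n (discr_quot G H n) (core_coset G H n)). y j = x j \<and> y \<noteq> x" by blast
  qed
qed

end

section \<open>The Galois groups of the iterates\<close>

context kummer_tower
begin

lemma cyclic_chain_Gc: "cyclic_chain B Gc \<kappa> bs so"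
proof (intro cyclic_chain.intro cyclic_chain_axioms.intro group_B)
  show "bs \<in> Gc n" for n unfolding Gc_generate by (rule generate.incl) simp
  show "so n dvd so (Suc n)" for n by (rule so_dvd) simp
qed (simp_all add: subgroup_Gc Gc_Suc \<kappa>_mult \<kappa>_gens so_pos so_unbounded chain_core_Gc)

lemma main_properties:
  defines "c \<equiv> \<lambda>_ :: nat. 1 :: int" and "s \<equiv> \<lambda>n. int (so n)"
  shows "mono s \<and> \<not> bdd_above (range s) \<and>
    (\<forall>n. \<phi> n \<in> iso (presented_group (bs_quot_rels q (c n * int (d ^ n)) (s n))) (iter_galois ff n)) \<and>
    \<Theta> \<in> hom (BS q) (arboreal_group ff) \<and>
    (\<forall>n. \<Theta> (bs_tau q) n = \<phi> n (pres_gen (bs_quot_rels q (c n * int (d ^ n)) (s n)) GTau) \<and>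
         \<Theta> (bs_sigma q) n = \<phi> n (pres_gen (bs_quot_rels q (c n * int (d ^ n)) (s n)) GSigma)) \<and>
    (\<forall>n. let C = generate (BS q) {bs_tau q [^]\<^bsub>BS q\<^esub> (c n * int (d ^ n)),
                                  bs_sigma q [^]\<^bsub>BS q\<^esub> s n}
         in C \<lhd> BS q \<and>
            (\<lambda>A. the_elem ((\<lambda>g. \<Theta> g n) ` A)) \<in> iso (BS q Mod C) (iter_galois ff n)) \<and>
    (\<lambda>g. tree_act ff (\<Theta> g)) \<in> hom (BS q) (tree_aut ff) \<and>
    (\<forall>n. transitive_action (BS q) (preims ff n) (\<lambda>g. restrict (\<Theta> g n) (preims ff n))) \<and>
    group_action (BS q) (path_space ff) (\<lambda>g. path_act ff (\<Theta> g)) \<and>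
    (\<forall>g\<in>carrier (BS q).
       homeomorphic_map (path_topology ff) (path_topology ff) (path_act ff (\<Theta> g))) \<and>
    (\<exists>v\<in>path_space ff.
       let G = group_chain (BS q) (\<lambda>g. tree_act ff (\<Theta> g)) v
       in (\<forall>n. G n = generate (BS q) {bs_tau q [^]\<^bsub>BS q\<^esub> (c n * int (d ^ n)), bs_sigma q}) \<and>
          G 0 = carrier (BS q) \<and>
          (\<forall>n. cantor_group (discr_group (BS q) G n) (discr_topology (BS q) G n)) \<and>
          (\<forall>n k. n < k \<longrightarrow>
             discr_map (BS q) G k \<in> iso (discr_group (BS q) G n) (discr_group (BS q) G k)) \<and>
          stable_chain (BS q) G)"
proof -
  interpret CC: cyclic_chain B Gc \<kappa> bs so by (rule cyclic_chain_Gc)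
  have m1: "mono s" unfolding s_def by (rule monoI) (simp add: so_mono)
  have m2: "\<not> bdd_above (range s)"
  proof
    assume "bdd_above (range s)"
    then obtain M where M: "\<And>n. int (so n) \<le> M" unfolding s_def bdd_above_def by auto
    obtain n where "so n > nat M" using so_unbounded by blast
    then show False using M[of n] by linarith
  qed
  have m3: "\<phi> n \<in> iso (presented_group (bs_quot_rels q (c n * int (d ^ n)) (s n))) (iter_galois ff n)" for n
    using \<phi>_iso[of n] unfolding c_def s_def quot_rels_def iter_galois_eq .
  have m4: "\<Theta> (bs_tau q) n = \<phi> n (pres_gen (bs_quot_rels q (c n * int (d ^ n)) (s n)) GTau)"
    "\<Theta> (bs_sigma q) n = \<phi> n (pres_gen (bs_quot_rels q (c n * int (d ^ n)) (s n)) GSigma)" for n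
    using \<phi>_gens[of n] \<Theta>_gens[of n] unfolding c_def s_def quot_rels_def by simp_all
  have m5: "let C = generate (BS q) {bs_tau q [^]\<^bsub>BS q\<^esub> (c n * int (d ^ n)), bs_sigma q [^]\<^bsub>BS q\<^esub> s n}
         in C \<lhd> BS q \<and>
            (\<lambda>A. the_elem ((\<lambda>g. \<Theta> g n) ` A)) \<in> iso (BS q Mod C) (iter_galois ff n)" for n
    using C_normal[of n] C_quotient[of n] unfolding c_def s_def C_def iter_galois_eq Let_def by blast
  have m6: "\<exists>v\<in>path_space ff.
       let G = group_chain (BS q) (\<lambda>g. tree_act ff (\<Theta> g)) v
       in (\<forall>n. G n = generate (BS q) {bs_tau q [^]\<^bsub>BS q\<^esub> (c n * int (d ^ n)), bs_sigma q}) \<and>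
          G 0 = carrier (BS q) \<and>
          (\<forall>n. cantor_group (discr_group (BS q) G n) (discr_topology (BS q) G n)) \<and>
          (\<forall>n k. n < k \<longrightarrow>
             discr_map (BS q) G k \<in> iso (discr_group (BS q) G n) (discr_group (BS q) G k)) \<and>
          stable_chain (BS q) G"
  proof (rule bexI[OF _ v_path], unfold Let_def, intro conjI allI impI)
    show "Gc n = generate (BS q) {bs_tau q [^]\<^bsub>BS q\<^esub> (c n * int (d ^ n)), bs_sigma q}" for n
      unfolding c_def by (rule Gc_generate)
    show "Gc 0 = carrier (BS q)" by (rule Gc_0)
    show "cantor_group (discr_group (BS q) Gc n) (discr_topology (BS q) Gc n)" for n by (rule CC.cantor_discr_group)
    show "discr_map (BS q) Gc k \<in> iso (discr_group (BS q) Gc n) (discr_group (BS q) Gc k)" if "n < k" for n k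
      using that by (intro CC.discr_map_iso) simp
    show "stable_chain (BS q) Gc"
      unfolding stable_chain_def by (intro exI[of _ 0] allI impI CC.discr_map_iso) simp
  qed
  show ?thesis
    by (intro conjI allI ballI m1 m2 m3 \<Theta>_arboreal m4 m5 tree_act_hom level_action path_action
        path_act_homeomorphic m6)
qed

end

text \<open>Any root of 1 + X + ... + X^(d-1) will do: its value at 1 is d, which is
  nonzero.\<close>

lemma nontrivial_root_of_unity:
  assumes "d > 1" obtains w :: "'k::field_char_0 alg_closure" where "w ^ d = 1" "w \<noteq> 1"
proof -
  define P :: "'k alg_closure poly" where "P = (\<Sum>i<d. Polynomial.monom 1 i)"
  have "Polynomial.coeff P (d - 1) = 1" using assms by (simp add: P_def coeff_sum)
  then have "Polynomial.degree P \<ge> d - 1" by (intro le_degree) simp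
  then have "Polynomial.degree P > 0" using assms by simp
  then obtain w where w: "poly P w = 0" using alg_closed_imp_poly_has_root by blast
  have Pw: "poly P x = (\<Sum>i<d. x ^ i)" for x by (simp add: P_def poly_sum poly_monom)
  have "w ^ d - 1 = 0" using w power_diff_1_eq[of w d] by (simp add: Pw)
  moreover have "w \<noteq> 1" using w assms by (auto simp: Pw)
  ultimately show ?thesis using that by simp
qed

lemma (in unram_field) kummer_tower_exists:
  assumes "Factorial_Ring.prime d" "odd d" "p \<noteq> d"
  shows "\<exists>\<zeta> \<pi>. kummer_tower A Ok R T p q m d \<zeta> \<pi>"
proof -
  have d1: "d > 1" using assms(1) prime_gt_1_nat by blast
  obtain w :: "'k alg_closure" where w: "w ^ d = 1" "w \<noteq> 1" using nontrivial_root_of_unity[OF d1] by blast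
  define rt where "rt x = (SOME y. y ^ d = x)" for x :: "'k alg_closure"
  have rt: "rt x ^ d = x" for x
    unfolding rt_def by (rule someI_ex) (use nth_root_exists[of d x] d1 in auto)
  \<comment> \<open>The sequence begins with 1 and w and continues with successive d-th roots of w,
    so \<open>\<zeta> 1\<close> is the nontrivial root w.\<close>
  define \<zeta> where "\<zeta> n = (case n of 0 \<Rightarrow> 1 | Suc k \<Rightarrow> (rt ^^ k) w)" for n
  define \<pi> where "\<pi> n = (rt ^^ n) pp" for n
  have "kummer_tower A Ok R T p q m d \<zeta> \<pi>"
  proof (intro kummer_tower.intro kummer_tower_axioms.intro assms unram_field_axioms)
    show "\<zeta> (Suc n) ^ d = \<zeta> n" for n by (cases n) (simp_all add: \<zeta>_def rt w)
  qed (simp_all add: \<zeta>_def \<pi>_def rt w)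
  then show ?thesis by blast
qed
theorem theorem1p9:
  fixes p d m q :: nat
    and Qp :: "'k::field_char_0 set" and absv :: "'k \<Rightarrow> real"
    and f :: "'k poly"
  assumes "Factorial_Ring.prime p" and "odd p" and "Factorial_Ring.prime d" and "odd d" and "p \<noteq> d"
    and "padic_field p Qp absv"
    and "ring.finite_dimension (ring_of_type_algebra :: 'k ring) Qp UNIV"
    and "unramified p Qp absv"
    and "q = p ^ m"
    and "finite (carrier (residue_field Qp absv))"
    and "card (carrier (residue_field Qp absv)) = q"
    and "f = [:of_nat p, 1:] ^ d - [:of_nat p:]"
  shows "\<exists>(c :: nat \<Rightarrow> int) (s :: nat \<Rightarrow> int)
           (\<phi> :: nat \<Rightarrow> bs_gen word set \<Rightarrow> 'k alg_closure \<Rightarrow> 'k alg_closure)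
           (\<Theta> :: bs_gen word set \<Rightarrow> nat \<Rightarrow> 'k alg_closure \<Rightarrow> 'k alg_closure).
    mono s \<and> \<not> bdd_above (range s) \<and>
    (\<forall>n. \<phi> n \<in> iso (presented_group (bs_quot_rels q (c n * int (d ^ n)) (s n))) (iter_galois f n)) \<and>
    \<Theta> \<in> hom (BS q) (arboreal_group f) \<and>
    (\<forall>n. \<Theta> (bs_tau q) n = \<phi> n (pres_gen (bs_quot_rels q (c n * int (d ^ n)) (s n)) GTau) \<and>
         \<Theta> (bs_sigma q) n = \<phi> n (pres_gen (bs_quot_rels q (c n * int (d ^ n)) (s n)) GSigma)) \<and>
    (\<forall>n. let C = generate (BS q) {bs_tau q [^]\<^bsub>BS q\<^esub> (c n * int (d ^ n)),
                                  bs_sigma q [^]\<^bsub>BS q\<^esub> s n}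
         in C \<lhd> BS q \<and>
            (\<lambda>A. the_elem ((\<lambda>g. \<Theta> g n) ` A)) \<in> iso (BS q Mod C) (iter_galois f n)) \<and>
    (\<lambda>g. tree_act f (\<Theta> g)) \<in> hom (BS q) (tree_aut f) \<and>
    (\<forall>n. transitive_action (BS q) (preims f n) (\<lambda>g. restrict (\<Theta> g n) (preims f n))) \<and>
    group_action (BS q) (path_space f) (\<lambda>g. path_act f (\<Theta> g)) \<and>
    (\<forall>g\<in>carrier (BS q).
       homeomorphic_map (path_topology f) (path_topology f) (path_act f (\<Theta> g))) \<and>
    (\<exists>v\<in>path_space f.
       let G = group_chain (BS q) (\<lambda>g. tree_act f (\<Theta> g)) v
       in (\<forall>n. G n = generate (BS q) {bs_tau q [^]\<^bsub>BS q\<^esub> (c n * int (d ^ n)), bs_sigma q}) \<and>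
          G 0 = carrier (BS q) \<and>
          (\<forall>n. cantor_group (discr_group (BS q) G n) (discr_topology (BS q) G n)) \<and>
          (\<forall>n k. n < k \<longrightarrow>
             discr_map (BS q) G k \<in> iso (discr_group (BS q) G n) (discr_group (BS q) G k)) \<and>
          stable_chain (BS q) G)"
proof -
  interpret U: unram_extension p q m Qp absv
    by unfold_locales (use assms in simp_all)
  interpret K: unram_field U.A U.Ok U.Zp U.T p q m by (rule U.unram_field)
  obtain \<zeta> \<pi> where "kummer_tower U.A U.Ok U.Zp U.T p q m d \<zeta> \<pi>"
    using K.kummer_tower_exists[OF \<open>Factorial_Ring.prime d\<close> \<open>odd d\<close> \<open>p \<noteq> d\<close>] by blast
  then interpret T: kummer_tower U.A U.Ok U.Zp U.T p q m d \<zeta> \<pi> .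
  show ?thesis
    unfolding \<open>f = [:of_nat p, 1:] ^ d - [:of_nat p:]\<close>
    by (intro exI) (rule T.main_properties)
qed

end
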